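(* Let $n\ge 2$ and $1\le r\le n-1$. The automorphism group $\mathrm{Aut}(T_{n,r})$ is isomorphic to the group $\mathcal{TB}_{n,r}$ consisting of those elements of $\mathcal R_{n,r}$ which can be represented by bi-synchronizing transducers and which respect the cyclic ordering of $\mathfrak C_{n,r}$, i.e. preserve the relation $\simeq$ on $\mathfrak C_{n,r}$.
   Context: Notation. Maps act on the right. $X_n=\{0,\ldots,n-1\}$; $X_n^*$ (resp. $X_n^k$) is the set of finite words (words of length $k$) over $X_n$; $\epsilon$ is the empty word; $\dot{\mathbf r}=\{\dot 0,\ldots,\dot{(r-1)}\}$ is a further ordered alphabet; $X_{n,r}^+=\{\dot a w:\dot a\in\dot{\mathbf r},\,w\in X_n^*\}$, $X_{n,r}^*=X_{n,r}^+\cup\{\epsilon\}$. $\mathfrak C_n=X_n^\omega$ and $\mathfrak C_{n,r}=\{\dot a x:\dot a\in\dot{\mathbf r},\,x\in\mathfrak C_n\}$ are Cantor spaces; $U_\nu$ is the set of infinite words with prefix $\nu$. The group $T_{n,r}$. A complete antichain is a finite set of pairwise prefix-incomparable words $u\in X_{n,r}^+$ whose sets $U_u$ cover $\mathfrak C_{n,r}$; it is listed in lexicographic order. $T_{n,r}$ is the group of homeomorphisms $g$ of $\mathfrak C_{n,r}$ for which there are complete antichains $\{u_0,\ldots,u_{l-1}\}$, $\{v_0,\ldots,v_{l-1}\}$ of the same size and a fixed $j$ with $(u_i x)g=v_{(i+j)\bmod l}\,x$ for all $i$ and all $x\in\mathfrak C_n$. The relation $\simeq$ on $\mathfrak C_{n,r}$: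 $x\simeq y$ iff $x=y$, or $\{x,y\}=\{w\,i\,000\ldots,\;w\,(i-1)(n-1)(n-1)\ldots\}$ with $w\in X_{n,r}^+$ and $0<i\le n-1$, or $\{x,y\}=\{\dot a\,00\ldots,\;\dot{(a-1)}(n-1)(n-1)\ldots\}$ with $0<a\le r-1$, or $\{x,y\}=\{\dot 0\,00\ldots,\;\dot{(r-1)}(n-1)(n-1)\ldots\}$. The quotient $\mathfrak C_{n,r}/\!\simeq$ is the circle $\mathbb R/r\mathbb Z$. A homeomorphism $h$ preserves $\simeq$ if $x\simeq y$ implies $(x)h\simeq (y)h$. Transducers over $\mathfrak C_{n,r}$. An initial transducer $A_{q_0}$ over $\mathfrak C_{n,r}$ has a state set $Q=R\sqcup S$ with $R$ finite, an initial state $q_0\in R$, a transition function $\pi$ and an output function $\lambda$, both defined on $(\dot{\mathbf r}\times\{q_0\})\sqcup(X_n\times(Q\setminus\{q_0\}))$, $\pi$ with values in $Q\setminus\{q_0\}$ and $\lambda$ with values in $X_{n,r}^*\sqcup X_n^*$, such that: a transition from a state of $R$ outputs $\epsilon$ if it ends in $R$ and a word of $X_{n,r}^+$ if it ends in $S$; transitions from states of $S$ end in $S$ with output in $X_n^*$; every infinite word read from a state of $S$ gives infinite output; no state of $R$ lies on a cycle. $\pi,\lambda$ are extended to words by $\pi(wi,q)=\pi(i,\pi(w,q))$, $\lambda(wi,q)=\lambda(w,q)\lambda(i,\pi(w,q))$. Reading from state $q$ gives a continuous map $h_q$; $A_{q_0}$ represents $h_{q_0}:\mathfrak C_{n,r}\to\mathfrak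 C_{n,r}$. $A_{q_0}$ is minimal if all states are reachable from $q_0$, $h_q\ne h_p$ for distinct states $q,p$, and for every state $q$ and letter $i$ readable from $q$, $\lambda(i,q)$ is the greatest common prefix of $\{(i\delta)h_q:\delta\in\mathfrak C_n\}$. Each homeomorphism of $\mathfrak C_{n,r}$ is represented by a unique minimal transducer (up to renaming states). $\mathcal R_{n,r}$ is the group of homeomorphisms of $\mathfrak C_{n,r}$ whose minimal transducer is finite. A transducer is synchronizing if for some $k$ the state reached by reading a word of length $k$ from any state from which it can be read depends only on the word. A homeomorphism is represented by a bi-synchronizing transducer if the minimal transducers of it and of its inverse are both synchronizing. *)

theory Defs
  imports
    "HOL-Analysis.Analysis"
    "HOL-Algebra.Bij"
    "HOL-Library.Stream"
    "HOL-Library.Sublist"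
begin

section \<open>Words and Cantor spaces\<close>

datatype letter = Dotted nat | Plain nat

abbreviation alphabet :: "nat \<Rightarrow> letter set" where
  "alphabet n \<equiv> Plain ` {..<n}"

abbreviation dotted_alphabet :: "nat \<Rightarrow> letter set" where
  "dotted_alphabet r \<equiv> Dotted ` {..<r}"

definition words :: "nat \<Rightarrow> letter list set" where
  "words n = lists (alphabet n)"

definition words_plus :: "nat \<Rightarrow> nat \<Rightarrow> letter list set" where
  "words_plus n r = {a # w | a w. a \<in> dotted_alphabet r \<and> w \<in> words n}"

definition words_star :: "nat \<Rightarrow> nat \<Rightarrow> letter list set" where
  "words_star n r = words_plus n r \<union> {[]}"

definition cantor1 :: "nat \<Rightarrow> letter stream set" where
  "cantor1 n = streams (alphabet n)"

definition cantor :: "nat \<Rightarrow> nat \<Rightarrow> letter stream set" where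
  "cantor n r = {a ## x | a x. a \<in> dotted_alphabet r \<and> x \<in> cantor1 n}"

definition has_prefix :: "letter list \<Rightarrow> letter stream \<Rightarrow> bool" where
  "has_prefix u x \<longleftrightarrow> stake (length u) x = u"

definition cone :: "nat \<Rightarrow> nat \<Rightarrow> letter list \<Rightarrow> letter stream set" where
  "cone n r u = {x \<in> cantor n r. has_prefix u x}"

text \<open>The topology induced from the product of discrete alphabets, a stream being identified
  with its sequence of entries.\<close>

definition cantor_top :: "nat \<Rightarrow> nat \<Rightarrow> letter stream topology" where
  "cantor_top n r =
     pullback_topology (cantor n r) snth (product_topology (\<lambda>_. discrete_topology UNIV) UNIV)"

text \<open>Maps are made extensional outside the Cantor space, so that they are elements of
  \<^const>\<open>BijGroup\<close>.\<close>

definition homeos :: "nat \<Rightarrow> nat \<Rightarrow> (letter stream \<Rightarrow> letter stream) set" where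
  "homeos n r =
     {h \<in> extensional (cantor n r). homeomorphic_map (cantor_top n r) (cantor_top n r) h}"

definition homeo_inv ::
    "nat \<Rightarrow> nat \<Rightarrow> (letter stream \<Rightarrow> letter stream) \<Rightarrow> letter stream \<Rightarrow> letter stream" where
  "homeo_inv n r h = restrict (inv_into (cantor n r) h) (cantor n r)"


section \<open>The group \<open>T\<^bsub>n,r\<^esub>\<close>\<close>

fun letter_less :: "letter \<Rightarrow> letter \<Rightarrow> bool" where
  "letter_less (Dotted a) (Dotted b) \<longleftrightarrow> a < b"
| "letter_less (Plain i) (Plain j) \<longleftrightarrow> i < j"
| "letter_less _ _ \<longleftrightarrow> False"

definition lex_less :: "letter list \<Rightarrow> letter list \<Rightarrow> bool" where
  "lex_less u v \<longleftrightarrow> (u, v) \<in> lexord {(a, b). letter_less a b}"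

definition complete_antichain :: "nat \<Rightarrow> nat \<Rightarrow> letter list set \<Rightarrow> bool" where
  "complete_antichain n r U \<longleftrightarrow>
     finite U \<and> U \<subseteq> words_plus n r \<and>
     (\<forall>u\<in>U. \<forall>v\<in>U. u \<noteq> v \<longrightarrow> \<not> prefix u v \<and> \<not> prefix v u) \<and>
     cantor n r \<subseteq> (\<Union>u\<in>U. cone n r u)"

definition lists_antichain :: "nat \<Rightarrow> nat \<Rightarrow> letter list list \<Rightarrow> bool" where
  "lists_antichain n r us \<longleftrightarrow> complete_antichain n r (set us) \<and> sorted_wrt lex_less us"

definition T_elements :: "nat \<Rightarrow> nat \<Rightarrow> (letter stream \<Rightarrow> letter stream) set" where
  "T_elements n r =
     {g \<in> homeos n r. \<exists>us vs j.
        lists_antichain n r us \<and> lists_antichain n r vs \<and> length us = length vs \<and>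
        (\<forall>i<length us. \<forall>x\<in>cantor1 n.
           g (us ! i @- x) = vs ! ((i + j) mod length us) @- x)}"

text \<open>The multiplication of \<^const>\<open>BijGroup\<close> is \<open>g \<otimes> f = g \<circ> f\<close>, the opposite of the
  convention for maps acting on the right.  Since a group is isomorphic to its opposite via
  inversion, and a group and its opposite have the same automorphisms, the isomorphism types in
  question are unaffected.\<close>

definition T_group :: "nat \<Rightarrow> nat \<Rightarrow> (letter stream \<Rightarrow> letter stream) monoid" where
  "T_group n r = (BijGroup (cantor n r)) \<lparr>carrier := T_elements n r\<rparr>"


section \<open>The relation whose quotient is the circle\<close>

definition circle_eq :: "nat \<Rightarrow> nat \<Rightarrow> letter stream \<Rightarrow> letter stream \<Rightarrow> bool" where
  "circle_eq n r x y \<longleftrightarrow> x \<in> cantor n r \<and> y \<in> cantor n r \<and>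
     (x = y \<or>
      (\<exists>w\<in>words_plus n r. \<exists>i. 0 < i \<and> i \<le> n - 1 \<and>
         {x, y} = {w @- Plain i ## sconst (Plain 0),
                   w @- Plain (i - 1) ## sconst (Plain (n - 1))}) \<or>
      (\<exists>a. 0 < a \<and> a \<le> r - 1 \<and>
         {x, y} = {Dotted a ## sconst (Plain 0),
                   Dotted (a - 1) ## sconst (Plain (n - 1))}) \<or>
      {x, y} = {Dotted 0 ## sconst (Plain 0),
                Dotted (r - 1) ## sconst (Plain (n - 1))})"

definition preserves_circle_eq ::
    "nat \<Rightarrow> nat \<Rightarrow> (letter stream \<Rightarrow> letter stream) \<Rightarrow> bool" where
  "preserves_circle_eq n r h \<longleftrightarrow> (\<forall>x y. circle_eq n r x y \<longrightarrow> circle_eq n r (h x) (h y))"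


section \<open>Transducers\<close>

text \<open>The state set is the disjoint union of \<open>Rstates\<close> and \<open>Sstates\<close>.  The functions \<open>step\<close> and
  \<open>out\<close> are total, but only their values at readable letters are ever constrained or used.\<close>

record 's transducer =
  Rstates :: "'s set"
  Sstates :: "'s set"
  start :: 's
  step :: "letter \<Rightarrow> 's \<Rightarrow> 's"
  out :: "letter \<Rightarrow> 's \<Rightarrow> letter list"

definition states :: "'s transducer \<Rightarrow> 's set" where
  "states A = Rstates A \<union> Sstates A"

definition readable :: "nat \<Rightarrow> nat \<Rightarrow> 's transducer \<Rightarrow> letter \<Rightarrow> 's \<Rightarrow> bool" where
  "readable n r A i q \<longleftrightarrow>
     i \<in> dotted_alphabet r \<and> q = start A \<or> i \<in> alphabet n \<and> q \<in> states A - {start A}"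

primrec readable_word ::
    "nat \<Rightarrow> nat \<Rightarrow> 's transducer \<Rightarrow> letter list \<Rightarrow> 's \<Rightarrow> bool" where
  "readable_word n r A [] q \<longleftrightarrow> q \<in> states A"
| "readable_word n r A (i # w) q \<longleftrightarrow> readable n r A i q \<and> readable_word n r A w (step A i q)"

primrec step_word :: "'s transducer \<Rightarrow> letter list \<Rightarrow> 's \<Rightarrow> 's" where
  "step_word A [] q = q"
| "step_word A (i # w) q = step_word A w (step A i q)"

primrec out_word :: "'s transducer \<Rightarrow> letter list \<Rightarrow> 's \<Rightarrow> letter list" where
  "out_word A [] q = []"
| "out_word A (i # w) q = out A i q @ out_word A w (step A i q)"

lemma step_word_snoc: "step_word A (w @ [i]) q = step A i (step_word A w q)"
  by (induction w arbitrary: q) auto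

lemma out_word_snoc: "out_word A (w @ [i]) q = out_word A w q @ out A i (step_word A w q)"
  by (induction w arbitrary: q) auto

definition transducer :: "nat \<Rightarrow> nat \<Rightarrow> 's transducer \<Rightarrow> bool" where
  "transducer n r A \<longleftrightarrow>
     finite (Rstates A) \<and> Rstates A \<inter> Sstates A = {} \<and> start A \<in> Rstates A \<and>
     (\<forall>q i. readable n r A i q \<longrightarrow>
        step A i q \<in> states A - {start A} \<and> out A i q \<in> words_star n r \<union> words n) \<and>
     (\<forall>q\<in>Rstates A. \<forall>i. readable n r A i q \<longrightarrow>
        (step A i q \<in> Rstates A \<longrightarrow> out A i q = []) \<and>
        (step A i q \<in> Sstates A \<longrightarrow> out A i q \<in> words_plus n r)) \<and>
     (\<forall>q\<in>Sstates A. \<forall>i. readable n r A i q \<longrightarrow>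
        step A i q \<in> Sstates A \<and> out A i q \<in> words n) \<and>
     (\<forall>q\<in>Sstates A. \<forall>x\<in>cantor1 n. \<forall>m. \<exists>k. m \<le> length (out_word A (stake k x) q)) \<and>
     (\<forall>q\<in>Rstates A. \<forall>w. w \<noteq> [] \<and> readable_word n r A w q \<longrightarrow> step_word A w q \<noteq> q)"

definition input_space :: "nat \<Rightarrow> nat \<Rightarrow> 's transducer \<Rightarrow> 's \<Rightarrow> letter stream set" where
  "input_space n r A q = (if q = start A then cantor n r else cantor1 n)"

text \<open>The map \<open>h\<^bsub>q\<^esub>\<close>.  For a transducer and an element of the input space of \<open>q\<close> the output words
  form an unbounded chain of prefixes, so the stream described here exists and is unique.\<close>

definition state_map :: "'s transducer \<Rightarrow> 's \<Rightarrow> letter stream \<Rightarrow> letter stream" where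
  "state_map A q x = (THE y. \<forall>k. has_prefix (out_word A (stake k x) q) y)"

definition represents ::
    "nat \<Rightarrow> nat \<Rightarrow> 's transducer \<Rightarrow> (letter stream \<Rightarrow> letter stream) \<Rightarrow> bool" where
  "represents n r A h \<longleftrightarrow> (\<forall>x\<in>cantor n r. h x = state_map A (start A) x)"

definition same_state_map :: "nat \<Rightarrow> nat \<Rightarrow> 's transducer \<Rightarrow> 's \<Rightarrow> 's \<Rightarrow> bool" where
  "same_state_map n r A p q \<longleftrightarrow>
     input_space n r A p = input_space n r A q \<and>
     (\<forall>x\<in>input_space n r A p. state_map A p x = state_map A q x)"

definition greatest_common_prefix :: "letter list \<Rightarrow> letter stream set \<Rightarrow> bool" where
  "greatest_common_prefix u Y \<longleftrightarrow>
     (\<forall>y\<in>Y. has_prefix u y) \<and> (\<forall>v. (\<forall>y\<in>Y. has_prefix v y) \<longrightarrow> prefix v u)"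

definition minimal :: "nat \<Rightarrow> nat \<Rightarrow> 's transducer \<Rightarrow> bool" where
  "minimal n r A \<longleftrightarrow>
     transducer n r A \<and>
     (\<forall>q\<in>states A. \<exists>w. readable_word n r A w (start A) \<and> step_word A w (start A) = q) \<and>
     (\<forall>p\<in>states A. \<forall>q\<in>states A. p \<noteq> q \<longrightarrow> \<not> same_state_map n r A p q) \<and>
     (\<forall>q\<in>states A. \<forall>i. readable n r A i q \<longrightarrow>
        greatest_common_prefix (out A i q) {state_map A q (i ## x) | x. x \<in> cantor1 n})"

definition synchronizing :: "nat \<Rightarrow> nat \<Rightarrow> 's transducer \<Rightarrow> bool" where
  "synchronizing n r A \<longleftrightarrow>
     (\<exists>k. \<forall>w p q. length w = k \<and> readable_word n r A w p \<and> readable_word n r A w q \<longrightarrow>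
        step_word A w p = step_word A w q)"

text \<open>A minimal transducer has countably many states, all being reachable, so no generality is
  lost by taking its states to be natural numbers.  As the minimal transducer of a homeomorphism
  is unique up to renaming states, the existential quantifiers below speak about that one.\<close>

definition rational_homeos :: "nat \<Rightarrow> nat \<Rightarrow> (letter stream \<Rightarrow> letter stream) set" where
  "rational_homeos n r =
     {h \<in> homeos n r. \<exists>A :: nat transducer.
        minimal n r A \<and> represents n r A h \<and> finite (states A)}"

definition sync_homeo :: "nat \<Rightarrow> nat \<Rightarrow> (letter stream \<Rightarrow> letter stream) \<Rightarrow> bool" where
  "sync_homeo n r h \<longleftrightarrow>
     (\<exists>A :: nat transducer. minimal n r A \<and> represents n r A h \<and> synchronizing n r A)"

definition bisync_homeo :: "nat \<Rightarrow> nat \<Rightarrow> (letter stream \<Rightarrow> letter stream) \<Rightarrow> bool" where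
  "bisync_homeo n r h \<longleftrightarrow> sync_homeo n r h \<and> sync_homeo n r (homeo_inv n r h)"

definition TB_elements :: "nat \<Rightarrow> nat \<Rightarrow> (letter stream \<Rightarrow> letter stream) set" where
  "TB_elements n r =
     {h \<in> rational_homeos n r. bisync_homeo n r h \<and> preserves_circle_eq n r h}"

definition TB_group :: "nat \<Rightarrow> nat \<Rightarrow> (letter stream \<Rightarrow> letter stream) monoid" where
  "TB_group n r = (BijGroup (cantor n r)) \<lparr>carrier := TB_elements n r\<rparr>"

end

theory Submission
  imports Defs
begin

text \<open>Every automorphism of \<open>T\<close> is conjugation by a homeomorphism of the Cantor space, by an
  argument of Rubin: disjointness of supports can be detected by commutators, and since the closed
  support of an element of \<open>T\<close> is clopen, the automorphism acts on a base of clopen sets and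
  hence on points.  Two points are \<open>\<simeq>\<close>-equivalent iff they have the same stabilizer in \<open>T\<close>, so
  this homeomorphism preserves \<open>\<simeq>\<close>.

  It remains to see that a homeomorphism preserving \<open>\<simeq>\<close> normalizes \<open>T\<close> iff it is
  bi-synchronizing.  The elements of \<open>T\<close> are the homeomorphisms that preserve \<open>\<simeq>\<close> and locally
  replace prefixes.  If \<open>h\<close> is synchronizing, its action on a cone depends, up to a prefix of the
  output, only on the last letters of the word defining the cone, so conjugation by \<open>h\<close> preserves
  local prefix maps.  Conversely, if \<open>h\<close> normalizes \<open>T\<close>, the elements of \<open>T\<close> which
  move a cone to another one show that \<open>h\<close> acts in the same way on both, up to a prefix and at
  large depth; finitely many such elements suffice to bound this depth.\<close>

section \<open>Reconstructing a space from a group with clopen supports\<close>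

text \<open>The group detects disjointness of supports only up to a power: disjointness implies
  \<open>alg_disjoint\<close>, which in turn only makes the supports of \<open>f\<close> and
  \<open>g [^] 12\<close> disjoint. Here 12 is the least common multiple of 1, ..., 4. The loss is
  harmless because every nonempty open set supports an element with nontrivial twelfth power. No
  cyclic order enters the description of \<open>T\<close>: a prefix replacement keeps tails, so it
  sends right ends \<open>u @- M\<close> of cones to right ends and left ends \<open>u @- Z\<close>
  to left ends, and preserving \<simeq> then forces it to preserve orientation. A general
  homeomorphism preserving \<simeq> may reverse orientation. Synchronization is turned into
  \<open>sync_map\<close>, a property of the local maps of \<open>h\<close>; in the other direction
  the local maps themselves serve as the states of the minimal transducer.\<close>

definition group_comm :: "('a, 'b) monoid_scheme \<Rightarrow> 'a \<Rightarrow> 'a \<Rightarrow> 'a" where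
  "group_comm G a b = a \<otimes>\<^bsub>G\<^esub> b \<otimes>\<^bsub>G\<^esub> inv\<^bsub>G\<^esub> a \<otimes>\<^bsub>G\<^esub> inv\<^bsub>G\<^esub> b"

definition commute :: "('a, 'b) monoid_scheme \<Rightarrow> 'a \<Rightarrow> 'a \<Rightarrow> bool" where
  "commute G a b \<longleftrightarrow> a \<otimes>\<^bsub>G\<^esub> b = b \<otimes>\<^bsub>G\<^esub> a"

text \<open>Rubin's condition: from any \<open>h\<close> that fails to commute with
  \<open>f\<close>, two commutators with elements centralizing \<open>g\<close> produce a nontrivial
  element that still centralizes \<open>g\<close>. It speaks of the group operations only, so every
  automorphism respects it.\<close>

definition alg_disjoint :: "('a, 'b) monoid_scheme \<Rightarrow> 'a \<Rightarrow> 'a \<Rightarrow> bool" where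
  "alg_disjoint G f g \<longleftrightarrow>
     (\<forall>h\<in>carrier G. \<not> commute G f h \<longrightarrow>
        (\<exists>a\<in>carrier G. \<exists>b\<in>carrier G. commute G a g \<and> commute G b g \<and>
           commute G (group_comm G a (group_comm G b h)) g \<and>
           group_comm G a (group_comm G b h) \<noteq> \<one>\<^bsub>G\<^esub>))"

definition act_supp :: "'x topology \<Rightarrow> ('g \<Rightarrow> 'x \<Rightarrow> 'x) \<Rightarrow> 'g \<Rightarrow> 'x set" where
  "act_supp X act g = {x \<in> topspace X. act g x \<noteq> x}"

definition closed_supp :: "'x topology \<Rightarrow> ('g \<Rightarrow> 'x \<Rightarrow> 'x) \<Rightarrow> 'g \<Rightarrow> 'x set" where
  "closed_supp X act g = Abstract_Topology.closure_of X (act_supp X act g)"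

text \<open>\<open>supp_base\<close> together with \<open>open_closed_supp\<close> makes the closed
  supports a base of clopen sets, on which an automorphism will act. \<open>noncommuting\<close>
  feeds the construction of witnesses for \<open>alg_disjoint\<close>, and
  \<open>twelfth_power\<close> keeps the power in \<open>alg_disjoint_disjoint\<close> from being
  trivial.\<close>

locale rubin_action = group G for G (structure) +
  fixes X :: "'x topology" and act :: "'a \<Rightarrow> 'x \<Rightarrow> 'x"
  assumes act_mult: "\<lbrakk>g \<in> carrier G; h \<in> carrier G; x \<in> topspace X\<rbrakk> \<Longrightarrow> act (g \<otimes> h) x = act g (act h x)"
    and act_one: "x \<in> topspace X \<Longrightarrow> act \<one> x = x"
    and act_faithful: "\<lbrakk>g \<in> carrier G; \<And>x. x \<in> topspace X \<Longrightarrow> act g x = x\<rbrakk> \<Longrightarrow> g = \<one>"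
    and act_continuous: "g \<in> carrier G \<Longrightarrow> continuous_map X X (act g)"
    and compact: "compact_space X"
    and Hausdorff: "Hausdorff_space X"
    and open_closed_supp: "g \<in> carrier G \<Longrightarrow> openin X (closed_supp X act g)"
    and supp_base: "\<lbrakk>openin X U; x \<in> U\<rbrakk> \<Longrightarrow> \<exists>g\<in>carrier G. x \<in> closed_supp X act g \<and> closed_supp X act g \<subseteq> U"
    and noncommuting: "\<lbrakk>openin X U; U \<noteq> {}\<rbrakk> \<Longrightarrow>
        \<exists>f\<in>carrier G. \<exists>g\<in>carrier G. act_supp X act f \<subseteq> U \<and> act_supp X act g \<subseteq> U \<and> \<not> commute G f g"
    and twelfth_power: "\<lbrakk>openin X U; U \<noteq> {}\<rbrakk> \<Longrightarrow>
        \<exists>g\<in>carrier G. act_supp X act g \<subseteq> U \<and> g [^] (12::nat) \<noteq> \<one>"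
begin

section \<open>Supports, commutation and conjugation\<close>

abbreviation "supp \<equiv> act_supp X act"
abbreviation "csupp \<equiv> closed_supp X act"
abbreviation "com \<equiv> group_comm G"

lemma act_closed: "\<lbrakk>g \<in> carrier G; x \<in> topspace X\<rbrakk> \<Longrightarrow> act g x \<in> topspace X"
  using act_continuous continuous_map_image_subset_topspace by fastforce

lemma act_inv [simp]:
  assumes "g \<in> carrier G" "x \<in> topspace X"
  shows "act (inv g) (act g x) = x" "act g (act (inv g) x) = x"
  using assms act_mult[of "inv g" g x] act_mult[of g "inv g" x] act_one by auto

lemma act_inj: "\<lbrakk>g \<in> carrier G; x \<in> topspace X; y \<in> topspace X\<rbrakk> \<Longrightarrow> act g x = act g y \<longleftrightarrow> x = y"
  by (metis act_inv(1))

lemma act_eqI: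
  assumes "g \<in> carrier G" "h \<in> carrier G" "\<And>x. x \<in> topspace X \<Longrightarrow> act g x = act h x"
  shows "g = h"
proof -
  have "inv h \<otimes> g = \<one>"
    using assms by (intro act_faithful) (auto simp: act_mult act_closed)
  then show ?thesis using assms by (metis inv_closed inv_equality inv_inv l_inv)
qed

lemma suppD: "x \<in> supp g \<Longrightarrow> x \<in> topspace X" and supp_moves: "x \<in> supp g \<Longrightarrow> act g x \<noteq> x"
  and supp_fixes: "\<lbrakk>x \<in> topspace X; x \<notin> supp g\<rbrakk> \<Longrightarrow> act g x = x"
  by (auto simp: act_supp_def)

lemma act_in_supp:
  assumes "g \<in> carrier G" "x \<in> supp g"
  shows "act g x \<in> supp g"
  using assms act_closed[of g x] act_inj[of g "act g x" x] by (auto simp: act_supp_def)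

lemma supp_empty: "g \<in> carrier G \<Longrightarrow> supp g = {} \<longleftrightarrow> g = \<one>"
  using act_faithful act_one by (auto simp: act_supp_def)

lemma commute_iff:
  assumes "g \<in> carrier G" "h \<in> carrier G"
  shows "commute G g h \<longleftrightarrow> (\<forall>x\<in>topspace X. act g (act h x) = act h (act g x))"
proof
  assume "commute G g h"
  then show "\<forall>x\<in>topspace X. act g (act h x) = act h (act g x)"
    using assms by (metis act_mult commute_def)
next
  assume "\<forall>x\<in>topspace X. act g (act h x) = act h (act g x)"
  then show "commute G g h"
    unfolding commute_def using assms by (intro act_eqI) (auto simp: act_mult)
qed

lemma commute_sym: "commute G g h \<longleftrightarrow> commute G h g"
  by (auto simp: commute_def)

lemma commute_supp:
  assumes "g \<in> carrier G" "h \<in> carrier G" "commute G g h" "x \<in> supp g"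
  shows "act h x \<in> supp g"
proof -
  have "x \<in> topspace X" using assms suppD by auto
  then show ?thesis
    using assms act_closed[of h x] act_inj[of h "act g x" x] act_closed[of g x] commute_iff[of g h]
    by (auto simp: act_supp_def)
qed

lemma commute_disjoint:
  assumes gh: "g \<in> carrier G" "h \<in> carrier G" and dis: "supp g \<inter> supp h = {}"
  shows "commute G g h"
proof -
  have "act g (act h x) = act h (act g x)" if x: "x \<in> topspace X" for x
  proof (cases "x \<in> supp g")
    case True
    then have "act g x \<in> supp g" using act_in_supp gh by auto
    with True x dis gh show ?thesis by (metis supp_fixes act_closed disjoint_iff)
  next
    case g: False
    show ?thesis
    proof (cases "x \<in> supp h")
      case True
      then have "act h x \<in> supp h" using act_in_supp gh by auto
      with True x dis gh show ?thesis by (metis supp_fixes act_closed disjoint_iff)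
    next
      case False
      with g x show ?thesis by (metis supp_fixes)
    qed
  qed
  then show ?thesis using commute_iff gh by auto
qed

lemma supp_conj:
  assumes "f \<in> carrier G" "h \<in> carrier G"
  shows "supp (h \<otimes> f \<otimes> inv h) = act h ` supp f"
proof (intro equalityI subsetI)
  fix x assume x: "x \<in> supp (h \<otimes> f \<otimes> inv h)"
  let ?y = "act (inv h) x"
  have xt: "x \<in> topspace X" using x suppD by auto
  have "act (h \<otimes> f \<otimes> inv h) x = act h (act f ?y)"
    using assms xt by (simp add: act_mult act_closed)
  then have "?y \<in> supp f"
    using x xt assms by (auto simp: act_supp_def act_closed)
  then show "x \<in> act h ` supp f" using assms xt by (metis act_inv(2) image_eqI)
next
  fix x assume "x \<in> act h ` supp f"
  then obtain y where y: "y \<in> supp f" "x = act h y" by auto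
  then show "x \<in> supp (h \<otimes> f \<otimes> inv h)"
    using assms suppD[OF y(1)] act_inj[of h "act f y" y]
    by (auto simp: act_supp_def act_mult act_closed)
qed

lemma supp_inv: "g \<in> carrier G \<Longrightarrow> supp (inv g) = supp g"
  by (auto simp: act_supp_def) (metis act_inv)+

lemma supp_mult: "\<lbrakk>g \<in> carrier G; h \<in> carrier G\<rbrakk> \<Longrightarrow> supp (g \<otimes> h) \<subseteq> supp g \<union> supp h"
  by (auto simp: act_supp_def act_mult)

lemma group_comm_closed [simp]: "\<lbrakk>g \<in> carrier G; h \<in> carrier G\<rbrakk> \<Longrightarrow> com g h \<in> carrier G"
  by (simp add: group_comm_def)

lemma supp_comm:
  assumes "g \<in> carrier G" "h \<in> carrier G"
  shows "supp (com g h) \<subseteq> act g ` supp h \<union> supp h"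
proof -
  have "supp (com g h) \<subseteq> supp (g \<otimes> h \<otimes> inv g) \<union> supp (inv h)"
    unfolding group_comm_def using assms by (intro supp_mult) auto
  then show ?thesis using assms by (simp add: supp_conj supp_inv)
qed

section \<open>Detecting disjoint supports with commutators\<close>

lemma Hausdorff_separate:
  assumes "x \<in> topspace X" "y \<in> topspace X" "x \<noteq> y"
  obtains U V where "openin X U" "openin X V" "x \<in> U" "y \<in> V" "U \<inter> V = {}"
  using Hausdorff assms unfolding Hausdorff_space_def disjnt_def by metis

text \<open>A point and its image have disjoint neighbourhoods; intersecting the first with the
  preimage of the second gives a neighbourhood moved off itself, and every point of it is
  moved.\<close>

lemma move_off:
  assumes g: "g \<in> carrier G" and x: "x \<in> supp g"
  obtains U where "openin X U" "x \<in> U" "U \<inter> act g ` U = {}" "U \<subseteq> supp g"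
proof -
  have xt: "x \<in> topspace X" using x suppD by auto
  obtain U V where UV: "openin X U" "openin X V" "x \<in> U" "act g x \<in> V" "U \<inter> V = {}"
    using Hausdorff_separate[of x "act g x"] act_closed[OF g xt] supp_moves[OF x] xt by metis
  let ?W = "U \<inter> {y \<in> topspace X. act g y \<in> V}"
  have W: "openin X ?W"
    using UV act_continuous[OF g] by (auto simp: continuous_map_def intro!: openin_Int)
  show ?thesis
  proof
    show "?W \<inter> act g ` ?W = {}" using UV by auto
    show "?W \<subseteq> supp g" using UV by (auto simp: act_supp_def)
  qed (use W UV xt in auto)
qed

lemma open_supp: "g \<in> carrier G \<Longrightarrow> openin X (supp g)"
  by (subst openin_subopen) (metis move_off)

text \<open>Choose \<open>V\<close> inside \<open>supp f\<close> with \<open>V\<close> and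
  \<open>h V\<close> disjoint, and noncommuting \<open>a\<close>, \<open>b\<close> supported in
  \<open>V\<close>. Then \<open>com b h\<close> is \<open>b\<close> times the conjugate
  \<open>d\<close> of \<open>inv b\<close> living on \<open>h V\<close>; \<open>a\<close> commutes
  with \<open>d\<close>, so the double commutator collapses to \<open>com a b\<close>, which is
  nontrivial and supported in \<open>V\<close>, away from \<open>supp g\<close>.\<close>

lemma disjoint_alg_disjoint:
  assumes fg: "f \<in> carrier G" "g \<in> carrier G" and dis: "supp f \<inter> supp g = {}"
  shows "alg_disjoint G f g"
  unfolding alg_disjoint_def
proof (intro ballI impI)
  fix h assume h: "h \<in> carrier G" and nc: "\<not> commute G f h"
  have "supp f \<inter> supp h \<noteq> {}" using nc commute_disjoint fg h by blast
  then obtain x where x: "x \<in> supp f" "x \<in> supp h" by auto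
  obtain U where U: "openin X U" "x \<in> U" "U \<inter> act h ` U = {}" "U \<subseteq> supp h"
    using move_off[OF h x(2)] by metis
  define V where "V = U \<inter> supp f"
  have V: "openin X V" "V \<noteq> {}" "V \<inter> act h ` V = {}"
    using U x open_supp[OF fg(1)] by (auto simp: V_def)
  obtain a b where ab: "a \<in> carrier G" "b \<in> carrier G" "supp a \<subseteq> V" "supp b \<subseteq> V" "\<not> commute G a b"
    using noncommuting[OF V(1,2)] by blast
  define d where "d = h \<otimes> inv b \<otimes> inv h"
  have dc: "d \<in> carrier G" using h ab by (simp add: d_def)
  have "supp d \<subseteq> act h ` V"
    using supp_conj[of "inv b" h] ab h supp_inv[of b] by (auto simp: d_def)
  then have ad: "commute G a d"
    using ab V dc by (intro commute_disjoint) auto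
  have bh: "com b h = b \<otimes> d" using ab h by (simp add: group_comm_def d_def m_assoc)
  have inv_bd: "inv (b \<otimes> d) = inv d \<otimes> inv b" using ab dc by (simp add: inv_mult_group)
  have ad': "d \<otimes> inv a \<otimes> inv d = inv a"
  proof -
    have "d \<otimes> inv a = inv a \<otimes> d"
      using ad ab dc unfolding commute_def by (metis inv_closed inv_solve_left inv_solve_right m_assoc m_closed)
    then show ?thesis using ab dc by (simp add: m_assoc)
  qed
  have "com a (com b h) = a \<otimes> (b \<otimes> d) \<otimes> inv a \<otimes> (inv d \<otimes> inv b)"
    by (simp add: bh group_comm_def[of G a] inv_bd)
  also have "\<dots> = a \<otimes> b \<otimes> (d \<otimes> inv a \<otimes> inv d) \<otimes> inv b" using ab dc by (simp add: m_assoc)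
  also have "\<dots> = com a b" unfolding ad' by (simp add: group_comm_def)
  finally have k: "com a (com b h) = com a b" .
  have "com a b \<noteq> \<one>"
  proof
    assume "com a b = \<one>"
    then have "a \<otimes> b = b \<otimes> a"
      using ab unfolding group_comm_def
      by (metis inv_closed inv_equality inv_inv inv_mult_group m_assoc m_closed)
    then show False using ab by (simp add: commute_def)
  qed
  moreover have Vg: "commute G c g" if "c \<in> carrier G" "supp c \<subseteq> V" for c
    using that fg dis by (intro commute_disjoint) (auto simp: V_def)
  moreover have "supp (com a b) \<subseteq> V"
  proof -
    have "act a y \<in> V" if "y \<in> supp b" for y
    proof (cases "y \<in> supp a")
      case True then show ?thesis using act_in_supp ab by blast
    next
      case False then show ?thesis using that ab suppD supp_fixes by (metis subsetD)
    qed
    then show ?thesis using supp_comm[of a b] ab by blast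
  qed
  ultimately show "\<exists>a\<in>carrier G. \<exists>b\<in>carrier G. commute G a g \<and> commute G b g \<and>
           commute G (com a (com b h)) g \<and> com a (com b h) \<noteq> \<one>"
    using ab k by (intro bexI[of _ a] bexI[of _ b]) auto
qed

lemma act_pow_fix:
  assumes "g \<in> carrier G" "x \<in> topspace X" "act g x = x"
  shows "act (g [^] (m::nat)) x = x"
  using assms by (induction m) (auto simp: act_one act_mult)

text \<open>Each of 1, 2, 3, 4 divides 12, so a point fixed by such a power of \<open>g\<close>
  would be fixed by the twelfth.\<close>

lemma moves_of_twelfth_power:
  assumes g: "g \<in> carrier G" and x: "x \<in> supp (g [^] (12::nat))" and i: "i \<in> {1..4::nat}"
  shows "x \<in> supp (g [^] i)"
proof (rule ccontr)
  have xt: "x \<in> topspace X" using x suppD by auto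
  assume "x \<notin> supp (g [^] i)"
  then have fx: "act (g [^] i) x = x" using xt supp_fixes by auto
  have "i dvd 12"
  proof -
    have "i = 1 \<or> i = 2 \<or> i = 3 \<or> i = 4" using i by auto
    then show ?thesis by (elim disjE) simp_all
  qed
  then obtain m where "12 = i * m" by (elim dvdE)
  then have "act (g [^] (12::nat)) x = x"
    using act_pow_fix[of "g [^] i" x m] fx g xt by (simp add: nat_pow_pow)
  then show False using x supp_moves by auto
qed

text \<open>Were \<open>x\<close> in both supports, take \<open>h\<close> supported in a small \<open>U\<close> around \<open>x\<close>.  The witness
  given by algebraic disjointness is supported in four translates of \<open>U\<close> by elements of the
  centralizer of \<open>g\<close>; five points of a \<open>g\<close>-orbit cannot be distributed among them when
  \<open>U\<close>, \<open>g U\<close>, ..., \<open>g\<^sup>4 U\<close> are disjoint.\<close>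

lemma alg_disjoint_disjoint:
  assumes fg: "f \<in> carrier G" "g \<in> carrier G" and ad: "alg_disjoint G f g"
  shows "supp f \<inter> supp (g [^] (12::nat)) = {}"
proof (rule ccontr)
  assume "supp f \<inter> supp (g [^] (12::nat)) \<noteq> {}"
  then obtain x where x: "x \<in> supp f" "x \<in> supp (g [^] (12::nat))" by auto
  have xt: "x \<in> topspace X" using x suppD by auto
  obtain U0 where U0: "openin X U0" "x \<in> U0" "U0 \<inter> act f ` U0 = {}"
    using move_off[OF fg(1) x(1)] by metis
  have "\<exists>U. openin X U \<and> x \<in> U \<and> U \<inter> act (g [^] i) ` U = {}" if "i \<in> {1..4::nat}" for i
    using move_off[OF _ moves_of_twelfth_power[OF fg(2) x(2) that]] fg(2) by (metis nat_pow_closed)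
  then obtain V where V: "\<And>i. i \<in> {1..4::nat} \<Longrightarrow>
      openin X (V i) \<and> x \<in> V i \<and> V i \<inter> act (g [^] i) ` V i = {}"
    by metis
  define U where "U = U0 \<inter> (\<Inter>i\<in>{1..4::nat}. V i)"
  have U: "openin X U" "x \<in> U"
    unfolding U_def using U0 V by (auto intro!: openin_Int openin_INT2)
  have Uf: "U \<inter> act f ` U = {}" using U0 by (auto simp: U_def)
  have Ug: "U \<inter> act (g [^] i) ` U = {}" if "i \<in> {1..4::nat}" for i
    using V[OF that] that unfolding U_def by blast
  obtain h where h: "h \<in> carrier G" "supp h \<subseteq> U" "\<not> commute G f h"
  proof -
    obtain h where h: "h \<in> carrier G" "supp h \<subseteq> U" "h [^] (12::nat) \<noteq> \<one>"
      using twelfth_power[OF U(1)] U(2) by blast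
    then have "supp h \<noteq> {}" using supp_empty by fastforce
    then obtain y where y: "y \<in> supp h" by auto
    \<comment> \<open>Commuting would keep the image under \<open>f\<close> of a point of
      \<open>supp h\<close> inside \<open>supp h\<close>, hence inside \<open>U\<close>; but
      \<open>f\<close> throws \<open>U\<close> off itself.\<close>
    have "\<not> commute G f h"
    proof
      assume "commute G f h"
      then have "act f y \<in> supp h" using commute_supp[of h f y] fg h y commute_sym by blast
      then show False using Uf h y by blast
    qed
    with h that show thesis by blast
  qed
  obtain a b where ab: "a \<in> carrier G" "b \<in> carrier G" "commute G a g" "commute G b g"
    "commute G (com a (com b h)) g" "com a (com b h) \<noteq> \<one>"
    using ad h unfolding alg_disjoint_def by blast
  define k where "k = com a (com b h)"
  have kc: "k \<in> carrier G" using ab h by (simp add: k_def)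
  then obtain y where y: "y \<in> supp k" using ab supp_empty by (fastforce simp: k_def)
  \<comment> \<open>The four centralizing elements whose translates of \<open>U\<close> cover the
    support of the double commutator: expanding \<open>supp_comm\<close> twice gives
    \<open>U\<close>, \<open>b U\<close>, \<open>a U\<close> and \<open>a b U\<close>.\<close>
  define c where "c = (\<lambda>i::nat. [\<one>, b, a, a \<otimes> b] ! i)"
  have c_less: "i = 0 \<or> i = 1 \<or> i = 2 \<or> i = 3" if "i < 4" for i :: nat using that by auto
  have cc: "c i \<in> carrier G" "commute G (c i) g" if "i < 4" for i
  proof -
    have "commute G (a \<otimes> b) g"
      using ab fg unfolding commute_def by (metis m_assoc)
    then show "c i \<in> carrier G" "commute G (c i) g"
      using c_less[OF that] ab fg by (auto simp: c_def commute_def)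
  qed
  have supp_k: "\<exists>i<4. \<exists>u\<in>U. z = act (c i) u" if z: "z \<in> supp k" for z
  proof -
    have "supp k \<subseteq> act a ` supp (com b h) \<union> supp (com b h)"
      using supp_comm[of a "com b h"] ab h by (simp add: k_def)
    moreover have bh: "supp (com b h) \<subseteq> act b ` U \<union> U"
      using supp_comm[of b h] ab h image_mono[OF h(2), of "act b"] by blast
    ultimately have "supp k \<subseteq> act a ` (act b ` U \<union> U) \<union> (act b ` U \<union> U)"
      using image_mono[OF bh, of "act a"] by (meson Un_mono order_trans)
    with z have "z \<in> act a ` (act b ` U \<union> U) \<union> (act b ` U \<union> U)" by (rule subsetD[rotated])
    then consider u where "u \<in> U" "z = act a (act b u)" | u where "u \<in> U" "z = act a u"
      | u where "u \<in> U" "z = act b u" | "z \<in> U" by blast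
    then show ?thesis
    proof cases
      case 1
      then have "z = act (c 3) u" using ab U openin_subset by (fastforce simp: c_def act_mult)
      then show ?thesis using 1 by (intro exI[of _ 3]) auto
    next
      case 2
      then show ?thesis by (intro exI[of _ 2]) (auto simp: c_def)
    next
      case 3
      then show ?thesis by (intro exI[of _ 1]) (auto simp: c_def)
    next
      case 4
      then have "act (c 0) z = z" using U openin_subset by (fastforce simp: c_def act_one)
      then show ?thesis using 4 by (intro exI[of _ 0] conjI bexI[of _ z]) auto
    qed
  qed
  have orbit: "act (g [^] j) y \<in> supp k" for j :: nat
  proof (rule commute_supp[OF kc _ _ y])
    show "commute G k (g [^] j)"
      using ab(5) fg kc unfolding k_def[symmetric]
    proof (induction j)
      case (Suc j)
      then show ?case by (simp add: commute_def) (metis m_assoc nat_pow_closed)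
    qed (simp add: commute_def)
  qed (use fg in auto)
  then have "\<forall>j. \<exists>i<4. \<exists>u\<in>U. act (g [^] (j::nat)) y = act (c i) u" using supp_k by blast
  then obtain idx u where idx: "\<And>j::nat. idx j < (4::nat) \<and> u j \<in> U \<and> act (g [^] j) y = act (c (idx j)) (u j)"
    by metis
  have "\<not> inj_on idx {..<5}"
  proof
    assume "inj_on idx {..<5}"
    moreover have "idx ` {..<5} \<subseteq> {..<4}" using idx by auto
    ultimately have "card {..<5::nat} \<le> card {..<4::nat}" by (intro card_inj_on_le) auto
    then show False by simp
  qed
  then obtain i j where "i < 5" "j < 5" "i \<noteq> j" "idx i = idx j" by (auto simp: inj_on_def)
  then obtain i j where ij: "i < j" "j < 5" "idx i = idx j"
    by (metis linorder_neqE_nat)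
  define e where "e = c (idx i)"
  have e: "e \<in> carrier G" "commute G e g" using cc idx by (auto simp: e_def)
  have yt: "y \<in> topspace X" using y suppD by auto
  have Ut: "U \<subseteq> topspace X" using U openin_subset by auto
  have eg: "commute G e (g [^] m)" for m :: nat
    using e fg
  proof (induction m)
    case (Suc m)
    then show ?case by (simp add: commute_def) (metis m_assoc nat_pow_closed)
  qed (simp add: commute_def)
  \<comment> \<open>Two orbit points in the same translate: \<open>e\<close> commutes with powers of
    \<open>g\<close>, so it cancels and \<open>g [^] (j - i)\<close> carries a point of
    \<open>U\<close> into \<open>U\<close>, with exponent between 1 and 4.\<close>
  have "act e (u j) = act (g [^] ((j - i) + i)) y" using idx[of j] ij by (simp add: e_def)
  also have "\<dots> = act (g [^] (j - i)) (act (g [^] i) y)"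
    using fg yt by (simp add: nat_pow_mult[symmetric] act_mult)
  also have "\<dots> = act (g [^] (j - i)) (act e (u i))" using idx[of i] by (simp add: e_def)
  also have "\<dots> = act e (act (g [^] (j - i)) (u i))"
    using eg[of "j - i"] e fg idx[of i] Ut commute_iff[of e "g [^] (j - i)"] by auto
  finally have "u j = act (g [^] (j - i)) (u i)"
    using act_inj[of e] e fg idx Ut by (metis act_closed nat_pow_closed subsetD)
  moreover have "j - i \<in> {1..4}" using ij by auto
  ultimately show False using Ug[of "j - i"] idx[of i] idx[of j] by auto
qed

section \<open>Inclusion and disjointness of closed supports in group terms\<close>

lemma supp_subset_csupp: "supp g \<subseteq> csupp g"
  unfolding closed_supp_def by (intro closure_of_subset) (auto simp: act_supp_def)

lemma csupp_subset: "csupp g \<subseteq> topspace X"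
  unfolding closed_supp_def by (rule closure_of_subset_topspace)

lemma open_disjoint_csupp: "\<lbrakk>openin X U; U \<inter> supp g = {}\<rbrakk> \<Longrightarrow> U \<inter> csupp g = {}"
  unfolding closed_supp_def using openin_Int_closure_of_eq_empty by blast

lemma csupp_le_iff: "csupp g \<subseteq> csupp f \<longleftrightarrow> supp g \<subseteq> csupp f"
  using supp_subset_csupp[of g] unfolding closed_supp_def
  by (metis closedin_closure_of closure_of_minimal order_trans)

text \<open>For the converse, if \<open>k\<close> moves a point outside \<open>csupp f\<close>, some
  \<open>g\<close> is supported near it, off \<open>csupp f\<close> and in a set that
  \<open>k\<close> moves off itself. It is algebraically disjoint from \<open>f\<close>, while its
  nontrivial twelfth power is not centralized by \<open>k\<close>. In the forward direction openness
  of \<open>supp (g [^] 12)\<close> upgrades disjointness from \<open>supp f\<close> to disjointness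
  from the closure.\<close>

lemma csupp_subset_iff:
  assumes kf: "k \<in> carrier G" "f \<in> carrier G"
  shows "csupp k \<subseteq> csupp f \<longleftrightarrow>
    (\<forall>g\<in>carrier G. alg_disjoint G f g \<longrightarrow> commute G k (g [^] (12::nat)))"
proof (intro iffI ballI impI)
  fix g assume sub: "csupp k \<subseteq> csupp f" and g: "g \<in> carrier G" "alg_disjoint G f g"
  have "supp (g [^] (12::nat)) \<inter> csupp f = {}"
    using alg_disjoint_disjoint[OF kf(2) g] open_supp g by (intro open_disjoint_csupp) auto
  then show "commute G k (g [^] (12::nat))"
    using sub supp_subset_csupp[of k] kf g by (intro commute_disjoint) auto
next
  assume *: "\<forall>g\<in>carrier G. alg_disjoint G f g \<longrightarrow> commute G k (g [^] (12::nat))"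
  show "csupp k \<subseteq> csupp f"
    unfolding csupp_le_iff
  proof
    fix x assume x: "x \<in> supp k"
    show "x \<in> csupp f"
    proof (rule ccontr)
      assume nx: "x \<notin> csupp f"
      obtain U where U: "openin X U" "x \<in> U" "U \<inter> act k ` U = {}" using move_off[OF kf(1) x] by metis
      have "openin X (topspace X - csupp f)" unfolding closed_supp_def by (simp add: openin_diff)
      then have V: "openin X (U - csupp f)" "U - csupp f \<noteq> {}"
        using U nx openin_diff[OF U(1)] by (auto simp: closed_supp_def)
      obtain g where g: "g \<in> carrier G" "supp g \<subseteq> U - csupp f" "g [^] (12::nat) \<noteq> \<one>"
        using twelfth_power[OF V] by blast
      have "alg_disjoint G f g" using disjoint_alg_disjoint kf g supp_subset_csupp[of f] by blast
      then have com: "commute G k (g [^] (12::nat))" using * g by auto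
      obtain y where y: "y \<in> supp (g [^] (12::nat))" using g supp_empty by fastforce
      have "supp (g [^] (12::nat)) \<subseteq> supp g"
        using act_pow_fix[OF g(1)] by (auto simp: act_supp_def)
      moreover have "act k y \<in> supp (g [^] (12::nat))"
        using commute_supp[of "g [^] (12::nat)" k y] com commute_sym g kf y by auto
      ultimately show False using y g U by blast
    qed
  qed
qed

lemma csupp_one: "csupp \<one> = {}"
  using supp_empty[of \<one>] by (simp add: closed_supp_def)

lemma csupp_nonempty: "\<lbrakk>g \<in> carrier G; g \<noteq> \<one>\<rbrakk> \<Longrightarrow> csupp g \<noteq> {}"
  using supp_empty supp_subset_csupp by fastforce

text \<open>Openness of closed supports is decisive: a common point lies in an open intersection,
  which contains the closed support of a nontrivial element. Disjointness thereby reduces to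
  inclusion, which the group already expresses.\<close>

lemma csupp_disjoint_iff:
  assumes "f \<in> carrier G" "g \<in> carrier G"
  shows "csupp f \<inter> csupp g = {} \<longleftrightarrow> (\<forall>k\<in>carrier G. csupp k \<subseteq> csupp f \<and> csupp k \<subseteq> csupp g \<longrightarrow> k = \<one>)"
proof
  assume "csupp f \<inter> csupp g = {}"
  then show "\<forall>k\<in>carrier G. csupp k \<subseteq> csupp f \<and> csupp k \<subseteq> csupp g \<longrightarrow> k = \<one>"
    using csupp_nonempty by blast
next
  assume *: "\<forall>k\<in>carrier G. csupp k \<subseteq> csupp f \<and> csupp k \<subseteq> csupp g \<longrightarrow> k = \<one>"
  show "csupp f \<inter> csupp g = {}"
  proof (rule ccontr)
    assume "csupp f \<inter> csupp g \<noteq> {}"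
    then obtain x where "x \<in> csupp f \<inter> csupp g" by blast
    moreover have "openin X (csupp f \<inter> csupp g)" using assms open_closed_supp by auto
    ultimately obtain k where "k \<in> carrier G" "x \<in> csupp k" "csupp k \<subseteq> csupp f \<inter> csupp g"
      using supp_base by meson
    then show False using * csupp_one by (metis empty_iff le_inf_iff)
  qed
qed

lemma csupp_separates:
  assumes "x \<in> topspace X" "y \<in> topspace X" "\<And>f. f \<in> carrier G \<Longrightarrow> x \<in> csupp f \<Longrightarrow> y \<in> csupp f"
  shows "x = y"
proof (rule ccontr)
  assume "x \<noteq> y"
  then obtain U V where "openin X U" "openin X V" "x \<in> U" "y \<in> V" "U \<inter> V = {}"
    using Hausdorff_separate assms by metis
  then show False using supp_base[of U x] assms(3) by blast
qed

lemma closedin_csupp: "closedin X (csupp f)"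
  by (simp add: closed_supp_def)

lemma homeomorphic_act: "g \<in> carrier G \<Longrightarrow> homeomorphic_map X X (act g)"
  by (rule homeomorphic_maps_map[THEN iffD1, THEN conjunct1, of _ _ _ "act (inv g)"])
     (auto simp: homeomorphic_maps_def act_continuous)

lemma csupp_image:
  assumes h: "homeomorphic_map X X h" and "f \<in> carrier G" "f' \<in> carrier G"
    and eq: "\<And>x. x \<in> topspace X \<Longrightarrow> h (act f x) = act f' (h x)"
  shows "csupp f' = h ` csupp f"
proof -
  have im: "h ` topspace X = topspace X" and inj: "inj_on h (topspace X)"
    using h by (auto simp: homeomorphic_eq_everything_map)
  have "supp f' = h ` supp f"
  proof (intro equalityI subsetI)
    fix y assume y: "y \<in> supp f'"
    then obtain x where x: "x \<in> topspace X" "y = h x" using im suppD by fast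
    then have "act f x \<noteq> x" using y eq supp_moves by metis
    then show "y \<in> h ` supp f" using x by (auto simp: act_supp_def)
  next
    fix y assume "y \<in> h ` supp f"
    then obtain x where x: "x \<in> supp f" "y = h x" by auto
    then have "h (act f x) \<noteq> h x"
      using inj act_closed[OF assms(2)] suppD supp_moves by (metis inj_onD)
    moreover have "h (act f x) = act f' y" "y \<in> topspace X"
      using x(2) eq[OF suppD[OF x(1)]] im suppD[OF x(1)] by blast+
    ultimately show "y \<in> supp f'" using x(2) by (simp add: act_supp_def)
  qed
  then show ?thesis
    unfolding closed_supp_def
    using homeomorphic_map_closure_of[OF h, of "supp f"] by (auto simp: act_supp_def)
qed

text \<open>If \<open>h x\<close> and \<open>h' x\<close> differed, a closed support around
  \<open>x\<close> could be taken so small that \<open>h\<close> and \<open>h'\<close> carry it to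
  disjoint sets; but both images are \<open>csupp (\<alpha> g)\<close>.\<close>

lemma equivariant_unique:
  assumes h: "homeomorphic_map X X h" "homeomorphic_map X X h'"
    and \<alpha>: "\<And>g. g \<in> carrier G \<Longrightarrow> \<alpha> g \<in> carrier G"
    and eq: "\<And>g x. \<lbrakk>g \<in> carrier G; x \<in> topspace X\<rbrakk> \<Longrightarrow> h (act g x) = act (\<alpha> g) (h x)"
      "\<And>g x. \<lbrakk>g \<in> carrier G; x \<in> topspace X\<rbrakk> \<Longrightarrow> h' (act g x) = act (\<alpha> g) (h' x)"
    and x: "x \<in> topspace X"
  shows "h x = h' x"
proof (rule ccontr)
  assume ne: "h x \<noteq> h' x"
  have cont: "continuous_map X X h" "continuous_map X X h'"
    using h homeomorphic_imp_continuous_map by auto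
  then have top: "h x \<in> topspace X" "h' x \<in> topspace X"
    using x continuous_map_image_subset_topspace by fastforce+
  obtain U V where UV: "openin X U" "openin X V" "h x \<in> U" "h' x \<in> V" "U \<inter> V = {}"
    using Hausdorff_separate[OF top ne] by metis
  let ?W = "{z \<in> topspace X. h z \<in> U} \<inter> {z \<in> topspace X. h' z \<in> V}"
  have "openin X ?W" using UV cont by (auto simp: continuous_map_def intro!: openin_Int)
  then obtain g where g: "g \<in> carrier G" "x \<in> csupp g" "csupp g \<subseteq> ?W"
    using supp_base[of ?W x] UV x by blast
  have "csupp (\<alpha> g) = h ` csupp g" "csupp (\<alpha> g) = h' ` csupp g"
    using csupp_image[of h g "\<alpha> g"] csupp_image[of h' g "\<alpha> g"] h \<alpha> eq g by auto
  then obtain z where "z \<in> csupp g" "h x = h' z" using g by blast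
  then show False using g UV by auto
qed

section \<open>The point map induced by an automorphism\<close>

context
  fixes \<alpha> assumes auto: "\<alpha> \<in> auto G"
begin

lemma auto_bij: "bij_betw \<alpha> (carrier G) (carrier G)"
  and auto_closed [simp]: "g \<in> carrier G \<Longrightarrow> \<alpha> g \<in> carrier G"
  and auto_mult [simp]: "\<lbrakk>g \<in> carrier G; h \<in> carrier G\<rbrakk> \<Longrightarrow> \<alpha> (g \<otimes> h) = \<alpha> g \<otimes> \<alpha> h"
  using auto by (auto simp: auto_def Bij_def hom_def)

lemma auto_hom: "group_hom G G \<alpha>"
  using auto is_group by (auto simp: auto_def group_hom_def group_hom_axioms_def)

lemma auto_one [simp]: "\<alpha> \<one> = \<one>"
  using group_hom.hom_one[OF auto_hom] .

lemma auto_inv [simp]: "g \<in> carrier G \<Longrightarrow> \<alpha> (inv g) = inv (\<alpha> g)"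
  using group_hom.hom_inv[OF auto_hom] .

lemma auto_pow [simp]: "g \<in> carrier G \<Longrightarrow> \<alpha> (g [^] (m::nat)) = \<alpha> g [^] m"
  by (induction m) auto

lemma auto_eq_iff: "\<lbrakk>g \<in> carrier G; h \<in> carrier G\<rbrakk> \<Longrightarrow> \<alpha> g = \<alpha> h \<longleftrightarrow> g = h"
  using auto_bij by (auto simp: bij_betw_def inj_on_def)

lemma auto_comm: "\<lbrakk>g \<in> carrier G; h \<in> carrier G\<rbrakk> \<Longrightarrow> \<alpha> (com g h) = com (\<alpha> g) (\<alpha> h)"
  by (simp add: group_comm_def)

lemma auto_commute: "\<lbrakk>g \<in> carrier G; h \<in> carrier G\<rbrakk> \<Longrightarrow> commute G (\<alpha> g) (\<alpha> h) \<longleftrightarrow> commute G g h"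
  unfolding commute_def using auto_eq_iff by (metis auto_mult m_closed)

lemma auto_ball: "(\<forall>g\<in>carrier G. P g) \<longleftrightarrow> (\<forall>g\<in>carrier G. P (\<alpha> g))"
  and auto_bex: "(\<exists>g\<in>carrier G. P g) \<longleftrightarrow> (\<exists>g\<in>carrier G. P (\<alpha> g))"
  using bij_betw_imp_surj_on[OF auto_bij] by (metis image_iff)+

lemma auto_alg_disjoint:
  assumes "f \<in> carrier G" "g \<in> carrier G"
  shows "alg_disjoint G (\<alpha> f) (\<alpha> g) \<longleftrightarrow> alg_disjoint G f g"
proof -
  define W where "W = (\<lambda>g h a b. commute G a g \<and> commute G b g \<and>
     commute G (com a (com b h)) g \<and> com a (com b h) \<noteq> \<one>)"
  have W: "W (\<alpha> g) (\<alpha> h) (\<alpha> a) (\<alpha> b) \<longleftrightarrow> W g h a b"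
    if "h \<in> carrier G" "a \<in> carrier G" "b \<in> carrier G" for h a b
  proof -
    have "com (\<alpha> a) (com (\<alpha> b) (\<alpha> h)) = \<alpha> (com a (com b h))" using that by (simp add: auto_comm)
    moreover have "\<alpha> (com a (com b h)) = \<one> \<longleftrightarrow> com a (com b h) = \<one>"
      using auto_eq_iff[of "com a (com b h)" \<one>] that by simp
    ultimately show ?thesis using that assms by (simp add: W_def auto_commute)
  qed
  have "alg_disjoint G (\<alpha> f) (\<alpha> g) \<longleftrightarrow>
      (\<forall>h\<in>carrier G. \<not> commute G (\<alpha> f) h \<longrightarrow> (\<exists>a\<in>carrier G. \<exists>b\<in>carrier G. W (\<alpha> g) h a b))"
    by (simp add: alg_disjoint_def W_def)
  also have "\<dots> \<longleftrightarrow> (\<forall>h\<in>carrier G. \<not> commute G (\<alpha> f) (\<alpha> h) \<longrightarrow>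
      (\<exists>a\<in>carrier G. \<exists>b\<in>carrier G. W (\<alpha> g) (\<alpha> h) a b))"
    by (rule auto_ball)
  also have "\<dots> \<longleftrightarrow> (\<forall>h\<in>carrier G. \<not> commute G (\<alpha> f) (\<alpha> h) \<longrightarrow>
      (\<exists>a\<in>carrier G. \<exists>b\<in>carrier G. W (\<alpha> g) (\<alpha> h) (\<alpha> a) (\<alpha> b)))"
    using auto_bex[of "\<lambda>b. W (\<alpha> g) _ _ b"] auto_bex[of "\<lambda>a. \<exists>b\<in>carrier G. W (\<alpha> g) _ a b"]
    by simp
  also have "\<dots> \<longleftrightarrow> (\<forall>h\<in>carrier G. \<not> commute G f h \<longrightarrow>
      (\<exists>a\<in>carrier G. \<exists>b\<in>carrier G. W g h a b))"
    using assms by (simp add: auto_commute W)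
  also have "\<dots> \<longleftrightarrow> alg_disjoint G f g" by (simp add: alg_disjoint_def W_def)
  finally show ?thesis .
qed

lemma auto_csupp_subset:
  assumes "f \<in> carrier G" "g \<in> carrier G"
  shows "csupp (\<alpha> f) \<subseteq> csupp (\<alpha> g) \<longleftrightarrow> csupp f \<subseteq> csupp g"
  using assms auto_ball[of "\<lambda>k. alg_disjoint G (\<alpha> g) k \<longrightarrow> commute G (\<alpha> f) (k [^] (12::nat))"]
  by (simp add: csupp_subset_iff auto_alg_disjoint auto_commute del: auto_pow flip: auto_pow)

lemma auto_csupp_disjoint:
  assumes "f \<in> carrier G" "g \<in> carrier G"
  shows "csupp (\<alpha> f) \<inter> csupp (\<alpha> g) = {} \<longleftrightarrow> csupp f \<inter> csupp g = {}"
proof -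
  have "\<alpha> k = \<one> \<longleftrightarrow> k = \<one>" if "k \<in> carrier G" for k
    using auto_eq_iff[of k \<one>] that by simp
  then show ?thesis
    using assms auto_ball[of "\<lambda>k. csupp k \<subseteq> csupp (\<alpha> f) \<and> csupp k \<subseteq> csupp (\<alpha> g) \<longrightarrow> k = \<one>"]
    by (simp add: csupp_disjoint_iff auto_csupp_subset)
qed

text \<open>Compactness: finitely many closed supports around \<open>x\<close> contain the closed
  support of some nontrivial \<open>k\<close>, and since \<alpha> preserves inclusion of closed
  supports, the images of these finitely many still share the nonempty
  \<open>csupp (\<alpha> k)\<close>.\<close>

lemma auto_point_ex:
  assumes x: "x \<in> topspace X"
  shows "\<exists>y\<in>topspace X. \<forall>f\<in>carrier G. x \<in> csupp f \<longrightarrow> y \<in> csupp (\<alpha> f)"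
proof -
  define F where "F = {f \<in> carrier G. x \<in> csupp f}"
  have "\<Inter> (csupp ` \<alpha> ` F) \<noteq> {}"
  proof -
    have "\<Inter> \<F> \<noteq> {}" if fin: "finite \<F>" "\<F> \<subseteq> csupp ` \<alpha> ` F" for \<F>
    proof -
      obtain E where E: "finite E" "E \<subseteq> F" "\<F> = (\<lambda>f. csupp (\<alpha> f)) ` E"
        using finite_subset_image[of \<F> "\<lambda>f. csupp (\<alpha> f)" F] fin by (auto simp: image_image)
      have "openin X (topspace X \<inter> \<Inter> (csupp ` E))"
        using E open_closed_supp by (intro openin_Int_Inter) (auto simp: F_def)
      moreover have "x \<in> topspace X \<inter> \<Inter> (csupp ` E)" using E x by (auto simp: F_def)
      ultimately obtain k where k: "k \<in> carrier G" "x \<in> csupp k" "csupp k \<subseteq> topspace X \<inter> \<Inter> (csupp ` E)"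
        using supp_base by meson
      have "k \<noteq> \<one>" using k csupp_one by auto
      then have "csupp (\<alpha> k) \<noteq> {}" using csupp_nonempty k auto_eq_iff[of k \<one>] by simp
      moreover have "csupp (\<alpha> k) \<subseteq> \<Inter> \<F>"
      proof -
        have "csupp (\<alpha> k) \<subseteq> csupp (\<alpha> e)" if "e \<in> E" for e
          using that E k auto_csupp_subset[of k e] by (auto simp: F_def)
        then show ?thesis unfolding E(3) by blast
      qed
      ultimately show ?thesis by blast
    qed
    moreover have "\<And>C. C \<in> csupp ` \<alpha> ` F \<Longrightarrow> closedin X C" using closedin_csupp by auto
    ultimately show ?thesis using compact unfolding compact_space_fip by metis
  qed
  then obtain y where y: "\<And>f. f \<in> F \<Longrightarrow> y \<in> csupp (\<alpha> f)" by auto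
  obtain f where "f \<in> F" using supp_base[of "topspace X" x] x unfolding F_def by auto
  then have "y \<in> topspace X" using y csupp_subset by blast
  then show ?thesis using y by (auto simp: F_def)
qed

definition auto_point :: "'x \<Rightarrow> 'x" where
  "auto_point x = (SOME y. y \<in> topspace X \<and> (\<forall>f\<in>carrier G. x \<in> csupp f \<longrightarrow> y \<in> csupp (\<alpha> f)))"

text \<open>For the converse inclusion, a closed support missing \<open>x\<close> is disjoint from
  some closed support around \<open>x\<close>, and \<alpha> preserves disjointness.\<close>

lemma auto_point:
  assumes x: "x \<in> topspace X"
  shows auto_point_closed: "auto_point x \<in> topspace X"
    and auto_point_iff: "f \<in> carrier G \<Longrightarrow> auto_point x \<in> csupp (\<alpha> f) \<longleftrightarrow> x \<in> csupp f"
proof -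
  have *: "auto_point x \<in> topspace X \<and> (\<forall>f\<in>carrier G. x \<in> csupp f \<longrightarrow> auto_point x \<in> csupp (\<alpha> f))"
    unfolding auto_point_def by (rule someI_ex) (use auto_point_ex[OF x] in blast)
  then show "auto_point x \<in> topspace X" by blast
  assume f: "f \<in> carrier G"
  have "x \<in> csupp f" if "auto_point x \<in> csupp (\<alpha> f)"
  proof (rule ccontr)
    assume "x \<notin> csupp f"
    moreover have "openin X (topspace X - csupp f)" using closedin_csupp by (simp add: openin_diff)
    ultimately obtain e where e: "e \<in> carrier G" "x \<in> csupp e" "csupp e \<subseteq> topspace X - csupp f"
      using supp_base[of "topspace X - csupp f" x] x by blast
    then have "csupp (\<alpha> e) \<inter> csupp (\<alpha> f) = {}" using auto_csupp_disjoint[of e f] f by blast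
    then show False using * e that by blast
  qed
  then show "auto_point x \<in> csupp (\<alpha> f) \<longleftrightarrow> x \<in> csupp f" using * f by blast
qed

lemma auto_point_continuous: "continuous_map X X auto_point"
  unfolding continuous_map_def
proof (intro conjI allI impI)
  show "auto_point \<in> topspace X \<rightarrow> topspace X" using auto_point_closed by auto
  fix U assume U: "openin X U"
  show "openin X {x \<in> topspace X. auto_point x \<in> U}"
  proof (subst openin_subopen, intro ballI)
    fix x assume x: "x \<in> {x \<in> topspace X. auto_point x \<in> U}"
    then obtain f' where f': "f' \<in> carrier G" "auto_point x \<in> csupp f'" "csupp f' \<subseteq> U"
      using supp_base[OF U] by blast
    then obtain f where f: "f \<in> carrier G" "f' = \<alpha> f"
      using bij_betw_imp_surj_on[OF auto_bij] by blast
    show "\<exists>V. openin X V \<and> x \<in> V \<and> V \<subseteq> {x \<in> topspace X. auto_point x \<in> U}"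
      using x f f' open_closed_supp auto_point_iff csupp_subset
      by (intro exI[of _ "csupp f"]) blast
  qed
qed

text \<open>By \<open>csupp_separates\<close> it suffices that every closed support around one of
  the two points contains the other. Conjugation by \<open>g\<close> translates closed supports by
  \<open>act g\<close>, and \<alpha> turns it into conjugation by \<open>\<alpha> g\<close>.\<close>

lemma auto_point_equivariant:
  assumes g: "g \<in> carrier G" and x: "x \<in> topspace X"
  shows "auto_point (act g x) = act (\<alpha> g) (auto_point x)"
proof (rule csupp_separates[symmetric])
  show "act (\<alpha> g) (auto_point x) \<in> topspace X" "auto_point (act g x) \<in> topspace X"
    using g x auto_point_closed act_closed by auto
  fix f' assume f': "f' \<in> carrier G" "act (\<alpha> g) (auto_point x) \<in> csupp f'"
  then obtain f where f: "f \<in> carrier G" "f' = \<alpha> f"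
    using bij_betw_imp_surj_on[OF auto_bij] by blast
  have conjugate: "csupp (inv k \<otimes> e \<otimes> k) = act (inv k) ` csupp e" if "k \<in> carrier G" "e \<in> carrier G" for k e
    using that by (intro csupp_image[OF homeomorphic_act]) (auto simp: act_mult act_closed)
  have "act (inv (\<alpha> g)) (act (\<alpha> g) (auto_point x)) \<in> csupp (inv (\<alpha> g) \<otimes> \<alpha> f \<otimes> \<alpha> g)"
    using conjugate[of "\<alpha> g" "\<alpha> f"] f' f g by auto
  then have "auto_point x \<in> csupp (\<alpha> (inv g \<otimes> f \<otimes> g))"
    using g f x auto_point_closed[OF x] by simp
  moreover have "inv g \<otimes> f \<otimes> g \<in> carrier G" using f g by simp
  ultimately have "x \<in> csupp (inv g \<otimes> f \<otimes> g)" using auto_point_iff[OF x] by blast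
  then obtain z where "z \<in> csupp f" "x = act (inv g) z" using conjugate f g by blast
  then have "act g x \<in> csupp f" using g csupp_subset[of f] by (metis act_inv(2) subsetD)
  then show "auto_point (act g x) \<in> csupp f'"
    using auto_point_iff[of "act g x" f] act_closed g x f by auto
qed

end

lemma auto_point_inverse:
  assumes \<alpha>: "\<alpha> \<in> auto G" and \<beta>: "\<beta> \<in> auto G" and inv: "\<And>g. g \<in> carrier G \<Longrightarrow> \<alpha> (\<beta> g) = g"
    and x: "x \<in> topspace X"
  shows "auto_point \<alpha> (auto_point \<beta> x) = x"
proof (rule csupp_separates[symmetric])
  fix f assume f: "f \<in> carrier G" "x \<in> csupp f"
  then have "auto_point \<beta> x \<in> csupp (\<beta> f)" using auto_point_iff[OF \<beta> x] by auto
  then have "auto_point \<alpha> (auto_point \<beta> x) \<in> csupp (\<alpha> (\<beta> f))"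
    using auto_point_iff[OF \<alpha> auto_point_closed[OF \<beta> x]] auto_closed[OF \<beta>] f by auto
  then show "auto_point \<alpha> (auto_point \<beta> x) \<in> csupp f" using inv f by auto
qed (use auto_point_closed \<alpha> \<beta> x in auto)

text \<open>The inverse of \<alpha> induces the inverse point map, and point maps of automorphisms
  are continuous.\<close>

theorem auto_spatial:
  assumes \<alpha>: "\<alpha> \<in> auto G"
  obtains h where "homeomorphic_map X X h"
    "\<And>g x. \<lbrakk>g \<in> carrier G; x \<in> topspace X\<rbrakk> \<Longrightarrow> h (act g x) = act (\<alpha> g) (h x)"
proof
  define \<beta> where "\<beta> = restrict (inv_into (carrier G) \<alpha>) (carrier G)"
  have bij: "bij_betw \<alpha> (carrier G) (carrier G)" using auto_bij[OF \<alpha>] .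
  have \<beta>: "\<beta> \<in> auto G"
    using \<alpha> restrict_inv_into_hom[of \<alpha>] restrict_inv_into_Bij[of \<alpha> "carrier G"]
    by (auto simp: \<beta>_def auto_def)
  have inv: "\<alpha> (\<beta> g) = g" "\<beta> (\<alpha> g) = g" if "g \<in> carrier G" for g
    using bij_betw_inv_into_left[OF bij] bij_betw_inv_into_right[OF bij] that auto_closed[OF \<alpha>]
    by (auto simp: \<beta>_def)
  have "homeomorphic_maps X X (auto_point \<alpha>) (auto_point \<beta>)"
    unfolding homeomorphic_maps_def
    using auto_point_continuous[OF \<alpha>] auto_point_continuous[OF \<beta>]
      auto_point_inverse[OF \<alpha> \<beta>] auto_point_inverse[OF \<beta> \<alpha>] inv by auto
  then show "homeomorphic_map X X (auto_point \<alpha>)" using homeomorphic_maps_map by blast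
qed (rule auto_point_equivariant[OF \<alpha>])

end

section \<open>The Cantor space\<close>

locale cantor_params =
  fixes n r :: nat
  assumes n2: "2 \<le> n" and r1: "1 \<le> r"
begin

abbreviation "C \<equiv> cantor n r"
abbreviation "D \<equiv> cantor1 n"
abbreviation "W \<equiv> words_plus n r"
abbreviation "X \<equiv> cantor_top n r"
abbreviation "H \<equiv> homeos n r"
abbreviation "T \<equiv> T_elements n r"
abbreviation "clsupp \<equiv> closed_supp (cantor_top n r) (\<lambda>g. g)"
abbreviation "asupp \<equiv> act_supp (cantor_top n r) (\<lambda>g. g)"
text \<open>The greatest and the least tail. The cone of \<open>u\<close> ends at
  \<open>u @- M\<close> on the right and starts at \<open>u @- Z\<close> on the left, and every gap
  of the order lies between two such points.\<close>

definition M :: "letter stream" where "M = sconst (Plain (n - 1))"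
definition Z :: "letter stream" where "Z = sconst (Plain 0)"

lemma shift_D: "w @- x \<in> D \<longleftrightarrow> w \<in> words n \<and> x \<in> D"
  by (induction w) (auto simp: cantor1_def words_def streams_Stream)

lemma Cons_D: "a ## x \<in> D \<longleftrightarrow> a \<in> alphabet n \<and> x \<in> D"
  by (auto simp: cantor1_def streams_Stream)

lemma Cons_C: "a ## x \<in> C \<longleftrightarrow> a \<in> dotted_alphabet r \<and> x \<in> D"
  by (auto simp: cantor_def)

lemma Cons_W: "a # w \<in> W \<longleftrightarrow> a \<in> dotted_alphabet r \<and> w \<in> words n"
  by (auto simp: words_plus_def)

lemma Nil_W [simp]: "[] \<notin> W"
  by (auto simp: words_plus_def)

lemma Nil_words [simp]: "[] \<in> words n"
  by (simp add: words_def)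

lemma append_words: "u @ w \<in> words n \<longleftrightarrow> u \<in> words n \<and> w \<in> words n"
  by (auto simp: words_def)

lemma Cons_words: "a # w \<in> words n \<longleftrightarrow> a \<in> alphabet n \<and> w \<in> words n"
  by (auto simp: words_def)

lemma append_W: "u \<noteq> [] \<Longrightarrow> u @ w \<in> W \<longleftrightarrow> u \<in> W \<and> w \<in> words n"
  by (cases u) (auto simp: Cons_W append_words)

lemma append_WI: "u \<in> W \<Longrightarrow> w \<in> words n \<Longrightarrow> u @ w \<in> W"
  by (cases u) (auto simp: Cons_W append_words)

lemma shift_C: "u \<noteq> [] \<Longrightarrow> u @- x \<in> C \<longleftrightarrow> u \<in> W \<and> x \<in> D"
  by (cases u) (auto simp: Cons_W Cons_C shift_D)

lemma shift_CI: "u \<in> W \<Longrightarrow> x \<in> D \<Longrightarrow> u @- x \<in> C"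
  by (cases "u = []") (auto simp: shift_C)

lemma words_not_W: "w \<in> words n \<Longrightarrow> w \<notin> W"
  by (cases w) (auto simp: Cons_W Cons_words)

lemma C_not_D: "x \<in> C \<Longrightarrow> x \<notin> D"
  by (cases x) (auto simp: Cons_C Cons_D)

lemma M_D: "M \<in> D" and Z_D: "Z \<in> D"
  using n2 by (auto simp: cantor1_def M_def Z_def intro!: sconst_streams)

lemma stake_W: "x \<in> C \<Longrightarrow> 0 < k \<Longrightarrow> stake k x \<in> W"
  and sdrop_D: "x \<in> C \<Longrightarrow> 0 < k \<Longrightarrow> sdrop k x \<in> D"
  using shift_C[of "stake k x" "sdrop k x"] by (auto simp: stake_sdrop)

lemma stake_words: "x \<in> D \<Longrightarrow> stake k x \<in> words n"
  and sdrop_DD: "x \<in> D \<Longrightarrow> sdrop k x \<in> D"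
  using shift_D[of "stake k x" "sdrop k x"] by (auto simp: stake_sdrop)

lemma snth_D: "x \<in> D \<Longrightarrow> \<exists>i<n. x !! k = Plain i"
  using snth_in[of x "alphabet n" k] by (auto simp: cantor1_def)

lemma D_iff: "x \<in> D \<longleftrightarrow> (\<forall>k. x !! k \<in> alphabet n)"
  by (auto simp: cantor1_def streams_iff_snth)

lemma C_iff: "x \<in> C \<longleftrightarrow> (\<forall>k. x !! k \<in> (if k = 0 then dotted_alphabet r else alphabet n))"
proof (cases x)
  case (SCons a y)
  show ?thesis unfolding SCons Cons_C D_iff
    by (auto split: if_splits) (metis gr0_conv_Suc snth.simps stream.sel(2) nat.simps(3))+
qed

lemma has_prefix_iff: "has_prefix u x \<longleftrightarrow> (\<exists>z. x = u @- z)"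
proof
  assume "has_prefix u x"
  then show "\<exists>z. x = u @- z" using stake_sdrop[of "length u" x] by (metis has_prefix_def)
qed (auto simp: has_prefix_def stake_shift)

lemma has_prefix_shift [simp]: "has_prefix u (u @- z)"
  by (auto simp: has_prefix_iff)

lemma has_prefix_stake [simp]: "has_prefix (stake k x) x"
  by (auto simp: has_prefix_def)

lemma prefix_stake: "prefix u (stake k x) \<longleftrightarrow> length u \<le> k \<and> has_prefix u x"
proof
  assume "prefix u (stake k x)"
  then obtain w where "stake k x = u @ w" by (auto simp: prefix_def)
  then have "length u \<le> k" "x = u @- w @- sdrop k x"
    by (metis length_append length_stake le_add1, metis shift_append stake_sdrop)
  then show "length u \<le> k \<and> has_prefix u x" by (auto simp: has_prefix_iff)
next
  assume "length u \<le> k \<and> has_prefix u x"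
  then show "prefix u (stake k x)"
    by (auto simp: has_prefix_iff stake_shift prefix_def)
qed

lemma has_prefix_comparable:
  assumes "has_prefix u x" "has_prefix v x"
  shows "prefix u v \<or> prefix v u"
proof -
  have "prefix u (stake (length u + length v) x)" "prefix v (stake (length u + length v) x)"
    using assms by (auto simp: prefix_stake)
  then show ?thesis using prefix_same_cases by blast
qed

lemma shift_eqD:
  fixes u v :: "letter list"
  assumes "u @- x = v @- y"
  shows "prefix u v \<or> prefix v u"
  using has_prefix_comparable[of u "u @- x" v] has_prefix_shift[of u x] has_prefix_shift[of v y]
  unfolding assms by blast

lemma shift_eq_same_length: "length u = length v \<Longrightarrow> u @- x = v @- y \<longleftrightarrow> u = v \<and> x = y"
  by (induction u v rule: list_induct2) auto

lemma cone_iff: "u \<in> W \<Longrightarrow> x \<in> cone n r u \<longleftrightarrow> (\<exists>z\<in>D. x = u @- z)"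
  by (cases "u = []") (auto simp: cone_def has_prefix_iff shift_C)

lemma C_nonempty: "\<exists>x. x \<in> C"
  using r1 Cons_C[of "Dotted 0" Z] Z_D by (intro exI[of _ "Dotted 0 ## Z"]) auto

lemma snth_Z [simp]: "Z !! k = Plain 0" and snth_M [simp]: "M !! k = Plain (n - 1)"
  by (simp_all add: M_def Z_def)

lemma sdrop_Z [simp]: "sdrop k Z = Z" and sdrop_M [simp]: "sdrop k M = M"
  by (simp_all add: M_def Z_def)

lemma shd_Z [simp]: "shd Z = Plain 0" and shd_M [simp]: "shd M = Plain (n - 1)"
  and stl_Z [simp]: "stl Z = Z" and stl_M [simp]: "stl M = M"
  by (simp_all add: M_def Z_def)

lemma M_neq_Z: "M \<noteq> Z"
proof
  assume "M = Z"
  then have "M !! 0 = Z !! 0" by simp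
  then show False using n2 by simp
qed

text \<open>Beyond both prefixes only the constant tails remain, and \<open>n2\<close> makes them
  different. This is what separates right ends of cones from left ends.\<close>

lemma shift_M_Z: "u @- M \<noteq> v @- Z"
proof
  assume "u @- M = v @- Z"
  then have "sdrop (length u + length v) (u @- M) = sdrop (length u + length v) (v @- Z)" by simp
  then show False using M_neq_Z by (simp add: sdrop_shift)
qed

lemma finite_words_length: "finite {w \<in> words n. length w = m}"
proof -
  have "{w \<in> words n. length w = m} = {w. set w \<subseteq> alphabet n \<and> length w = m}"
    by (auto simp: words_def)
  then show ?thesis by (simp add: finite_lists_length_eq)
qed

definition level :: "nat \<Rightarrow> letter list set" where
  "level m = {u \<in> W. length u = m}"

lemma finite_level: "finite (level m)"
proof -
  have "level m \<subseteq> {w. set w \<subseteq> dotted_alphabet r \<union> alphabet n \<and> length w = m}"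
    by (auto simp: level_def words_plus_def words_def)
  then show ?thesis by (rule finite_subset) (simp add: finite_lists_length_eq)
qed

lemma stream_eqI:
  assumes "\<And>k. stake k x = stake k y"
  shows "x = y"
proof -
  have "snth x = snth y" using assms by (metis ext lessI stake_nth)
  then show ?thesis using stream_smap_nats by metis
qed

section \<open>Topology of the Cantor space through initial segments\<close>

lemma topspace_cantor [simp]: "topspace X = C"
  by (auto simp: cantor_top_def topspace_pullback_topology)

lemma openin_cantor:
  "openin X S \<longleftrightarrow>
     S \<subseteq> C \<and> (\<forall>x\<in>S. \<exists>m. \<forall>y\<in>C. stake m y = stake m x \<longrightarrow> y \<in> S)"
proof
  assume "openin X S"
  then obtain U where U: "openin (product_topology (\<lambda>_. discrete_topology UNIV) (UNIV :: nat set)) U"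
    and S: "S = snth -` U \<inter> C"
    by (auto simp: cantor_top_def openin_pullback_topology)
  show "S \<subseteq> C \<and> (\<forall>x\<in>S. \<exists>m. \<forall>y\<in>C. stake m y = stake m x \<longrightarrow> y \<in> S)"
  proof (intro conjI ballI)
    fix x assume "x \<in> S"
    then have "snth x \<in> U" using S by auto
    then obtain V where V: "finite {i. V i \<noteq> (UNIV :: letter set)}" "snth x \<in> PiE UNIV V" "PiE UNIV V \<subseteq> U"
      using U unfolding openin_product_topology_alt by auto
    obtain m where m: "\<And>i. V i \<noteq> UNIV \<Longrightarrow> i < m"
      using V(1) unfolding finite_nat_iff_bounded by blast
    have "y \<in> S" if "y \<in> C" "stake m y = stake m x" for y
    proof -
      have "y !! i \<in> V i" for i
      proof (cases "i < m")
        case True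
        then have "y !! i = x !! i" using that by (metis stake_nth)
        then show ?thesis using V(2) by auto
      qed (use m in auto)
      then have "snth y \<in> U" using V(3) by auto
      then show ?thesis using S that by auto
    qed
    then show "\<exists>m. \<forall>y\<in>C. stake m y = stake m x \<longrightarrow> y \<in> S" by blast
  qed (use S in auto)
next
  assume S: "S \<subseteq> C \<and> (\<forall>x\<in>S. \<exists>m. \<forall>y\<in>C. stake m y = stake m x \<longrightarrow> y \<in> S)"
  then obtain m where m: "\<And>x y. x \<in> S \<Longrightarrow> y \<in> C \<Longrightarrow> stake (m x) y = stake (m x) x \<Longrightarrow> y \<in> S"
    by metis
  define B where "B x = PiE UNIV (\<lambda>i. if i < m x then {x !! i} else UNIV)" for x
  have B: "snth y \<in> B x \<longleftrightarrow> stake (m x) y = stake (m x) x" for x y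
    by (auto simp: B_def PiE_iff list_eq_iff_nth_eq)
  have "openin (product_topology (\<lambda>_. discrete_topology UNIV) (UNIV :: nat set)) (B x)" for x
    unfolding B_def by (subst openin_PiE_gen) auto
  then have "openin (product_topology (\<lambda>_. discrete_topology UNIV) (UNIV :: nat set)) (\<Union>x\<in>S. B x)"
    by blast
  moreover have "S = snth -` (\<Union>x\<in>S. B x) \<inter> C"
    using S m by (auto simp: B)
  ultimately show "openin X S"
    unfolding cantor_top_def openin_pullback_topology by blast
qed

text \<open>The space is the continuous image, under reading a sequence as a stream, of a product of
  finite discrete alphabets, with the dotted letters at position 0.\<close>

lemma compact_cantor: "compact_space X"
proof -
  let ?P = "product_topology (\<lambda>_. discrete_topology (UNIV :: letter set)) (UNIV :: nat set)"
  let ?A = "PiE UNIV (\<lambda>k::nat. if k = 0 then dotted_alphabet r else alphabet n)"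
  let ?s = "\<lambda>f :: nat \<Rightarrow> letter. smap f nats"
  have nth: "snth (?s f) = f" for f :: "nat \<Rightarrow> letter" by (auto simp: fun_eq_iff)
  have "compactin ?P ?A" by (subst compactin_PiE) (auto intro!: finite_imp_compactin)
  then have "compactin (subtopology ?P ?A) ?A" by (simp add: compactin_subtopology)
  moreover have "continuous_map (subtopology ?P ?A) X ?s"
    unfolding cantor_top_def
  proof (rule continuous_map_pullback')
    have "snth \<circ> ?s = id" using nth by auto
    then show "continuous_map (subtopology ?P ?A) ?P (snth \<circ> ?s)"
      by (metis continuous_map_from_subtopology continuous_map_id)
    show "topspace (subtopology ?P ?A) \<subseteq> ?s -` C"
      by (auto simp: C_iff nth PiE_iff)
  qed
  ultimately have "compactin X (?s ` ?A)" by (rule image_compactin)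
  moreover have "?s ` ?A = C"
  proof (intro equalityI subsetI)
    fix x assume "x \<in> C"
    then have "snth x \<in> ?A" by (auto simp: C_iff PiE_iff)
    moreover have "x = ?s (snth x)" by (rule stream_smap_nats)
    ultimately show "x \<in> ?s ` ?A" by blast
  next
    fix x assume "x \<in> ?s ` ?A"
    then obtain f where f: "f \<in> ?A" "x = ?s f" by blast
    show "x \<in> C" unfolding C_iff using PiE_mem[OF f(1)] f(2) nth[of f] by (metis UNIV_I)
  qed
  ultimately show ?thesis by (simp add: compact_space_def)
qed

lemma Hausdorff_cantor: "Hausdorff_space X"
  unfolding Hausdorff_space_def
proof (intro allI impI)
  fix x y assume xy: "x \<in> topspace X \<and> y \<in> topspace X \<and> x \<noteq> y"
  then obtain k where k: "stake k x \<noteq> stake k y" using stream_eqI by blast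
  let ?U = "\<lambda>x. {z \<in> C. stake k z = stake k x}"
  have "openin X (?U z)" for z by (auto simp: openin_cantor intro!: exI[of _ k])
  moreover have "disjnt (?U x) (?U y)" using k by (auto simp: disjnt_def)
  ultimately show "\<exists>U V. openin X U \<and> openin X V \<and> x \<in> U \<and> y \<in> V \<and> disjnt U V"
    using xy by (intro exI[of _ "?U x"] exI[of _ "?U y"]) auto
qed

text \<open>The working form of compactness. Cones on whose defining word \<open>P\<close> holds
  cover the space; a finite subcover has a maximal depth, and monotonicity carries \<open>P\<close>
  down to that depth everywhere.\<close>

lemma uniform_depth:
  assumes mono: "\<And>x k m. x \<in> C \<Longrightarrow> P (stake k x) \<Longrightarrow> k \<le> m \<Longrightarrow> P (stake m x)"
    and ex: "\<And>x. x \<in> C \<Longrightarrow> \<exists>m. P (stake m x)"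
  shows "\<exists>m. \<forall>x\<in>C. P (stake m x)"
proof -
  obtain d where d: "\<And>x. x \<in> C \<Longrightarrow> P (stake (d x) x)" using ex by metis
  define U where "U x = {y \<in> C. stake (d x) y = stake (d x) x}" for x
  have "openin X (U x)" for x
    by (auto simp: openin_cantor U_def intro!: exI[of _ "d x"])
  moreover have "topspace X \<subseteq> \<Union> (U ` C)" by (auto simp: U_def)
  ultimately have "\<exists>\<F>. finite \<F> \<and> \<F> \<subseteq> U ` C \<and> topspace X \<subseteq> \<Union> \<F>"
    using compact_cantor[unfolded compact_space_alt, rule_format, of "U ` C"] by blast
  then obtain \<F> where \<F>: "finite \<F>" "\<F> \<subseteq> U ` C" "C \<subseteq> \<Union> \<F>" by auto
  then obtain E where E: "finite E" "E \<subseteq> C" "\<F> = U ` E" by (metis finite_subset_image)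
  have "P (stake (Max (d ` E)) x)" if x: "x \<in> C" for x
  proof -
    obtain e where e: "e \<in> E" "stake (d e) x = stake (d e) e" using \<F>(3) E(3) x by (auto simp: U_def)
    then have "P (stake (d e) x)" using d E by auto
    then show ?thesis using mono[OF x, of "d e"] e E by auto
  qed
  then show ?thesis by blast
qed

definition stake_continuous :: "(letter stream \<Rightarrow> letter stream) \<Rightarrow> bool" where
  "stake_continuous f \<longleftrightarrow> (\<forall>x\<in>C. \<forall>m. \<exists>k. \<forall>y\<in>C. stake k y = stake k x \<longrightarrow> stake m (f y) = stake m (f x))"

lemma continuous_map_cantor:
  "continuous_map X X f \<longleftrightarrow> f \<in> C \<rightarrow> C \<and> stake_continuous f"
proof (intro iffI conjI)
  assume f: "continuous_map X X f"
  then show fC: "f \<in> C \<rightarrow> C" by (auto simp: continuous_map_def)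
  show "stake_continuous f"
    unfolding stake_continuous_def
  proof (intro ballI allI)
    fix x m assume x: "x \<in> C"
    have "openin X {z \<in> C. stake m z = stake m (f x)}"
      by (auto simp: openin_cantor intro!: exI[of _ m])
    then have "openin X {y \<in> topspace X. f y \<in> {z \<in> C. stake m z = stake m (f x)}}"
      using f unfolding continuous_map_def by blast
    moreover have "x \<in> {y \<in> topspace X. f y \<in> {z \<in> C. stake m z = stake m (f x)}}"
      using x fC by auto
    ultimately obtain k where
      "\<forall>y\<in>C. stake k y = stake k x \<longrightarrow> y \<in> {y \<in> topspace X. f y \<in> {z \<in> C. stake m z = stake m (f x)}}"
      unfolding openin_cantor by meson
    then show "\<exists>k. \<forall>y\<in>C. stake k y = stake k x \<longrightarrow> stake m (f y) = stake m (f x)"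
      by (intro exI[of _ k]) simp
  qed
next
  assume f: "f \<in> C \<rightarrow> C \<and> stake_continuous f"
  show "continuous_map X X f"
    unfolding continuous_map_def
  proof (intro conjI allI impI)
    fix U assume U: "openin X U"
    show "openin X {x \<in> topspace X. f x \<in> U}"
      unfolding openin_cantor
    proof (intro conjI ballI)
      fix x assume x: "x \<in> {x \<in> topspace X. f x \<in> U}"
      then obtain m where m: "\<forall>y\<in>C. stake m y = stake m (f x) \<longrightarrow> y \<in> U"
        using U unfolding openin_cantor by auto
      obtain k where "\<forall>y\<in>C. stake k y = stake k x \<longrightarrow> stake m (f y) = stake m (f x)"
        using f x unfolding stake_continuous_def by (metis (no_types, lifting) mem_Collect_eq topspace_cantor)
      then show "\<exists>m. \<forall>y\<in>C. stake m y = stake m x \<longrightarrow> y \<in> {x \<in> topspace X. f x \<in> U}"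
        using m f by (intro exI[of _ k]) auto
    qed auto
  qed (use f in auto)
qed

text \<open>A continuous bijection of a compact Hausdorff space onto itself is a homeomorphism, so
  only one direction of continuity has to be checked for the maps built later.\<close>

lemma homeomorphic_cantor_iff:
  "homeomorphic_map X X h \<longleftrightarrow> bij_betw h C C \<and> stake_continuous h"
proof
  assume h: "homeomorphic_map X X h"
  then have "continuous_map X X h"
    by (rule homeomorphic_imp_continuous_map)
  then show "bij_betw h C C \<and> stake_continuous h"
    using h by (auto simp: homeomorphic_eq_everything_map continuous_map_cantor bij_betw_def)
next
  assume h: "bij_betw h C C \<and> stake_continuous h"
  then have "continuous_map X X h"
    by (auto simp: continuous_map_cantor bij_betw_def)
  then show "homeomorphic_map X X h"
    using h by (intro continuous_imp_homeomorphic_map compact_cantor Hausdorff_cantor)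
      (auto simp: bij_betw_def)
qed

section \<open>Homeomorphisms as extensional bijections\<close>

lemma homeos_iff: "h \<in> H \<longleftrightarrow> h \<in> extensional C \<and> bij_betw h C C \<and> stake_continuous h"
  by (simp add: homeos_def homeomorphic_cantor_iff)

lemma homeos_Bij: "h \<in> H \<Longrightarrow> h \<in> Bij C"
  by (simp add: homeos_iff Bij_def)

lemma homeos_closed: "h \<in> H \<Longrightarrow> x \<in> C \<Longrightarrow> h x \<in> C"
  by (auto simp: homeos_iff bij_betw_def)

lemma homeos_inj: "h \<in> H \<Longrightarrow> x \<in> C \<Longrightarrow> y \<in> C \<Longrightarrow> h x = h y \<longleftrightarrow> x = y"
  by (auto simp: homeos_iff bij_betw_def inj_on_def)

lemma homeos_surj: "h \<in> H \<Longrightarrow> y \<in> C \<Longrightarrow> \<exists>x\<in>C. y = h x"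
  by (auto simp: homeos_iff bij_betw_def)

lemma homeos_continuous: "h \<in> H \<Longrightarrow> x \<in> C \<Longrightarrow>
    \<exists>k. \<forall>y\<in>C. stake k y = stake k x \<longrightarrow> stake m (h y) = stake m (h x)"
  by (auto simp: homeos_iff stake_continuous_def)

lemma homeos_eqI: "\<lbrakk>g \<in> H; h \<in> H; \<And>x. x \<in> C \<Longrightarrow> g x = h x\<rbrakk> \<Longrightarrow> g = h"
  by (metis extensionalityI homeos_iff)

lemma homeo_inv_left: "h \<in> H \<Longrightarrow> x \<in> C \<Longrightarrow> homeo_inv n r h (h x) = x"
  and homeo_inv_right: "h \<in> H \<Longrightarrow> x \<in> C \<Longrightarrow> h (homeo_inv n r h x) = x"
  by (auto simp: homeo_inv_def homeos_iff bij_betw_inv_into_left bij_betw_inv_into_right bij_betw_apply)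

lemma homeo_inv_homeos:
  assumes h: "h \<in> H"
  shows "homeo_inv n r h \<in> H"
proof -
  have "homeomorphic_map X X h" using h by (simp add: homeos_def)
  then obtain g where g: "homeomorphic_maps X X h g"
    by (auto simp: homeomorphic_map_maps)
  then have gh: "homeomorphic_map X X g"
    using homeomorphic_maps_map by blast
  have eq: "homeo_inv n r h x = g x" if "x \<in> C" for x
  proof -
    have "g x \<in> C" using gh that by (auto simp: homeomorphic_cantor_iff bij_betw_def)
    moreover have "h (g x) = x" using g that by (auto simp: homeomorphic_maps_def)
    ultimately show ?thesis using homeo_inv_left[OF h] by metis
  qed
  have "homeomorphic_map X X (homeo_inv n r h)"
    by (rule homeomorphic_map_eq[OF gh]) (simp add: eq)
  then show ?thesis by (auto simp: homeos_def homeo_inv_def)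
qed

lemma compose_homeos:
  assumes "g \<in> H" "h \<in> H"
  shows "compose C g h \<in> H"
proof -
  have "homeomorphic_map X X (g \<circ> h)"
    using assms by (auto simp: homeos_def intro: homeomorphic_map_compose)
  then have "homeomorphic_map X X (compose C g h)"
    by (rule homeomorphic_map_eq) (auto simp: compose_def)
  then show ?thesis by (auto simp: homeos_def compose_def)
qed

lemma id_homeos: "(\<lambda>x\<in>C. x) \<in> H"
  by (auto simp: homeos_iff stake_continuous_def bij_betw_def inj_on_def)

end

section \<open>Successors in the cyclic order\<close>

fun lsuc :: "letter \<Rightarrow> letter \<Rightarrow> bool" where
  "lsuc (Dotted a) (Dotted b) \<longleftrightarrow> b = Suc a"
| "lsuc (Plain i) (Plain j) \<longleftrightarrow> j = Suc i"
| "lsuc _ _ \<longleftrightarrow> False"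

lemma letter_less_irrefl [simp]: "\<not> letter_less a a"
  by (cases a) auto

lemma letter_less_trans: "letter_less a b \<Longrightarrow> letter_less b c \<Longrightarrow> letter_less a c"
  by (cases a; cases b; cases c) auto

lemma lsuc_less: "lsuc a b \<Longrightarrow> letter_less a b"
  by (cases a; cases b) auto

lemma lsuc_gap: "lsuc a b \<Longrightarrow> letter_less a c \<Longrightarrow> c = b \<or> letter_less b c"
  by (cases a; cases b; cases c) auto

text \<open>Lexicographic order, with letters of different kinds incomparable. On
  \<open>cantor n r\<close> it is linear: the order of the circle cut open between the greatest and
  the least point.\<close>

definition sless :: "letter stream \<Rightarrow> letter stream \<Rightarrow> bool" where
  "sless x y \<longleftrightarrow> (\<exists>k. (\<forall>i<k. x !! i = y !! i) \<and> letter_less (x !! k) (y !! k))"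

lemma sless_irrefl [simp]: "\<not> sless x x"
  by (auto simp: sless_def)

lemma sless_trans:
  assumes "sless x y" "sless y z"
  shows "sless x z"
proof -
  obtain k l where k: "\<forall>i<k. x !! i = y !! i" "letter_less (x !! k) (y !! k)"
    and l: "\<forall>i<l. y !! i = z !! i" "letter_less (y !! l) (z !! l)"
    using assms by (auto simp: sless_def)
  consider "k < l" | "k = l" | "l < k" by linarith
  then show ?thesis
  proof cases
    case 1
    then show ?thesis unfolding sless_def using k l by (intro exI[of _ k]) auto
  next
    case 2
    then show ?thesis unfolding sless_def using k l by (intro exI[of _ k]) (auto intro: letter_less_trans)
  next
    case 3
    then show ?thesis unfolding sless_def using k l by (intro exI[of _ l]) auto
  qed
qed

lemma sless_asym: "sless x y \<Longrightarrow> \<not> sless y x"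
  using sless_trans sless_irrefl by blast

lemma sless_shift: "sless (u @- x) (u @- y) \<longleftrightarrow> sless x y"
proof
  assume "sless (u @- x) (u @- y)"
  then obtain k where k: "\<forall>i<k. (u @- x) !! i = (u @- y) !! i" "letter_less ((u @- x) !! k) ((u @- y) !! k)"
    by (auto simp: sless_def)
  then have len: "length u \<le> k" by (metis letter_less_irrefl not_le shift_snth_less)
  have "x !! i = y !! i" if "i < k - length u" for i
    using k(1)[rule_format, of "i + length u"] that by simp
  then show "sless x y" unfolding sless_def using k(2) len by (intro exI[of _ "k - length u"]) auto
next
  assume "sless x y"
  then obtain k where "\<forall>i<k. x !! i = y !! i" "letter_less (x !! k) (y !! k)" by (auto simp: sless_def)
  then show "sless (u @- x) (u @- y)"
    unfolding sless_def by (intro exI[of _ "length u + k"]) (auto simp: shift_snth)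
qed

lemma sless_fork: "letter_less a b \<Longrightarrow> sless (w @- a ## x) (w @- b ## y)"
  unfolding sless_shift by (auto simp: sless_def intro!: exI[of _ 0])

lemma lex_less_trans: "lex_less u v \<Longrightarrow> lex_less v w \<Longrightarrow> lex_less u w"
  unfolding lex_less_def
  by (rule lexord_trans) (auto simp: trans_def intro: letter_less_trans)

lemma lex_less_irrefl: "\<not> lex_less u u"
  unfolding lex_less_def by (rule lexord_irreflexive) auto

lemma lex_less_sless:
  assumes "lex_less u v" "\<not> prefix u v"
  shows "sless (u @- x) (v @- y)"
proof -
  obtain w a b u' v' where "letter_less a b" "u = w @ a # u'" "v = w @ b # v'"
    using assms unfolding lex_less_def lexord_def prefix_def by blast
  then show ?thesis by (simp add: sless_fork)
qed

lemma lex_less_fork: "letter_less a b \<Longrightarrow> lex_less (w @ a # u) (w @ b # v)"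
  unfolding lex_less_def lexord_def by blast

context cantor_params
begin

section \<open>The linear order of the points and its gaps\<close>

lemma sless_total:
  assumes x: "x \<in> C" and y: "y \<in> C" and "x \<noteq> y"
  shows "sless x y \<or> sless y x"
proof -
  have "snth x \<noteq> snth y" using assms(3) stream_smap_nats by metis
  then have "\<exists>k. x !! k \<noteq> y !! k" by auto
  then obtain k where k: "x !! k \<noteq> y !! k" and less: "\<forall>i<k. x !! i = y !! i"
    using exists_least_iff[of "\<lambda>k. x !! k \<noteq> y !! k"] by auto
  have "letter_less (x !! k) (y !! k) \<or> letter_less (y !! k) (x !! k)"
  proof (cases "k = 0")
    case True
    have "x !! k \<in> dotted_alphabet r" "y !! k \<in> dotted_alphabet r"
      using x y True unfolding C_iff by metis+
    then show ?thesis using k by auto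
  next
    case False
    have "x !! k \<in> alphabet n" "y !! k \<in> alphabet n"
      using x y False unfolding C_iff by metis+
    then show ?thesis using k by auto
  qed
  then show ?thesis unfolding sless_def
  proof
    assume "letter_less (x !! k) (y !! k)"
    then show "(\<exists>k. (\<forall>i<k. x !! i = y !! i) \<and> letter_less (x !! k) (y !! k)) \<or>
        (\<exists>k. (\<forall>i<k. y !! i = x !! i) \<and> letter_less (y !! k) (x !! k))"
      using less by blast
  next
    assume "letter_less (y !! k) (x !! k)"
    then show "(\<exists>k. (\<forall>i<k. x !! i = y !! i) \<and> letter_less (x !! k) (y !! k)) \<or>
        (\<exists>k. (\<forall>i<k. y !! i = x !! i) \<and> letter_less (y !! k) (x !! k))"
      using less by (intro disjI2 exI[of _ k]) simp
  qed
qed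

lemma incomparable_lex_less:
  assumes "\<not> prefix u v" "\<not> prefix v u" "u \<in> W" "v \<in> W"
  shows "lex_less u v \<or> lex_less v u"
proof -
  obtain w a b u' v' where w: "u = w @ a # u'" "v = w @ b # v'" "a \<noteq> b"
    using parallel_decomp[OF parallelI[OF assms(1,2)]] by auto
  have "letter_less a b \<or> letter_less b a"
  proof (cases "w = []")
    case True
    then show ?thesis using w assms by (auto simp: Cons_W)
  next
    case False
    then show ?thesis using w assms by (auto simp: append_W Cons_words)
  qed
  then show ?thesis unfolding w using lex_less_fork by blast
qed

lemma not_sless_Z: "\<not> sless z Z"
  unfolding sless_def by (auto, case_tac "z !! k") auto

lemma not_sless_M:
  assumes "z \<in> D"
  shows "\<not> sless M z"
proof
  assume "sless M z"
  then obtain k where "letter_less (Plain (n - 1)) (z !! k)" by (auto simp: sless_def)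
  then show False using snth_D[OF assms, of k] by auto
qed

definition bot_pt :: "letter stream" where "bot_pt = Dotted 0 ## Z"
definition top_pt :: "letter stream" where "top_pt = Dotted (r - 1) ## M"

lemma bot_pt_C: "bot_pt \<in> C" and top_pt_C: "top_pt \<in> C"
  using r1 Z_D M_D by (auto simp: bot_pt_def top_pt_def Cons_C)

lemma not_sless_bot:
  assumes "x \<in> C"
  shows "\<not> sless x bot_pt"
proof
  assume "sless x bot_pt"
  then obtain k where k: "letter_less (x !! k) (bot_pt !! k)" by (auto simp: sless_def)
  then show False by (cases k; cases "x !! k") (auto simp: bot_pt_def)
qed

lemma not_sless_top:
  assumes "x \<in> C"
  shows "\<not> sless top_pt x"
proof
  assume "sless top_pt x"
  then obtain k where k: "letter_less (top_pt !! k) (x !! k)" by (auto simp: sless_def)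
  have "x !! k \<in> (if k = 0 then dotted_alphabet r else alphabet n)" using assms unfolding C_iff by metis
  then show False using k by (cases k; cases "x !! k") (auto simp: top_pt_def)
qed

text \<open>The identified pairs of \<simeq> with a direction: \<open>x\<close> is the left and
  \<open>y\<close> the right endpoint of a gap in the order, or the pair closes the circle. Allowing
  \<open>w\<close> to be empty merges the clauses for plain and for dotted letters.\<close>

definition nxt :: "letter stream \<Rightarrow> letter stream \<Rightarrow> bool" where
  "nxt x y \<longleftrightarrow> x \<in> C \<and> y \<in> C \<and>
     ((\<exists>w a b. lsuc a b \<and> x = w @- a ## M \<and> y = w @- b ## Z) \<or> x = top_pt \<and> y = bot_pt)"

lemma nxt_fork: "lsuc a b \<Longrightarrow> w @- a ## M \<in> C \<Longrightarrow> w @- b ## Z \<in> C \<Longrightarrow> nxt (w @- a ## M) (w @- b ## Z)"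
  unfolding nxt_def by blast

lemma nxt_C: "nxt x y \<Longrightarrow> x \<in> C" "nxt x y \<Longrightarrow> y \<in> C"
  by (auto simp: nxt_def)

text \<open>Look at the first letter where \<open>z\<close> exceeds \<open>w @- a ## M\<close>.
  Inside \<open>w\<close> it puts \<open>z\<close> beyond the second point as well; at the branching
  letter it is \<open>b\<close> or larger, and nothing lies below \<open>Z\<close>; past it, no
  letter exceeds \<open>n - 1\<close>.\<close>

lemma gap:
  assumes ab: "lsuc a b" and z: "z \<in> C" and xz: "sless (w @- a ## M) z"
  shows "\<not> sless z (w @- b ## Z)"
proof
  let ?x = "w @- a ## M" and ?y = "w @- b ## Z"
  assume zy: "sless z ?y"
  obtain k where k: "\<forall>i<k. ?x !! i = z !! i" "letter_less (?x !! k) (z !! k)"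
    using xz by (auto simp: sless_def)
  consider "k < length w" | "k = length w" | "length w < k" by linarith
  then show False
  proof cases
    case 1
    then have "sless ?y z" unfolding sless_def using k by (intro exI[of _ k]) auto
    then show False using zy sless_asym by blast
  next
    case 2
    then have az: "letter_less a (z !! k)" using k by simp
    consider "z !! k = b" | "letter_less b (z !! k)" using lsuc_gap[OF ab az] by auto
    then show False
    proof cases
      case 1
      obtain j where j: "\<forall>i<j. z !! i = ?y !! i" "letter_less (z !! j) (?y !! j)"
        using zy by (auto simp: sless_def)
      have "z !! i = ?y !! i" if "i \<le> k" for i
        using k(1) 1 2 that by (cases "i = k") (auto dest: spec[of _ i])
      then have "k < j" using j by (metis letter_less_irrefl not_le)
      then have "?y !! j = Plain 0"
        using 2 by (cases "j - length w") (auto simp: shift_snth)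
      then show False using j by (cases "z !! j") auto
    next
      case b: 2
      then have "sless ?y z" unfolding sless_def using k 2 by (intro exI[of _ k]) auto
      then show False using zy sless_asym by blast
    qed
  next
    case 3
    then have "?x !! k = Plain (n - 1)"
      by (cases "k - length w") (auto simp: shift_snth)
    moreover have "z !! k \<in> alphabet n" using z 3 unfolding C_iff by (metis not_less_zero)
    ultimately show False using k by auto
  qed
qed

text \<open>The order-theoretic content of \<open>nxt\<close>, free of words. With linearity of
  \<open>sless\<close> and extremality of \<open>top_pt\<close> and \<open>bot_pt\<close> it yields
  uniqueness of neighbours on both sides.\<close>

lemma nxt_cases [consumes 1, case_names gap wrap]:
  assumes "nxt x y"
  obtains "sless x y" "\<And>z. z \<in> C \<Longrightarrow> sless x z \<Longrightarrow> \<not> sless z y" | "x = top_pt" "y = bot_pt"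
  using assms gap unfolding nxt_def by (metis lsuc_less sless_fork)

lemma nxt_right_unique:
  assumes "nxt x y" "nxt x y'"
  shows "y = y'"
  using assms(1)
proof (cases rule: nxt_cases)
  case gap
  show ?thesis
    using assms(2)
  proof (cases rule: nxt_cases)
    case gap': gap
    show ?thesis using gap gap' sless_total assms nxt_C by metis
  next
    case wrap
    then show ?thesis using gap not_sless_top assms nxt_C by metis
  qed
next
  case wrap
  show ?thesis
    using assms(2)
  proof (cases rule: nxt_cases)
    case gap
    then show ?thesis using wrap not_sless_top assms nxt_C by metis
  qed (use wrap in auto)
qed

lemma nxt_left_unique:
  assumes "nxt x y" "nxt x' y"
  shows "x = x'"
  using assms(1)
proof (cases rule: nxt_cases)
  case gap
  show ?thesis
    using assms(2)
  proof (cases rule: nxt_cases)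
    case gap': gap
    show ?thesis using gap gap' sless_total assms nxt_C by metis
  next
    case wrap
    then show ?thesis using gap not_sless_bot assms nxt_C by metis
  qed
next
  case wrap
  show ?thesis
    using assms(2)
  proof (cases rule: nxt_cases)
    case gap
    then show ?thesis using wrap not_sless_bot assms nxt_C by metis
  qed (use wrap in auto)
qed

lemma M_unfold: "Plain (n - 1) ## M = M" and Z_unfold: "Plain 0 ## Z = Z"
  using stream.collapse[of M] stream.collapse[of Z] by simp_all

lemma nxt_form:
  assumes "nxt x y"
  obtains w a b where "x = w @- a ## M" "y = w @- b ## Z"
proof -
  have "top_pt = [] @- Dotted (r - 1) ## M" "bot_pt = [] @- Dotted 0 ## Z"
    by (simp_all add: top_pt_def bot_pt_def)
  then show thesis using assms that unfolding nxt_def by blast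
qed

lemma nxt_left_M: "nxt x y \<Longrightarrow> \<exists>u. u \<noteq> [] \<and> x = u @- M"
  by (erule nxt_form, rule_tac x = "w @ [a]" in exI) simp

lemma nxt_right_Z: "nxt x y \<Longrightarrow> \<exists>u. u \<noteq> [] \<and> y = u @- Z"
  by (erule nxt_form, rule_tac x = "w @ [b]" in exI) simp

lemma nxt_not_Z_M: "\<not> nxt (u @- Z) y" "\<not> nxt x (u @- M)"
  using nxt_left_M nxt_right_Z shift_M_Z by metis+

lemma nxt_neq: "nxt x y \<Longrightarrow> x \<noteq> y"
  using nxt_left_M nxt_right_Z shift_M_Z by metis

text \<open>Induction from the last letter: a letter \<open>n - 1\<close> is absorbed by the tail
  \<open>M\<close>, any smaller letter can be increased, and the last dotted letter wraps
  around.\<close>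

lemma nxt_exists: "u \<in> W \<Longrightarrow> \<exists>y. nxt (u @- M) y"
proof (induction u rule: rev_induct)
  case (snoc l u)
  show ?case
  proof (cases "u = []")
    case True
    then obtain a where a: "l = Dotted a" "a < r" using snoc by (auto simp: Cons_W)
    show ?thesis
    proof (cases "a = r - 1")
      case True
      then have "nxt ((u @ [l]) @- M) bot_pt"
        using \<open>u = []\<close> a top_pt_C bot_pt_C by (auto simp: nxt_def top_pt_def)
      then show ?thesis by blast
    next
      case False
      have "nxt ([] @- Dotted a ## M) ([] @- Dotted (Suc a) ## Z)"
        using a False M_D Z_D by (intro nxt_fork) (auto simp: Cons_C)
      then show ?thesis using True a by auto
    qed
  next
    case False
    then have uW: "u \<in> W" "l \<in> alphabet n" using snoc by (auto simp: append_W Cons_words)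
    then obtain i where i: "l = Plain i" "i < n" by auto
    show ?thesis
    proof (cases "i = n - 1")
      case True
      then have "l ## M = M" using i M_unfold by metis
      then have "(u @ [l]) @- M = u @- M" by simp
      then show ?thesis using snoc.IH uW by simp
    next
      case False
      have "nxt (u @- Plain i ## M) (u @- Plain (Suc i) ## Z)"
        using uW i False M_D Z_D by (intro nxt_fork) (auto intro!: shift_CI simp: Cons_D)
      then show ?thesis using i by auto
    qed
  qed
qed simp

lemma circle_eq_iff: "circle_eq n r x y \<longleftrightarrow> x \<in> C \<and> y \<in> C \<and> (x = y \<or> nxt x y \<or> nxt y x)"
proof
  assume c: "circle_eq n r x y"
  then have C: "x \<in> C" "y \<in> C" by (auto simp: circle_eq_def)
  consider "x = y"
    | w i where "w \<in> W" "0 < i" "{x, y} = {w @- Plain i ## Z, w @- Plain (i - 1) ## M}"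
    | a where "0 < a" "{x, y} = {Dotted a ## Z, Dotted (a - 1) ## M}"
    | "{x, y} = {bot_pt, top_pt}"
    using c unfolding circle_eq_def bot_pt_def top_pt_def M_def Z_def by blast
  then have "x = y \<or> nxt x y \<or> nxt y x"
  proof cases
    case (2 w i)
    have "lsuc (Plain (i - 1)) (Plain i)" using 2 by simp
    then show ?thesis using 2 C unfolding doubleton_eq_iff nxt_def by blast
  next
    case (3 a)
    have "lsuc (Dotted (a - 1)) (Dotted a)" using 3 by simp
    moreover have "{x, y} = {[] @- Dotted a ## Z, [] @- Dotted (a - 1) ## M}" using 3 by simp
    ultimately show ?thesis using C unfolding doubleton_eq_iff nxt_def by blast
  next
    case 4
    then show ?thesis using C unfolding doubleton_eq_iff nxt_def by blast
  qed auto
  then show "x \<in> C \<and> y \<in> C \<and> (x = y \<or> nxt x y \<or> nxt y x)" using C by blast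
next
  have nxt: "circle_eq n r x y \<and> circle_eq n r y x" if nx: "nxt x y" for x y
  proof -
    have C: "x \<in> C" "y \<in> C" using nxt_C nx by auto
    consider w a b where "lsuc a b" "x = w @- a ## M" "y = w @- b ## Z" | "x = top_pt" "y = bot_pt"
      using nx unfolding nxt_def by blast
    then show ?thesis
    proof cases
      case (1 w a b)
      show ?thesis
      proof (cases "w = []")
        case True
        then obtain c where "a = Dotted c" "b = Dotted (Suc c)" "Suc c < r"
          using 1 C by (cases a; cases b) (auto simp: Cons_C)
        then have "\<exists>a. 0 < a \<and> a \<le> r - 1 \<and> {x, y} = {Dotted a ## Z, Dotted (a - 1) ## M}"
          using 1 True by (intro exI[of _ "Suc c"]) auto
        then show ?thesis unfolding circle_eq_def M_def[symmetric] Z_def[symmetric] using C by (simp add: insert_commute)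
      next
        case False
        then have "w \<in> W" "a ## M \<in> D" "b ## Z \<in> D" using 1 C by (auto simp: shift_C)
        moreover obtain c where "a = Plain c" "b = Plain (Suc c)" "Suc c < n"
          using 1 calculation by (cases a; cases b) (auto simp: Cons_D)
        ultimately have "\<exists>w\<in>W. \<exists>i. 0 < i \<and> i \<le> n - 1 \<and>
            {x, y} = {w @- Plain i ## Z, w @- Plain (i - 1) ## M}"
          using 1 by (intro bexI[of _ w] exI[of _ "Suc c"]) auto
        then show ?thesis unfolding circle_eq_def M_def[symmetric] Z_def[symmetric] using C by (simp add: insert_commute)
      qed
    next
      case 2
      then have "{x, y} = {Dotted 0 ## Z, Dotted (r - 1) ## M}" by (auto simp: bot_pt_def top_pt_def)
      then show ?thesis unfolding circle_eq_def M_def[symmetric] Z_def[symmetric] using C by (simp add: insert_commute)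
    qed
  qed
  assume "x \<in> C \<and> y \<in> C \<and> (x = y \<or> nxt x y \<or> nxt y x)"
  then show "circle_eq n r x y" using nxt by (auto simp: circle_eq_def)
qed

text \<open>The two points agree up to the branching word \<open>w\<close>. If only one of them lies
  in the cone of \<open>u\<close>, the branching happens before \<open>u\<close> ends, so what
  remains of \<open>x\<close> after \<open>u\<close> is \<open>M\<close>.\<close>

lemma nxt_leave_cone:
  assumes "nxt x y" "u \<in> W" "has_prefix u x" "\<not> has_prefix u y"
  shows "x = u @- M"
proof -
  obtain w a b where w: "x = w @- a ## M" "y = w @- b ## Z" 
    using nxt_form[OF assms(1)] by metis
  have "\<not> prefix u w" using assms(4) w(2) by (auto simp: has_prefix_iff prefix_def)
  then have "length w < length u"
    using has_prefix_comparable[OF assms(3), of w] w(1)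
    by (metis has_prefix_shift not_le prefix_length_le prefix_length_prefix prefix_order.refl)
  then have "sdrop (length u) x = M"
    unfolding w(1) by (cases "length u - length w") (auto simp: sdrop_shift)
  then show ?thesis using assms(3) by (metis has_prefix_def stake_sdrop)
qed

lemma nxt_enter_cone:
  assumes "nxt x y" "u \<in> W" "has_prefix u y" "\<not> has_prefix u x"
  shows "y = u @- Z"
proof -
  obtain w a b where w: "x = w @- a ## M" "y = w @- b ## Z" 
    using nxt_form[OF assms(1)] by metis
  have "\<not> prefix u w" using assms(4) w(1) by (auto simp: has_prefix_iff prefix_def)
  then have "length w < length u"
    using has_prefix_comparable[OF assms(3), of w] w(2)
    by (metis has_prefix_shift not_le prefix_length_le prefix_length_prefix prefix_order.refl)
  then have "sdrop (length u) y = Z"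
    unfolding w(2) by (cases "length u - length w") (auto simp: sdrop_shift)
  then show ?thesis using assms(3) by (metis has_prefix_def stake_sdrop)
qed

text \<open>Two adjacent points in one cone branch after \<open>u\<close>, so the prefix may be
  exchanged. The exception is the pair \<open>top_pt\<close>, \<open>bot_pt\<close>: it lies in one
  cone only if that cone is the whole space.\<close>

lemma nxt_same_cone:
  assumes nx: "nxt (u @- x) (u @- y)" and u: "u \<in> W" and v: "v \<in> W"
  shows "nxt (v @- x) (v @- y) \<or> r = 1 \<and> u = [Dotted 0]"
proof -
  have D: "x \<in> D" "y \<in> D" using nxt_C[OF nx] u shift_C[of u] by (cases "u = []"; simp)+
  consider w a b where "lsuc a b" "u @- x = w @- a ## M" "u @- y = w @- b ## Z"
    | "u @- x = top_pt" "u @- y = bot_pt"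
    using nx unfolding nxt_def by blast
  then show ?thesis
  proof cases
    case (1 w a b)
    have "prefix u w"
    proof (rule ccontr)
      assume np: "\<not> prefix u w"
      then have "prefix w u" using 1(2) shift_eqD by metis
      then obtain c u' where "u = w @ c # u'" using np by (metis append_Nil2 neq_Nil_conv prefix_def prefix_order.refl)
      then have "c = a" "c = b" using 1 by auto
      then show False using lsuc_less[OF 1(1)] by simp
    qed
    then obtain w' where "w = u @ w'" by (auto simp: prefix_def)
    then have "x = w' @- a ## M" "y = w' @- b ## Z" using 1 by auto
    then have "v @- x = (v @ w') @- a ## M" "v @- y = (v @ w') @- b ## Z" by auto
    then show ?thesis unfolding nxt_def using 1(1) v D shift_CI by blast
  next
    case 2
    then obtain c u' where cu: "u = c # u'" using u by (cases u) auto
    with 2 have c: "c = Dotted (r - 1)" "c = Dotted 0" "u' @- x = M" "u' @- y = Z"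
      by (auto simp: top_pt_def bot_pt_def)
    have "u' = []"
    proof (cases u')
      case (Cons d u'')
      then have "d = shd M" "d = shd Z" using c(3,4) by (metis shift.simps(2) stream.sel(1))+
      then show ?thesis using n2 by simp
    qed
    then show ?thesis using c cu r1 by auto
  qed
qed

section \<open>Complete antichains in cyclic order\<close>

lemma antichain_disjoint:
  assumes "complete_antichain n r U" "u \<in> U" "v \<in> U" "u @- x = v @- y"
  shows "u = v"
  using assms shift_eqD unfolding complete_antichain_def by metis

lemma antichain_cover:
  assumes "complete_antichain n r U" "x \<in> C"
  obtains u z where "u \<in> U" "u \<in> W" "z \<in> D" "x = u @- z"
  using assms cone_iff unfolding complete_antichain_def by (metis UN_E subsetD)

lemma antichain_W: "complete_antichain n r U \<Longrightarrow> u \<in> U \<Longrightarrow> u \<in> W"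
  by (auto simp: complete_antichain_def)

lemma lists_antichain_sless:
  assumes us: "lists_antichain n r us" and "i < j" "j < length us"
  shows "sless (us ! i @- x) (us ! j @- y)"
proof -
  have "lex_less (us ! i) (us ! j)"
    using us assms(2,3) by (auto simp: lists_antichain_def sorted_wrt_iff_nth_less)
  moreover have "us ! i \<noteq> us ! j" using calculation lex_less_irrefl by metis
  then have "\<not> prefix (us ! i) (us ! j)"
    using us assms(2,3) by (auto simp: lists_antichain_def complete_antichain_def)
  ultimately show ?thesis by (rule lex_less_sless)
qed

lemma lists_antichain_distinct:
  assumes us: "lists_antichain n r us"
  shows "distinct us"
  unfolding distinct_conv_nth
  by (metis lists_antichain_sless[OF us] nat_neq_iff sless_irrefl)

lemma lists_antichain_cover:
  assumes us: "lists_antichain n r us" and "x \<in> C"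
  obtains j z where "j < length us" "z \<in> D" "x = us ! j @- z"
  using antichain_cover assms unfolding lists_antichain_def by (metis in_set_conv_nth)

text \<open>The successor of the right end of cone \<open>i\<close> lies in some cone
  \<open>j\<close>. Were it beyond the left end of the next cone, that left end would lie inside the
  gap; at the end of the list, minimality of \<open>bot_pt\<close> takes over this role.\<close>

lemma lists_antichain_nxt:
  assumes us: "lists_antichain n r us" and i: "i < length us"
  shows "nxt (us ! i @- M) (us ! (Suc i mod length us) @- Z)"
proof -
  have W: "us ! j \<in> W" if "j < length us" for j
    using us that antichain_W by (auto simp: lists_antichain_def)
  obtain y where y: "nxt (us ! i @- M) y" using nxt_exists W i by blast
  obtain j z where j: "j < length us" "z \<in> D" "y = us ! j @- z"
    using lists_antichain_cover[OF us] nxt_C(2)[OF y] by metis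
  have zZ: "z = Z \<or> sless Z z"
    using sless_total[OF shift_CI shift_CI] W[OF i] j Z_D sless_shift not_sless_Z by (metis shift_left_inj)
  show ?thesis
    using y
  proof (cases rule: nxt_cases)
    case gap
    have "j \<noteq> i" using gap(1) j not_sless_M by (auto simp: sless_shift)
    moreover have "\<not> j < i"
      using gap(1) j lists_antichain_sless[OF us _ i] sless_asym by blast
    ultimately have ij: "i < j" by linarith
    then have "Suc i < length us" using j by linarith
    then have C: "us ! Suc i @- Z \<in> C" and less: "sless (us ! i @- M) (us ! Suc i @- Z)"
      using W Z_D lists_antichain_sless[OF us] shift_CI by auto
    then have nl: "\<not> sless (us ! Suc i @- Z) y" using gap(2) by blast
    then have "\<not> Suc i < j" using j lists_antichain_sless[OF us] by blast
    then have "j = Suc i" using ij by linarith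
    moreover from this have "z = Z" using zZ nl j by (auto simp: sless_shift)
    ultimately show ?thesis using y j by auto
  next
    case wrap
    have "Suc i = length us"
    proof (rule ccontr)
      assume "Suc i \<noteq> length us"
      then have "Suc i < length us" using i by linarith
      then have "sless top_pt (us ! Suc i @- Z)" "us ! Suc i @- Z \<in> C"
        using lists_antichain_sless[OF us, of i "Suc i" M Z] wrap W Z_D shift_CI by auto
      then show False using not_sless_top by blast
    qed
    then have mod: "Suc i mod length us = 0" by simp
    have z0: "0 < length us" using i by linarith
    then have C: "us ! 0 @- Z \<in> C" using W Z_D shift_CI by blast
    have nl: "\<not> sless (us ! 0 @- Z) y" using wrap not_sless_bot[OF C] by simp
    then have "\<not> 0 < j" using j lists_antichain_sless[OF us] by blast
    moreover from this have "z = Z" using zZ nl j by (auto simp: sless_shift)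
    ultimately show ?thesis using y j mod by auto
  qed
qed

lemma sorted_list_exists:
  assumes "finite A" "\<And>u v. u \<in> A \<Longrightarrow> v \<in> A \<Longrightarrow> u \<noteq> v \<Longrightarrow> lex_less u v \<or> lex_less v u"
  shows "\<exists>us. set us = A \<and> sorted_wrt lex_less us"
  using assms
proof (induction A rule: finite_induct)
  case (insert x A)
  then obtain us where us: "set us = A" "sorted_wrt lex_less us" by auto
  let ?vs = "filter (\<lambda>u. lex_less u x) us @ x # filter (\<lambda>u. lex_less x u) us"
  have "set ?vs = insert x A" using us insert.hyps insert.prems by auto
  moreover have "sorted_wrt lex_less ?vs"
    using us by (auto simp: sorted_wrt_append sorted_wrt_filter intro: lex_less_trans)
  ultimately show ?case by blast
qed auto

lemma antichain_list:
  assumes "complete_antichain n r U"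
  obtains us where "lists_antichain n r us" "set us = U"
proof -
  have "\<exists>us. set us = U \<and> sorted_wrt lex_less us"
  proof (rule sorted_list_exists)
    show "finite U" using assms by (simp add: complete_antichain_def)
    show "lex_less u v \<or> lex_less v u" if "u \<in> U" "v \<in> U" "u \<noteq> v" for u v
      using assms that unfolding complete_antichain_def by (intro incomparable_lex_less) auto
  qed
  then show thesis using that assms by (auto simp: lists_antichain_def)
qed

end

section \<open>The elements of \<open>T\<close> as local prefix maps\<close>

lemma stake_shift_cong: "stake m x = stake m y \<Longrightarrow> stake m (v @- x) = stake m (v @- y)"
  by (metis diff_le_self min_absorb1 stake_shift take_stake)

text \<open>A discrete intermediate value principle on the cycle of residues: if no step left
  \<open>P\<close>, walking \<open>l - i + j\<close> steps from \<open>i\<close> would arrive at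
  \<open>j\<close> inside \<open>P\<close>.\<close>

lemma cyclic_exit:
  assumes "i < l" "P i" "j < l" "\<not> P j"
  shows "\<exists>i<l. P i \<and> \<not> P (Suc i mod l)"
proof (rule ccontr)
  assume "\<not> ?thesis"
  then have step: "P (Suc k mod l)" if "k < l" "P k" for k using that by blast
  have "P ((i + k) mod l)" for k
  proof (induction k)
    case (Suc k)
    then have "P (Suc ((i + k) mod l) mod l)" using step assms(1) by auto
    then show ?case by (simp add: mod_Suc_eq)
  qed (use assms in simp)
  from this[of "l - i + j"] show False using assms by simp
qed

lemma bij_betw_shift_mod: "bij_betw (\<lambda>i. (i + j) mod l) {..<l} {..<l :: nat}"
proof -
  have less: "(a + j) mod l \<noteq> (b + j) mod l" if "a < b" "b < l" for a b
    using that mod_eq_dvd_iff_nat[of "a + j" "b + j" l] nat_dvd_not_less[of "b - a" l] by auto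
  have "inj_on (\<lambda>i. (i + j) mod l) {..<l}"
  proof (rule inj_onI)
    fix a b assume "a \<in> {..<l}" "b \<in> {..<l}" "(a + j) mod l = (b + j) mod l"
    then show "a = b" using less[of a b] less[of b a] by (cases a b rule: linorder_cases) auto
  qed
  moreover have "(\<lambda>i. (i + j) mod l) ` {..<l} \<subseteq> {..<l}" by (cases "l = 0") auto
  ultimately show ?thesis by (simp add: bij_betw_def endo_inj_surj)
qed

context cantor_params
begin

text \<open>No antichain and no order is mentioned: the pointwise form composes and inverts easily,
  and \<open>uniform_depth\<close> recovers a finite antichain when one is wanted.\<close>

definition local_prefix_map :: "(letter stream \<Rightarrow> letter stream) \<Rightarrow> bool" where
  "local_prefix_map t \<longleftrightarrow>
     (\<forall>x\<in>C. \<exists>u\<in>W. \<exists>v\<in>W. has_prefix u x \<and> (\<forall>z\<in>D. t (u @- z) = v @- z))"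

lemma C_has_prefix: "x \<in> C \<Longrightarrow> u \<in> W \<Longrightarrow> has_prefix u x \<Longrightarrow> \<exists>z\<in>D. x = u @- z"
  using shift_C[of u] by (cases "u = []") (auto simp: has_prefix_iff)

lemma local_prefix_map_closed:
  assumes "local_prefix_map t" "x \<in> C"
  shows "t x \<in> C"
  using assms C_has_prefix[OF assms(2)] shift_CI unfolding local_prefix_map_def by metis

lemma local_prefix_map_continuous:
  assumes "local_prefix_map t"
  shows "stake_continuous t"
  unfolding stake_continuous_def
proof (intro ballI allI)
  fix x m assume x: "x \<in> C"
  then obtain u v where u: "u \<in> W" "has_prefix u x" "\<And>z. z \<in> D \<Longrightarrow> t (u @- z) = v @- z"
    using assms unfolding local_prefix_map_def by metis
  obtain z where z: "z \<in> D" "x = u @- z" using C_has_prefix x u by blast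
  have "stake m (t y) = stake m (t x)" if y: "y \<in> C" "stake (length u + m) y = stake (length u + m) x" for y
  proof -
    have "y = (u @ stake m z) @- sdrop (length u + m) y"
      using y(2) z(2) by (metis stake_sdrop stake_add stake_shift take_all_iff order_refl add_diff_cancel_left'
        le_add1)
    then obtain z' where z': "y = u @- stake m z @- z'" by auto
    then have "stake m z @- z' \<in> D" using y(1) u(1) shift_C[of u] by (cases "u = []") auto
    then have "t y = v @- stake m z @- z'" "t x = v @- z" using u(3) z z' by auto
    moreover have "stake m (stake m z @- z') = stake m z" by (simp add: stake_shift)
    ultimately show ?thesis using stake_shift_cong by metis
  qed
  then show "\<exists>k. \<forall>y\<in>C. stake k y = stake k x \<longrightarrow> stake m (t y) = stake m (t x)" by blast
qed

lemma local_prefix_map_compose: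
  assumes f: "local_prefix_map f" and g: "local_prefix_map g"
  shows "local_prefix_map (compose C f g)"
  unfolding local_prefix_map_def
proof
  fix x assume x: "x \<in> C"
  obtain u v where u: "u \<in> W" "v \<in> W" "has_prefix u x" "\<And>z. z \<in> D \<Longrightarrow> g (u @- z) = v @- z"
    using g x unfolding local_prefix_map_def by metis
  obtain z0 where z0: "z0 \<in> D" "x = u @- z0" using C_has_prefix x u by blast
  have gx: "g x = v @- z0" "g x \<in> C" using u z0 shift_CI by auto
  obtain u' v' where u': "u' \<in> W" "v' \<in> W" "has_prefix u' (g x)" "\<And>z. z \<in> D \<Longrightarrow> f (u' @- z) = v' @- z"
    using f gx unfolding local_prefix_map_def by metis
  have "has_prefix v (g x)" using gx by simp
  \<comment> \<open>The word written by \<open>g\<close> and the word read by \<open>f\<close> are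
    both prefixes of \<open>g x\<close>, so one extends the other by \<open>s\<close>; accordingly
    the output of \<open>f\<close> or the input of \<open>g\<close> is lengthened by
    \<open>s\<close>.\<close>
  then consider s where "v = u' @ s" | s where "u' = v @ s"
    using has_prefix_comparable u'(3) unfolding prefix_def by metis
  then show "\<exists>u\<in>W. \<exists>v\<in>W. has_prefix u x \<and> (\<forall>z\<in>D. compose C f g (u @- z) = v @- z)"
  proof cases
    case (1 s)
    then have s: "s \<in> words n" using u(2) u'(1) by (metis append_W Nil_W)
    have "compose C f g (u @- z) = (v' @ s) @- z" if "z \<in> D" for z
      using that u u' s 1 shift_CI[OF u(1) that] by (simp add: compose_def shift_D)
    then show ?thesis using u(1,3) append_WI[OF u'(2) s] by blast
  next
    case (2 s)
    then have s: "s \<in> words n" using u(2) u'(1) by (metis append_W Nil_W)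
    obtain z' where "z' \<in> D" "v @- z0 = v @- s @- z'" using C_has_prefix[OF gx(2) u'(1,3)] gx 2 by auto
    then have "has_prefix (u @ s) x" using z0 has_prefix_shift[of "u @ s" z'] by simp
    moreover have "compose C f g ((u @ s) @- z) = v' @- z" if "z \<in> D" for z
      using that u u' s 2 shift_CI[of "u @ s" z] append_WI[OF u(1) s] by (simp add: compose_def shift_D)
    ultimately show ?thesis using append_WI[OF u(1) s] u'(2) by blast
  qed
qed

lemma local_prefix_map_inv:
  assumes t: "t \<in> H" "local_prefix_map t"
  shows "local_prefix_map (homeo_inv n r t)"
  unfolding local_prefix_map_def
proof
  fix y assume "y \<in> C"
  then obtain x where x: "x \<in> C" "y = t x" using homeos_surj t by blast
  obtain u v where u: "u \<in> W" "v \<in> W" "has_prefix u x" "\<And>z. z \<in> D \<Longrightarrow> t (u @- z) = v @- z"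
    using t x unfolding local_prefix_map_def by metis
  have "has_prefix v y" using C_has_prefix[OF x(1) u(1,3)] u(4) x(2) by auto
  moreover have "homeo_inv n r t (v @- z) = u @- z" if "z \<in> D" for z
    using homeo_inv_left[OF t(1) shift_CI[OF u(1) that]] u(4)[OF that] by simp
  ultimately show "\<exists>u\<in>W. \<exists>v\<in>W. has_prefix u y \<and> (\<forall>z\<in>D. homeo_inv n r t (u @- z) = v @- z)"
    using u by blast
qed

section \<open>Prefix replacements between complete antichains\<close>

lemma level_antichain:
  assumes "0 < m"
  shows "complete_antichain n r (level m)"
proof -
  have "\<not> prefix u v" if "u \<in> level m" "v \<in> level m" "u \<noteq> v" for u v
  proof
    assume "prefix u v"
    then obtain w where "v = u @ w" by (auto simp: prefix_def)
    with that show False by (simp add: level_def)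
  qed
  moreover have "C \<subseteq> (\<Union>u\<in>level m. cone n r u)"
  proof
    fix x assume x: "x \<in> C"
    then have "stake m x \<in> level m" using assms by (simp add: level_def stake_W)
    moreover have "x \<in> cone n r (stake m x)" using x by (simp add: cone_def)
    ultimately show "x \<in> (\<Union>u\<in>level m. cone n r u)" by blast
  qed
  moreover have "level m \<subseteq> W" by (auto simp: level_def)
  ultimately show ?thesis unfolding complete_antichain_def using finite_level by simp
qed

text \<open>Injectivity of \<open>g\<close> gives the antichain: comparable words
  \<open>\<tau> u\<close> and \<open>\<tau> u'\<close> would give a point with preimages in two
  disjoint cones. Surjectivity gives the covering.\<close>

lemma image_antichain:
  assumes U: "complete_antichain n r U" and g: "g \<in> H"
    and \<tau>: "\<And>u. u \<in> U \<Longrightarrow> \<tau> u \<in> W" "\<And>u z. u \<in> U \<Longrightarrow> z \<in> D \<Longrightarrow> g (u @- z) = \<tau> u @- z"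
  shows "complete_antichain n r (\<tau> ` U)" "inj_on \<tau> U"
proof -
  have pre: "u = u'" if u: "u \<in> U" "u' \<in> U" and p: "prefix (\<tau> u) (\<tau> u')" for u u'
  proof -
    obtain w where w: "\<tau> u' = \<tau> u @ w" using p by (auto simp: prefix_def)
    then have wD: "w @- Z \<in> D" using \<tau>(1) u by (metis Nil_W Z_D append_W shift_D)
    have "g (u' @- Z) = g (u @- w @- Z)" using \<tau>(2)[OF u(2) Z_D] \<tau>(2)[OF u(1) wD] w by simp
    then have "u @- w @- Z = u' @- Z"
      using homeos_inj[OF g] shift_CI Z_D wD u antichain_W[OF U] by metis
    then show ?thesis using antichain_disjoint[OF U u] by blast
  qed
  then show "inj_on \<tau> U" by (metis inj_onI prefix_order.refl)
  have "C \<subseteq> (\<Union>v\<in>\<tau> ` U. cone n r v)"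
  proof
    fix y assume "y \<in> C"
    then obtain x where x: "x \<in> C" "y = g x" using homeos_surj g by blast
    obtain u z where "u \<in> U" "z \<in> D" "x = u @- z" using antichain_cover[OF U x(1)] by metis
    then show "y \<in> (\<Union>v\<in>\<tau> ` U. cone n r v)" using x \<tau> cone_iff by auto
  qed
  moreover have "\<not> prefix v v' \<and> \<not> prefix v' v" if "v \<in> \<tau> ` U" "v' \<in> \<tau> ` U" "v \<noteq> v'" for v v'
    using that pre by (metis imageE)
  moreover have "finite (\<tau> ` U)" "\<tau> ` U \<subseteq> W" using U \<tau>(1) by (auto simp: complete_antichain_def)
  ultimately show "complete_antichain n r (\<tau> ` U)" unfolding complete_antichain_def by simp
qed

lemma antichain_map_local:
  assumes U: "complete_antichain n r U" and V: "complete_antichain n r V" and \<sigma>: "\<sigma> \<in> U \<rightarrow> V"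
    and g: "\<And>u z. u \<in> U \<Longrightarrow> z \<in> D \<Longrightarrow> g (u @- z) = \<sigma> u @- z"
  shows "local_prefix_map g"
  unfolding local_prefix_map_def
proof
  fix x assume "x \<in> C"
  then obtain u z where u: "u \<in> U" "u \<in> W" "z \<in> D" "x = u @- z" using antichain_cover[OF U] by metis
  then have "\<sigma> u \<in> W" using \<sigma> antichain_W[OF V] by auto
  then show "\<exists>u\<in>W. \<exists>v\<in>W. has_prefix u x \<and> (\<forall>z\<in>D. g (u @- z) = v @- z)"
    using u g by (intro bexI[of _ u] bexI[of _ "\<sigma> u"]) auto
qed

lemma antichain_map:
  assumes U: "complete_antichain n r U" and V: "complete_antichain n r V" and \<sigma>: "bij_betw \<sigma> U V"
  obtains g where "g \<in> H" "\<And>u z. u \<in> U \<Longrightarrow> z \<in> D \<Longrightarrow> g (u @- z) = \<sigma> u @- z"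
proof -
  define pre where "pre x = (THE u. u \<in> U \<and> has_prefix u x)" for x
  have pre: "pre (u @- z) = u" if "u \<in> U" for u z
    unfolding pre_def
  proof (rule the_equality)
    fix v assume "v \<in> U \<and> has_prefix v (u @- z)"
    then show "v = u" using antichain_disjoint[OF U that, of v] unfolding has_prefix_iff by metis
  qed (use that in simp)
  define g where "g = (\<lambda>x\<in>C. \<sigma> (pre x) @- sdrop (length (pre x)) x)"
  have g: "g (u @- z) = \<sigma> u @- z" if "u \<in> U" "z \<in> D" for u z
    using that antichain_W[OF U] shift_CI by (simp add: g_def pre sdrop_shift)
  have lpm: "local_prefix_map g"
    using antichain_map_local[OF U V _ g] \<sigma> by (auto simp: bij_betw_def)
  have "inj_on g C"
  proof (rule inj_onI)
    fix x y assume "x \<in> C" "y \<in> C" and eq: "g x = g y"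
    then obtain u z u' z' where u: "u \<in> U" "z \<in> D" "x = u @- z" and u': "u' \<in> U" "z' \<in> D" "y = u' @- z'"
      using antichain_cover[OF U] by metis
    then have "\<sigma> u @- z = \<sigma> u' @- z'" using eq g by auto
    moreover from this have "\<sigma> u = \<sigma> u'"
      using antichain_disjoint[OF V] \<sigma> u u' by (metis bij_betw_apply)
    moreover from this have "u = u'" using \<sigma> u u' by (metis bij_betw_def inj_onD)
    ultimately show "x = y" using u u' by simp
  qed
  moreover have "g ` C = C"
  proof (intro equalityI subsetI)
    fix y assume "y \<in> C"
    then obtain v z where v: "v \<in> V" "z \<in> D" "y = v @- z" using antichain_cover[OF V] by metis
    then obtain u where u: "u \<in> U" "v = \<sigma> u" using \<sigma> by (auto simp: bij_betw_def)
    then have "y = g (u @- z)" using g v by auto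
    then show "y \<in> g ` C" using shift_CI antichain_W[OF U u(1)] v by blast
  qed (use local_prefix_map_closed[OF lpm] in blast)
  ultimately have "g \<in> H"
    unfolding homeos_iff bij_betw_def using local_prefix_map_continuous[OF lpm] by (simp add: g_def)
  then show thesis using that g by blast
qed

lemma preserves_circle_eqI:
  assumes g: "\<And>x. x \<in> C \<Longrightarrow> g x \<in> C" and nxt: "\<And>x y. nxt x y \<Longrightarrow> circle_eq n r (g x) (g y)"
  shows "preserves_circle_eq n r g"
  unfolding preserves_circle_eq_def
proof (intro allI impI)
  fix x y assume "circle_eq n r x y"
  then have C: "x \<in> C" "y \<in> C" and "x = y \<or> nxt x y \<or> nxt y x" by (auto simp: circle_eq_iff)
  then show "circle_eq n r (g x) (g y)" using nxt[of x y] nxt[of y x] g by (auto simp: circle_eq_iff)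
qed

lemma single_antichain:
  assumes U: "complete_antichain n r U" and r: "r = 1" and u: "[Dotted 0] \<in> U"
  shows "U = {[Dotted 0]}"
proof -
  have "v = [Dotted 0]" if "v \<in> U" for v
  proof -
    have "v \<in> W" using antichain_W[OF U that] .
    then obtain c w where v: "v = c # w" by (metis Nil_W neq_Nil_conv)
    then have "c \<in> dotted_alphabet r" using \<open>v \<in> W\<close> by (simp add: Cons_W)
    then have "c = Dotted 0" using r by auto
    then have p: "prefix [Dotted 0] v" using v by simp
    have "\<forall>u\<in>U. \<forall>v\<in>U. u \<noteq> v \<longrightarrow> \<not> prefix u v \<and> \<not> prefix v u"
      using U by (simp add: complete_antichain_def)
    then show ?thesis using p u that by blast
  qed
  then show ?thesis using u by blast
qed

text \<open>The single word is a prefix of both \<open>top_pt\<close> and \<open>bot_pt\<close>,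
  whose second letters differ. This disposes of the exception in
  \<open>nxt_same_cone\<close>.\<close>

lemma card_one_antichain:
  assumes V: "complete_antichain n r {v}"
  shows "v = [Dotted 0]"
proof -
  have "has_prefix v top_pt" "has_prefix v bot_pt"
    using V top_pt_C bot_pt_C by (auto simp: complete_antichain_def cone_def)
  moreover obtain c v' where cv: "v = c # v'" using V by (cases v) (auto simp: complete_antichain_def)
  ultimately obtain x y where xy: "top_pt = c ## v' @- x" "bot_pt = c ## v' @- y"
    by (auto simp: has_prefix_iff)
  have "v' = []"
  proof (cases v')
    case (Cons d w)
    then have "M = d ## w @- x" "Z = d ## w @- y" using xy by (auto simp: top_pt_def bot_pt_def)
    then have "shd M = d" "shd Z = d" by (metis stream.sel(1))+
    then show ?thesis using n2 by auto
  qed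
  then show ?thesis using xy cv by (auto simp: bot_pt_def)
qed

text \<open>Adjacent points in one cone stay adjacent by \<open>nxt_same_cone\<close>; adjacent
  points in different cones are a right end and a left end, so the hypothesis on cones applies. In
  the exceptional case both antichains consist of the one cone that is the whole space, and
  \<open>g\<close> fixes every point.\<close>

lemma antichain_map_preserves:
  assumes U: "complete_antichain n r U" and V: "complete_antichain n r V" and \<sigma>: "bij_betw \<sigma> U V"
    and g: "\<And>u z. u \<in> U \<Longrightarrow> z \<in> D \<Longrightarrow> g (u @- z) = \<sigma> u @- z"
    and nx: "\<And>u u'. u \<in> U \<Longrightarrow> u' \<in> U \<Longrightarrow> nxt (u @- M) (u' @- Z) \<Longrightarrow> nxt (\<sigma> u @- M) (\<sigma> u' @- Z)"
  shows "preserves_circle_eq n r g"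
proof (rule preserves_circle_eqI)
  have lpm: "local_prefix_map g"
    using antichain_map_local[OF U V _ g] \<sigma> by (auto simp: bij_betw_def)
  then show C: "g x \<in> C" if "x \<in> C" for x using local_prefix_map_closed that by blast
  fix x y assume xy: "nxt x y"
  then have xyC: "x \<in> C" "y \<in> C" using nxt_C by auto
  obtain u z where u: "u \<in> U" "u \<in> W" "z \<in> D" "x = u @- z" using antichain_cover[OF U xyC(1)] by metis
  obtain u' z' where u': "u' \<in> U" "u' \<in> W" "z' \<in> D" "y = u' @- z'" using antichain_cover[OF U xyC(2)] by metis
  show "circle_eq n r (g x) (g y)"
  proof (cases "u = u'")
    case True
    have "\<sigma> u \<in> W" using \<sigma> u antichain_W[OF V] by (metis bij_betw_apply)
    then consider "nxt (\<sigma> u @- z) (\<sigma> u @- z')" | "r = 1" "u = [Dotted 0]"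
      using nxt_same_cone[of u z z' "\<sigma> u"] xy u u' True by auto
    then show ?thesis
    proof cases
      case 1
      then have "nxt (g x) (g y)" using g u u' True by simp
      then show ?thesis using nxt_C by (auto simp: circle_eq_iff)
    next
      case 2
      then have U1: "U = {[Dotted 0]}" using single_antichain[OF U] u by auto
      then have "V = {\<sigma> [Dotted 0]}" using \<sigma> by (auto simp: bij_betw_def)
      then have "\<sigma> [Dotted 0] = [Dotted 0]" using card_one_antichain[of "\<sigma> [Dotted 0]"] V by simp
      then have "\<sigma> u = u" using U1 u(1) by simp
      then show ?thesis using xy xyC g u u' True by (auto simp: circle_eq_iff)
    qed
  next
    case False
    then have "\<not> has_prefix u y" "\<not> has_prefix u' x"
      using antichain_disjoint[OF U] u u' unfolding has_prefix_iff by metis+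
    then have eq: "x = u @- M" "y = u' @- Z"
      using nxt_leave_cone[OF xy u(2)] nxt_enter_cone[OF xy u'(2)] u u' by auto
    then have "nxt (g x) (g y)" using nx[OF u(1) u'(1)] xy g u u' M_D Z_D by simp
    then show ?thesis using C xyC by (auto simp: circle_eq_iff)
  qed
qed

text \<open>Backwards, compactness gives a level at which \<open>g\<close> replaces prefixes. Tails
  are kept, so adjacency of consecutive cones is transported together with its direction, and the
  induced map on indices commutes with the cyclic successor. Such a map is a rotation by its value
  at 0.\<close>

theorem T_elements_iff:
  "g \<in> T \<longleftrightarrow> g \<in> H \<and> local_prefix_map g \<and> preserves_circle_eq n r g"
proof (intro iffI conjI)
  assume "g \<in> T"
  then obtain us vs j where g: "g \<in> H" and us: "lists_antichain n r us"
    and vs: "lists_antichain n r vs" and len: "length us = length vs"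
    and eq: "\<And>i x. i < length us \<Longrightarrow> x \<in> D \<Longrightarrow> g (us ! i @- x) = vs ! ((i + j) mod length us) @- x"
    by (auto simp: T_elements_def)
  let ?l = "length us"
  have U: "complete_antichain n r (set us)" and V: "complete_antichain n r (set vs)"
    using us vs by (auto simp: lists_antichain_def)
  have bu: "bij_betw ((!) us) {..<?l} (set us)" and bv: "bij_betw ((!) vs) {..<?l} (set vs)"
    using bij_betw_nth lists_antichain_distinct us vs len by metis+
  define idx where "idx = inv_into {..<?l} ((!) us)"
  define \<sigma> where "\<sigma> = (\<lambda>u. vs ! ((idx u + j) mod ?l))"
  have idx: "idx (us ! i) = i" if "i < ?l" for i
    using bij_betw_inv_into_left[OF bu] that by (simp add: idx_def)
  have \<sigma>: "bij_betw \<sigma> (set us) (set vs)"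
  proof -
    have "bij_betw ((!) vs \<circ> (\<lambda>i. (i + j) mod ?l) \<circ> idx) (set us) (set vs)"
      using bij_betw_trans[OF bij_betw_inv_into[OF bu] bij_betw_trans[OF bij_betw_shift_mod bv]]
      by (simp add: idx_def comp_assoc)
    then show ?thesis by (simp add: \<sigma>_def comp_def)
  qed
  have g\<sigma>: "g (u @- z) = \<sigma> u @- z" if "u \<in> set us" "z \<in> D" for u z
    using that eq idx by (auto simp: \<sigma>_def in_set_conv_nth)
  show "g \<in> H" by fact
  show "local_prefix_map g" using antichain_map_local[OF U V _ g\<sigma>] \<sigma> by (auto simp: bij_betw_def)
  show "preserves_circle_eq n r g"
  proof (rule antichain_map_preserves[OF U V \<sigma> g\<sigma>])
    fix u u' assume u: "u \<in> set us" "u' \<in> set us" "nxt (u @- M) (u' @- Z)"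
    then obtain i where i: "i < ?l" "u = us ! i" by (auto simp: in_set_conv_nth)
    then have l0: "0 < ?l" by linarith
    have "us ! (Suc i mod ?l) @- Z = u' @- Z"
      using lists_antichain_nxt[OF us i(1)] u(3) nxt_right_unique i by metis
    then have u': "u' = us ! (Suc i mod ?l)"
      using antichain_disjoint[OF U] u(2) l0 by (metis mod_less_divisor nth_mem)
    have "\<sigma> u = vs ! ((i + j) mod ?l)" "\<sigma> u' = vs ! (Suc ((i + j) mod ?l) mod ?l)"
      using i u' l0 by (auto simp: \<sigma>_def idx mod_Suc_eq mod_add_left_eq)
    then show "nxt (\<sigma> u @- M) (\<sigma> u' @- Z)"
      using lists_antichain_nxt[OF vs, of "(i + j) mod ?l"] len l0 by simp
  qed
next
  assume "g \<in> H \<and> local_prefix_map g \<and> preserves_circle_eq n r g"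
  then have g: "g \<in> H" and lpm: "local_prefix_map g" and pres: "preserves_circle_eq n r g" by auto
  define P where "P w \<longleftrightarrow> w \<noteq> [] \<and> (\<exists>v\<in>W. \<forall>z\<in>D. g (w @- z) = v @- z)" for w
  have "\<exists>m. \<forall>x\<in>C. P (stake m x)"
  proof (rule uniform_depth)
    fix x k m assume x: "x \<in> C" and P: "P (stake k x)" and km: "k \<le> m"
    then obtain v where v: "v \<in> W" "\<And>z. z \<in> D \<Longrightarrow> g (stake k x @- z) = v @- z" and k: "0 < k"
      by (auto simp: P_def)
    let ?w = "stake (m - k) (sdrop k x)"
    have w: "?w \<in> words n" using x k by (simp add: sdrop_D stake_words)
    have eq: "stake m x = stake k x @ ?w" using km by simp
    have "g (stake m x @- z) = (v @ ?w) @- z" if "z \<in> D" for z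
    proof -
      have "?w @- z \<in> D" using w that shift_D by blast
      then show ?thesis unfolding eq shift_append by (rule v(2))
    qed
    then have "\<exists>v\<in>W. \<forall>z\<in>D. g (stake m x @- z) = v @- z"
      using append_WI[OF v(1) w] by blast
    then show "P (stake m x)" using k km by (simp add: P_def)
  next
    fix x assume "x \<in> C"
    then obtain u v where "u \<in> W" "v \<in> W" "has_prefix u x" "\<forall>z\<in>D. g (u @- z) = v @- z"
      using lpm unfolding local_prefix_map_def by blast
    then have "P (stake (length u) x)" unfolding P_def has_prefix_def by (metis Nil_W)
    then show "\<exists>m. P (stake m x)" by blast
  qed
  then obtain m where m: "\<And>x. x \<in> C \<Longrightarrow> P (stake m x)" by blast
  have "0 < m" using m C_nonempty by (auto simp: P_def)
  define U where "U = level m"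
  have U: "complete_antichain n r U" using level_antichain \<open>0 < m\<close> by (simp add: U_def)
  have "\<exists>v\<in>W. \<forall>z\<in>D. g (u @- z) = v @- z" if "u \<in> U" for u
  proof -
    have "u @- Z \<in> C" "stake m (u @- Z) = u"
      using that shift_CI Z_D by (auto simp: U_def level_def stake_shift)
    then show ?thesis using m unfolding P_def by metis
  qed
  then obtain \<tau> where \<tau>: "\<And>u. u \<in> U \<Longrightarrow> \<tau> u \<in> W" "\<And>u z. u \<in> U \<Longrightarrow> z \<in> D \<Longrightarrow> g (u @- z) = \<tau> u @- z"
    by metis
  have V: "complete_antichain n r (\<tau> ` U)" and inj: "inj_on \<tau> U" using image_antichain[OF U g \<tau>] by auto
  obtain us where us: "lists_antichain n r us" "set us = U" using antichain_list[OF U] by blast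
  obtain vs where vs: "lists_antichain n r vs" "set vs = \<tau> ` U" using antichain_list[OF V] by blast
  have len: "length us = length vs"
    using us vs inj lists_antichain_distinct by (metis card_image distinct_card)
  let ?l = "length us"
  have usU: "us ! i \<in> U" if "i < ?l" for i using us that by auto
  have "\<exists>k<?l. vs ! k = \<tau> (us ! i)" if "i < ?l" for i
    using usU[OF that] vs(2) len by (metis imageI in_set_conv_nth)
  then obtain s where s: "\<And>i. i < ?l \<Longrightarrow> s i < ?l" "\<And>i. i < ?l \<Longrightarrow> vs ! s i = \<tau> (us ! i)" by metis
  have s_Suc: "s (Suc i mod ?l) = Suc (s i) mod ?l" if i: "i < ?l" for i
  proof -
    let ?i = "Suc i mod ?l"
    have l0: "0 < ?l" using i by linarith
    then have i': "?i < ?l" by simp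
    have "nxt (us ! i @- M) (us ! ?i @- Z)" using lists_antichain_nxt us i by blast
    then have "circle_eq n r (us ! i @- M) (us ! ?i @- Z)" using nxt_C by (auto simp: circle_eq_iff)
    then have "circle_eq n r (g (us ! i @- M)) (g (us ! ?i @- Z))"
      using pres unfolding preserves_circle_eq_def by blast
    then have "circle_eq n r (vs ! s i @- M) (vs ! s ?i @- Z)"
      using \<tau>(2) usU i i' s M_D Z_D by simp
    \<comment> \<open>The tails exclude equality and the reversed direction.\<close>
    then have "nxt (vs ! s i @- M) (vs ! s ?i @- Z)"
      using shift_M_Z nxt_not_Z_M unfolding circle_eq_iff by metis
    moreover have "nxt (vs ! s i @- M) (vs ! (Suc (s i) mod ?l) @- Z)"
      using lists_antichain_nxt[OF vs(1)] s(1)[OF i] len by simp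
    ultimately have "vs ! s ?i @- Z = vs ! (Suc (s i) mod ?l) @- Z" using nxt_right_unique by blast
    moreover have "s ?i < ?l" "Suc (s i) mod ?l < ?l" using s(1) i' l0 by auto
    ultimately have "vs ! s ?i = vs ! (Suc (s i) mod ?l)"
      using antichain_disjoint[OF V] vs(2) len by (metis nth_mem)
    then show ?thesis
      using lists_antichain_distinct[OF vs(1)] \<open>s ?i < ?l\<close> \<open>Suc (s i) mod ?l < ?l\<close> len
      by (simp add: nth_eq_iff_index_eq)
  qed
  have s_eq: "s i = (i + s 0) mod ?l" if "i < ?l" for i
    using that
  proof (induction i)
    case (Suc i)
    then have "s (Suc i) = Suc (s i) mod ?l" using s_Suc[of i] by simp
    then show ?case using Suc by (simp add: mod_Suc_eq)
  qed (use s(1) in auto)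
  show "g \<in> T"
    unfolding T_elements_def
  proof (intro CollectI conjI exI allI impI ballI)
    fix i x assume "i < ?l" "x \<in> D"
    then show "g (us ! i @- x) = vs ! ((i + s 0) mod ?l) @- x"
      using \<tau>(2)[OF usU] s(2) s_eq by metis
  qed (fact g us vs len)+
qed

section \<open>Closure properties and particular elements of \<open>T\<close>\<close>

lemma circle_eq_leave_cone:
  assumes "circle_eq n r p q" "u \<in> W" "has_prefix u p" "\<not> has_prefix u q"
  shows "nxt p q \<and> p = u @- M \<or> nxt q p \<and> p = u @- Z"
proof -
  have "p \<noteq> q" using assms by auto
  then have "nxt p q \<or> nxt q p" using assms by (auto simp: circle_eq_iff)
  then show ?thesis using nxt_leave_cone[OF _ assms(2)] nxt_enter_cone[OF _ assms(2)] assms(3,4) by blast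
qed

text \<open>The preimage \<open>K\<close> of a cone \<open>u\<close> around \<open>h x\<close> is a union of arcs of the circle, hence
  has an end where one leaves \<open>K\<close> and one where one enters it.  These two are mapped to the only
  two ends of \<open>u\<close>, so \<open>h x\<close> and \<open>h y\<close> come from one of them.\<close>

lemma preserves_circle_eq_reflects:
  assumes h: "h \<in> H" and pres: "preserves_circle_eq n r h"
    and xy: "x \<in> C" "y \<in> C" and eq: "circle_eq n r (h x) (h y)"
  shows "circle_eq n r x y"
proof (cases "h x = h y")
  case True
  then show ?thesis using homeos_inj[OF h] xy by (auto simp: circle_eq_iff)
next
  case False
  then obtain m where m: "stake m (h x) \<noteq> stake m (h y)" using stream_eqI by blast
  then have "0 < m" by (cases m) auto
  define u where "u = stake m (h x)"
  have u: "u \<in> W" "has_prefix u (h x)" "\<not> has_prefix u (h y)"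
    using m \<open>0 < m\<close> homeos_closed[OF h xy(1)] by (auto simp: u_def stake_W has_prefix_def)
  \<comment> \<open>\<open>P w\<close> says that the cone of \<open>w\<close> lies entirely inside
    or entirely outside the preimage of the cone of \<open>u\<close>; at a uniform depth this
    preimage becomes a set of indices.\<close>
  define P where "P w \<longleftrightarrow> w \<noteq> [] \<and>
    ((\<forall>z\<in>D. has_prefix u (h (w @- z))) \<or> (\<forall>z\<in>D. \<not> has_prefix u (h (w @- z))))" for w
  have "\<exists>k. \<forall>x\<in>C. P (stake k x)"
  proof (rule uniform_depth)
    fix x k l assume x: "x \<in> C" and P: "P (stake k x)" and kl: "k \<le> l"
    let ?w = "stake (l - k) (sdrop k x)"
    have k: "0 < k" using P by (auto simp: P_def)
    have w: "?w \<in> words n" using x k by (simp add: sdrop_D stake_words)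
    have eq: "stake l x = stake k x @ ?w" using kl by simp
    have "?w @- z \<in> D" if "z \<in> D" for z using w that shift_D by blast
    then show "P (stake l x)" using P unfolding P_def eq shift_append by blast
  next
    fix x assume x: "x \<in> C"
    obtain k where k: "\<forall>y\<in>C. stake k y = stake k x \<longrightarrow> stake (length u) (h y) = stake (length u) (h x)"
      using homeos_continuous[OF h x] by blast
    have "stake (length u) (h (stake (Suc k) x @- z)) = stake (length u) (h x)" if "z \<in> D" for z
    proof -
      have "stake (Suc k) x @- z \<in> C" using stake_W[OF x, of "Suc k"] that by (intro shift_CI) auto
      moreover have "stake k (stake (Suc k) x @- z) = stake k x"
        by (subst stake_shift) (simp only: take_stake length_stake, simp)
      ultimately show ?thesis using k by blast
    qed
    then have "P (stake (Suc k) x)"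
      unfolding P_def has_prefix_def by (metis stake_invert_Nil nat.simps(3))
    then show "\<exists>k. P (stake k x)" by blast
  qed
  then obtain k where k: "\<And>x. x \<in> C \<Longrightarrow> P (stake k x)" by blast
  have "0 < k" using k[OF xy(1)] by (auto simp: P_def)
  then obtain us where us: "lists_antichain n r us" "set us = level k"
    using antichain_list[OF level_antichain] by blast
  let ?l = "length us"
  have usW: "us ! i \<in> W" "length (us ! i) = k" if "i < ?l" for i
    using that us nth_mem[OF that] by (auto simp: level_def)
  define K where "K i \<longleftrightarrow> has_prefix u (h (us ! i @- Z))" for i
  have K: "has_prefix u (h (us ! i @- z)) \<longleftrightarrow> K i" if "i < ?l" "z \<in> D" for i z
  proof -
    have "us ! i @- Z \<in> C" "stake k (us ! i @- Z) = us ! i"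
      using usW[OF that(1)] Z_D by (auto simp: shift_CI stake_shift)
    then have "P (us ! i)" using k by metis
    then show ?thesis using that Z_D unfolding P_def K_def by blast
  qed
  obtain i z where i: "i < ?l" "z \<in> D" "x = us ! i @- z" using lists_antichain_cover[OF us(1) xy(1)] by metis
  obtain j z' where j: "j < ?l" "z' \<in> D" "y = us ! j @- z'" using lists_antichain_cover[OF us(1) xy(2)] by metis
  have Ki: "K i" using K[OF i(1,2)] i(3) u(2) by simp
  have Kj: "\<not> K j" using K[OF j(1,2)] j(3) u(3) by simp
  have l0: "0 < ?l" using i(1) by linarith
  obtain i1 where i1: "i1 < ?l" "K i1" "\<not> K (Suc i1 mod ?l)"
    using cyclic_exit[of i ?l K j] i j Ki Kj by blast
  obtain i2 where i2: "i2 < ?l" "\<not> K i2" "K (Suc i2 mod ?l)"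
    using cyclic_exit[of j ?l "\<lambda>i. \<not> K i" i] i j Ki Kj by blast
  define a b c d where "a = us ! i1 @- M" and "b = us ! (Suc i1 mod ?l) @- Z"
    and "c = us ! i2 @- M" and "d = us ! (Suc i2 mod ?l) @- Z"
  have ab: "nxt a b" and cd: "nxt c d"
    unfolding a_def b_def c_def d_def using lists_antichain_nxt[OF us(1)] i1 i2 by blast+
  have C: "a \<in> C" "b \<in> C" "c \<in> C" "d \<in> C" using ab cd nxt_C by auto
  have ha: "has_prefix u (h a)" "\<not> has_prefix u (h b)" "\<not> has_prefix u (h c)" "has_prefix u (h d)"
    unfolding a_def b_def c_def d_def using K i1 i2 M_D Z_D l0 by simp_all
  have "circle_eq n r a b" "circle_eq n r d c" using ab cd C by (auto simp: circle_eq_iff)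
  then have "circle_eq n r (h a) (h b)" "circle_eq n r (h d) (h c)"
    using pres unfolding preserves_circle_eq_def by blast+
  then have A: "nxt (h a) (h b) \<and> h a = u @- M \<or> nxt (h b) (h a) \<and> h a = u @- Z"
    and B: "nxt (h d) (h c) \<and> h d = u @- M \<or> nxt (h c) (h d) \<and> h d = u @- Z"
    using circle_eq_leave_cone u(1) ha by blast+
  have X: "nxt (h x) (h y) \<and> h x = u @- M \<or> nxt (h y) (h x) \<and> h x = u @- Z"
    using circle_eq_leave_cone eq u by blast
  \<comment> \<open>\<open>a\<close> ends in \<open>M\<close> and \<open>d\<close> in
    \<open>Z\<close>, so the two crossings land on different ends of the cone of \<open>u\<close>
    and between them account for both.\<close>
  have "h a \<noteq> h d"
    using homeos_inj[OF h C(1) C(4)] shift_M_Z unfolding a_def d_def by metis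
  then have "h x = h a \<and> h y = h b \<or> h x = h d \<and> h y = h c"
    using A B X nxt_right_unique nxt_left_unique by metis
  then have "x = a \<and> y = b \<or> x = d \<and> y = c" using homeos_inj[OF h] xy C by blast
  then show ?thesis using ab cd C by (auto simp: circle_eq_iff)
qed

lemma preserves_circle_eq_inv:
  assumes h: "h \<in> H" and "preserves_circle_eq n r h"
  shows "preserves_circle_eq n r (homeo_inv n r h)"
  unfolding preserves_circle_eq_def
proof (intro allI impI)
  fix x y assume xy: "circle_eq n r x y"
  then have C: "x \<in> C" "y \<in> C" by (auto simp: circle_eq_iff)
  then have "circle_eq n r (h (homeo_inv n r h x)) (h (homeo_inv n r h y))"
    using xy homeo_inv_right[OF h] by simp
  then show "circle_eq n r (homeo_inv n r h x) (homeo_inv n r h y)"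
    using preserves_circle_eq_reflects[OF assms] homeos_closed[OF homeo_inv_homeos[OF h]] C by blast
qed

lemma preserves_circle_eq_compose:
  assumes "preserves_circle_eq n r f" "preserves_circle_eq n r g"
  shows "preserves_circle_eq n r (compose C f g)"
  unfolding preserves_circle_eq_def
proof (intro allI impI)
  fix x y assume xy: "circle_eq n r x y"
  then have C: "x \<in> C" "y \<in> C" by (auto simp: circle_eq_iff)
  have "circle_eq n r (f (g x)) (f (g y))" using assms xy unfolding preserves_circle_eq_def by blast
  then show "circle_eq n r (compose C f g x) (compose C f g y)" using C by (simp add: compose_def)
qed

lemma T_homeos: "g \<in> T \<Longrightarrow> g \<in> H"
  by (simp add: T_elements_iff)

lemma T_compose: "f \<in> T \<Longrightarrow> g \<in> T \<Longrightarrow> compose C f g \<in> T"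
  by (simp add: T_elements_iff compose_homeos local_prefix_map_compose preserves_circle_eq_compose)

lemma T_inv: "g \<in> T \<Longrightarrow> homeo_inv n r g \<in> T"
  by (simp add: T_elements_iff homeo_inv_homeos local_prefix_map_inv preserves_circle_eq_inv)

lemma id_T: "(\<lambda>x\<in>C. x) \<in> T"
proof -
  have "local_prefix_map (\<lambda>x\<in>C. x)"
    unfolding local_prefix_map_def
  proof
    fix x assume x: "x \<in> C"
    then have "stake 1 x \<in> W" by (rule stake_W) simp
    then show "\<exists>u\<in>W. \<exists>v\<in>W. has_prefix u x \<and> (\<forall>z\<in>D. (\<lambda>x\<in>C. x) (u @- z) = v @- z)"
      using shift_CI by (intro bexI[of _ "stake 1 x"] conjI) (auto simp del: stake.simps)
  qed
  moreover have "preserves_circle_eq n r (\<lambda>x\<in>C. x)"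
    unfolding preserves_circle_eq_def by (auto simp: circle_eq_iff)
  ultimately show ?thesis using id_homeos by (simp add: T_elements_iff)
qed

section \<open>Explicit elements of \<open>T\<close>\<close>

lemma antichain_T_element:
  assumes U: "complete_antichain n r U" and V: "complete_antichain n r V" and \<sigma>: "bij_betw \<sigma> U V"
    and nx: "\<And>u u'. u \<in> U \<Longrightarrow> u' \<in> U \<Longrightarrow> nxt (u @- M) (u' @- Z) \<Longrightarrow> nxt (\<sigma> u @- M) (\<sigma> u' @- Z)"
  obtains g where "g \<in> T" "\<And>u z. u \<in> U \<Longrightarrow> z \<in> D \<Longrightarrow> g (u @- z) = \<sigma> u @- z"
proof -
  obtain g where g: "g \<in> H" "\<And>u z. u \<in> U \<Longrightarrow> z \<in> D \<Longrightarrow> g (u @- z) = \<sigma> u @- z"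
    using antichain_map[OF U V \<sigma>] by blast
  have "g \<in> T"
    using g antichain_map_local[OF U V _ g(2)] antichain_map_preserves[OF U V \<sigma> g(2) nx] \<sigma>
    by (auto simp: T_elements_iff bij_betw_def)
  then show thesis using that g(2) by blast
qed

text \<open>The cyclic successor is a permutation of \<open>U\<close> since neighbours are unique on
  either side, and it respects adjacency because it maps the pair \<open>u\<close>,
  \<open>\<sigma> u\<close> to the pair \<open>\<sigma> u\<close> and its successor.\<close>

lemma rotation:
  assumes U: "complete_antichain n r U"
  obtains g where "g \<in> T"
    "\<And>u u' z. u \<in> U \<Longrightarrow> u' \<in> U \<Longrightarrow> nxt (u @- M) (u' @- Z) \<Longrightarrow> z \<in> D \<Longrightarrow> g (u @- z) = u' @- z"
proof -
  obtain us where us: "lists_antichain n r us" "set us = U" using antichain_list[OF U] by blast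
  let ?l = "length us"
  have ex: "\<exists>u'\<in>U. nxt (u @- M) (u' @- Z)" if u: "u \<in> U" for u
  proof -
    obtain i where i: "i < ?l" "u = us ! i" using u us by (metis in_set_conv_nth)
    moreover have "us ! (Suc i mod ?l) \<in> U" using us i by (metis mod_less_divisor nth_mem not_less_zero gr0I)
    ultimately show ?thesis using lists_antichain_nxt[OF us(1)] by blast
  qed
  then obtain \<sigma> where \<sigma>: "\<And>u. u \<in> U \<Longrightarrow> \<sigma> u \<in> U" "\<And>u. u \<in> U \<Longrightarrow> nxt (u @- M) (\<sigma> u @- Z)" by metis
  have eq: "\<sigma> u = u'" if "u \<in> U" "u' \<in> U" "nxt (u @- M) (u' @- Z)" for u u'
    using nxt_right_unique[OF \<sigma>(2)[OF that(1)] that(3)] antichain_disjoint[OF U] \<sigma>(1) that by blast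
  have "inj_on \<sigma> U"
  proof (rule inj_onI)
    fix u v assume uv: "u \<in> U" "v \<in> U" "\<sigma> u = \<sigma> v"
    then have "u @- M = v @- M" using nxt_left_unique \<sigma>(2) by metis
    then show "u = v" using antichain_disjoint[OF U] uv by blast
  qed
  moreover have "finite U" using U by (simp add: complete_antichain_def)
  ultimately have "bij_betw \<sigma> U U" using \<sigma>(1) by (simp add: bij_betw_def endo_inj_surj image_subsetI)
  moreover have "nxt (\<sigma> u @- M) (\<sigma> u' @- Z)" if "u \<in> U" "u' \<in> U" "nxt (u @- M) (u' @- Z)" for u u'
    using eq[OF that] \<sigma>(2)[OF that(2)] by simp
  ultimately obtain g where "g \<in> T" "\<And>u z. u \<in> U \<Longrightarrow> z \<in> D \<Longrightarrow> g (u @- z) = \<sigma> u @- z"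
    using antichain_T_element[OF U U] by metis
  then show thesis using that eq by blast
qed

definition children :: "letter list \<Rightarrow> letter list set" where
  "children v = (\<lambda>c. v @ [Plain c]) ` {..<n}"

lemma expand_antichain:
  assumes U: "complete_antichain n r U" and v: "v \<in> U"
  shows "complete_antichain n r (U - {v} \<union> children v)"
proof -
  have vW: "v \<in> W" using antichain_W U v by blast
  have inc: "\<And>u w. u \<in> U \<Longrightarrow> w \<in> U \<Longrightarrow> u \<noteq> w \<Longrightarrow> \<not> prefix u w"
    using U by (auto simp: complete_antichain_def)
  have "finite (U - {v} \<union> children v)" using U by (simp add: complete_antichain_def children_def)
  moreover have "U - {v} \<union> children v \<subseteq> W"
    using antichain_W[OF U] vW by (auto simp: children_def Cons_words intro!: append_WI)
  moreover have "\<not> prefix u w" if uw: "u \<in> U - {v} \<union> children v" "w \<in> U - {v} \<union> children v" "u \<noteq> w" for u w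
  proof
    assume p: "prefix u w"
    consider "u \<in> U" "u \<noteq> v" "w \<in> U" | "u \<in> U" "u \<noteq> v" "w \<in> children v"
      | "u \<in> children v" "w \<in> U" "w \<noteq> v" | "u \<in> children v" "w \<in> children v"
      using uw(1,2) by auto
    then show False
    proof cases
      case 1
      then show False using inc p uw by blast
    next
      case 2
      then obtain c where "w = v @ [Plain c]" by (auto simp: children_def)
      then have "prefix u v \<or> prefix v u" using p prefix_same_cases[of u w v] by auto
      then show False using inc 2 v by blast
    next
      case 3
      then have "prefix v w" using p by (auto simp: children_def prefix_def)
      then show False using inc 3 v by blast
    next
      case 4
      then show False using p uw(3) by (auto simp: children_def prefix_def)
    qed
  qed
  moreover have "C \<subseteq> (\<Union>u\<in>U - {v} \<union> children v. cone n r u)"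
  proof
    fix x assume x: "x \<in> C"
    obtain u z where u: "u \<in> U" "u \<in> W" "z \<in> D" "x = u @- z" using antichain_cover[OF U x] by metis
    show "x \<in> (\<Union>u\<in>U - {v} \<union> children v. cone n r u)"
    proof (cases "u = v")
      case True
      obtain c where c: "c < n" "shd z = Plain c" using snth_D[OF u(3), of 0] by auto
      then have "x = (v @ [Plain c]) @- stl z" using u True by (simp flip: c(2))
      then have "has_prefix (v @ [Plain c]) x" using has_prefix_shift by metis
      then show ?thesis using c x by (auto simp: cone_def children_def)
    next
      case False
      have "x \<in> cone n r u" using u x by (simp add: cone_def)
      then show ?thesis using u(1) False by blast
    qed
  qed
  ultimately show ?thesis unfolding complete_antichain_def by blast
qed

text \<open>The analogue of a generator of Thompson's group. Splitting \<open>q\<close> gives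
  \<open>p, q0, ..., q(n-1)\<close>, splitting \<open>p\<close> gives
  \<open>p0, ..., p(n-1), q\<close>: both list the union of the two cones in cyclic order with
  \<open>n + 1\<close> words, so matching them in order respects adjacency and leaves the rest of
  \<open>U\<close> alone.\<close>

lemma adjacent_element:
  assumes U: "complete_antichain n r U" and p: "p \<in> U" and q: "q \<in> U" and pq: "p \<noteq> q"
    and nx: "nxt (p @- M) (q @- Z)"
  obtains g where "g \<in> T" "\<And>z. z \<in> D \<Longrightarrow> g (p @- z) = p @- Plain 0 ## z"
    "\<And>c z. Suc c < n \<Longrightarrow> z \<in> D \<Longrightarrow> g (q @- Plain c ## z) = p @- Plain (Suc c) ## z"
    "\<And>z. z \<in> D \<Longrightarrow> g (q @- Plain (n - 1) ## z) = q @- z"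
    "\<And>x. x \<in> C \<Longrightarrow> \<not> has_prefix p x \<Longrightarrow> \<not> has_prefix q x \<Longrightarrow> g x = x"
proof -
  have inc: "\<And>u w. u \<in> U \<Longrightarrow> w \<in> U \<Longrightarrow> u \<noteq> w \<Longrightarrow> \<not> prefix u w"
    using U by (auto simp: complete_antichain_def)
  let ?N = "n - 1"
  have n_eq: "{..<n} = insert ?N {..<?N}" using n2 by auto
  define R where "R = U - {p, q}"
  define U1 where "U1 = U - {q} \<union> children q"
  define V1 where "V1 = U - {p} \<union> children p"
  have U1: "complete_antichain n r U1" and V1: "complete_antichain n r V1"
    unfolding U1_def V1_def using expand_antichain U p q by auto
  have U1_eq: "U1 = insert p (R \<union> children q)" and V1_eq: "V1 = insert q (R \<union> children p)"
    using p q pq by (auto simp: U1_def V1_def R_def)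
  have nch: "v @ [Plain c] \<notin> U" if "v \<in> U" for v c
    using inc[OF that, of "v @ [Plain c]"] by auto
  \<comment> \<open>The matching of the two lists; the index of a child of \<open>q\<close> is read
    off its last letter.\<close>
  define \<sigma> where "\<sigma> u = (if u = p then p @ [Plain 0] else if u = q @ [Plain ?N] then q
    else if u \<in> children q then p @ [case last u of Plain c \<Rightarrow> Plain (Suc c)] else u)" for u
  have \<sigma>p: "\<sigma> p = p @ [Plain 0]" by (simp add: \<sigma>_def)
  have \<sigma>N: "\<sigma> (q @ [Plain ?N]) = q" using nch[OF q] p by (auto simp: \<sigma>_def)
  have \<sigma>c: "\<sigma> (q @ [Plain c]) = p @ [Plain (Suc c)]" if "c < ?N" for c
  proof -
    have "q @ [Plain c] \<noteq> p" using nch[OF q] p by auto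
    moreover have "q @ [Plain c] \<in> children q" using that by (auto simp: children_def)
    ultimately show ?thesis using that by (simp add: \<sigma>_def)
  qed
  have \<sigma>R: "\<sigma> u = u" if "u \<in> R" for u
  proof -
    have "u \<notin> children q" "u \<noteq> q @ [Plain ?N]" "u \<noteq> p"
      using that nch[OF q] by (auto simp: R_def children_def)
    then show ?thesis by (simp add: \<sigma>_def)
  qed
  have ch_q: "children q = insert (q @ [Plain ?N]) ((\<lambda>c. q @ [Plain c]) ` {..<?N})"
    unfolding children_def n_eq by simp
  have ch_p: "children p = insert (p @ [Plain 0]) ((\<lambda>c. p @ [Plain (Suc c)]) ` {..<?N})"
  proof -
    have "{..<n} = insert 0 (Suc ` {..<?N})" using n2 by (simp flip: lessThan_Suc_eq_insert_0)
    then show ?thesis unfolding children_def by (simp add: image_image)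
  qed
  have im: "\<sigma> ` U1 = V1"
  proof -
    have R: "\<sigma> ` R = R" using \<sigma>R by simp
    have S: "\<sigma> ` (\<lambda>c. q @ [Plain c]) ` {..<?N} = (\<lambda>c. p @ [Plain (Suc c)]) ` {..<?N}"
      unfolding image_image using \<sigma>c by (intro image_cong) auto
    have swap: "insert a (A \<union> insert b B) = insert b (A \<union> insert a B)" for a b :: "letter list" and A B
      by blast
    show ?thesis
      unfolding U1_eq V1_eq ch_q ch_p image_insert image_Un R S \<sigma>p \<sigma>N by (rule swap)
  qed
  have card: "card (insert v (R \<union> children w)) = card R + n + 1"
    if "v \<in> U" "w \<in> U" "v \<notin> R" for v w
  proof -
    have "inj_on (\<lambda>c. w @ [Plain c]) {..<n}" by (auto simp: inj_on_def)
    then have "card (children w) = n" by (simp add: children_def card_image)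
    moreover have "R \<inter> children w = {}" "v \<notin> children w" 
      using nch[OF that(2)] that(1) by (auto simp: R_def children_def)
    moreover have "finite R" "finite (children w)"
      using U by (auto simp: R_def children_def complete_antichain_def)
    ultimately show ?thesis using that(3) by (simp add: card_Un_disjoint)
  qed
  have "card U1 = card V1" "finite U1"
    using card p q U1 unfolding U1_eq V1_eq by (auto simp: R_def complete_antichain_def)
  then have bij: "bij_betw \<sigma> U1 V1" using im by (simp add: bij_betw_def eq_card_imp_inj_on)
  have pW: "p \<in> W" and qW: "q \<in> W" using antichain_W U p q by auto
  have sib: "nxt (v @- Plain c ## M) (v @- Plain (Suc c) ## Z)" if "v \<in> W" "c < ?N" for v c
    using that M_D Z_D by (intro nxt_fork) (auto intro!: shift_CI simp: Cons_D)
  have qN: "(q @ [Plain ?N]) @- M = q @- M" and q0: "(q @ [Plain 0]) @- Z = q @- Z"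
    and pN: "(p @ [Plain ?N]) @- M = p @- M" and p0: "(p @ [Plain 0]) @- Z = p @- Z"
    using M_unfold Z_unfold by simp_all
  \<comment> \<open>Uniqueness of neighbours turns the claim into following the lists. After
    \<open>p\<close> and after a child of \<open>q\<close> other than the last the successor is
    known; after \<open>R\<close> and after the last child it suffices that no child of
    \<open>q\<close> can follow.\<close>
  have adj: "nxt (\<sigma> u @- M) (\<sigma> u' @- Z)" if u: "u \<in> U1" "u' \<in> U1" "nxt (u @- M) (u' @- Z)" for u u'
  proof -
    have succ: "u' = w" if "nxt (u @- M) (w @- Z)" "w \<in> U1" for w
      using nxt_right_unique[OF u(3) that(1)] antichain_disjoint[OF U1 u(2) that(2)] by blast
    have pred: "u = w" if "nxt (w @- M) (u' @- Z)" "w \<in> U1" for w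
      using nxt_left_unique[OF u(3) that(1)] antichain_disjoint[OF U1 u(1) that(2)] by blast
    consider "u = p" | c where "u = q @ [Plain c]" "c < ?N" | "u \<in> R" | "u = q @ [Plain ?N]"
      using u(1) unfolding U1_eq ch_q by blast
    then show ?thesis
    proof cases
      case 1
      have "q @ [Plain 0] \<in> U1" using n2 unfolding U1_eq children_def by auto
      then have "u' = q @ [Plain 0]" using succ[of "q @ [Plain 0]"] 1 nx q0 by simp
      moreover have "0 < ?N" using n2 by simp
      ultimately show ?thesis using 1 \<sigma>p \<sigma>c[of 0] sib[OF pW, of 0] by simp
    next
      case (2 c)
      have "nxt ((q @ [Plain c]) @- M) ((q @ [Plain (Suc c)]) @- Z)" using sib[OF qW 2(2)] by simp
      moreover have "q @ [Plain (Suc c)] \<in> U1" using 2(2) unfolding U1_eq children_def by auto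
      ultimately have u': "u' = q @ [Plain (Suc c)]" using succ 2(1) by blast
      show ?thesis
      proof (cases "Suc c = ?N")
        case True
        then have "\<sigma> u = p @ [Plain ?N]" "\<sigma> u' = q" using 2 u' \<sigma>c \<sigma>N by simp_all
        then show ?thesis using nx pN by metis
      next
        case False
        then have "Suc c < ?N" using 2(2) by linarith
        then have "\<sigma> u = p @ [Plain (Suc c)]" "\<sigma> u' = p @ [Plain (Suc (Suc c))]"
          using 2 u' \<sigma>c by simp_all
        then show ?thesis using sib[OF pW \<open>Suc c < ?N\<close>] by simp
      qed
    next
      case 3
      then have no: "u \<noteq> p" "\<And>c. u \<noteq> q @ [Plain c]" using nch[OF q] by (auto simp: R_def)
      have "u' \<notin> children q"
      proof
        assume "u' \<in> children q"
        then obtain c where c: "u' = q @ [Plain c]" "c < n" by (auto simp: children_def)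
        show False
        proof (cases c)
          case 0
          then have "u = p" using pred[of p] nx q0 c by (auto simp: U1_eq)
          then show False using no by blast
        next
          case (Suc d)
          then have "d < ?N" "q @ [Plain d] \<in> U1" using c by (auto simp: U1_eq children_def)
          then show False using pred[of "q @ [Plain d]"] sib[OF qW, of d] c Suc no by auto
        qed
      qed
      then have "u' = p \<or> u' \<in> R" using u(2) by (auto simp: U1_eq)
      \<comment> \<open>\<open>\<sigma>\<close> sends \<open>p\<close> to
        \<open>p @ [Plain 0]\<close>, but both cones have the same left end, so the successor of the
        right end is unchanged as a point.\<close>
      then have "\<sigma> u' @- Z = u' @- Z" using \<sigma>R \<sigma>p p0 by auto
      then show ?thesis using \<sigma>R[OF 3] u(3) by simp
    next
      case 4
      have "u' \<notin> children q"
      proof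
        assume "u' \<in> children q"
        then obtain c where c: "u' = q @ [Plain c]" "c < n" by (auto simp: children_def)
        show False
        proof (cases c)
          case 0
          then have "u = p" using pred[of p] nx q0 c by (auto simp: U1_eq)
          then show False using 4 nch[OF q] p by auto
        next
          case (Suc d)
          then have "d < ?N" "q @ [Plain d] \<in> U1" using c by (auto simp: U1_eq children_def)
          then show False using pred[of "q @ [Plain d]"] sib[OF qW, of d] c Suc 4 by auto
        qed
      qed
      then have "u' = p \<or> u' \<in> R" using u(2) by (auto simp: U1_eq)
      then have "\<sigma> u' @- Z = u' @- Z" using \<sigma>R \<sigma>p p0 by auto
      then show ?thesis using 4 \<sigma>N qN u(3) by simp
    qed
  qed
  obtain g where g: "g \<in> T" "\<And>u z. u \<in> U1 \<Longrightarrow> z \<in> D \<Longrightarrow> g (u @- z) = \<sigma> u @- z"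
    using antichain_T_element[OF U1 V1 bij adj] by blast
  show thesis
  proof (rule that[OF g(1)])
    fix z assume z: "z \<in> D"
    show "g (p @- z) = p @- Plain 0 ## z" using g(2)[OF _ z, of p] \<sigma>p by (simp add: U1_eq)
    have "q @ [Plain ?N] \<in> U1" using n2 by (auto simp: U1_eq ch_q)
    then show "g (q @- Plain ?N ## z) = q @- z" using g(2)[OF _ z, of "q @ [Plain ?N]"] \<sigma>N by simp
    fix c assume c: "Suc c < n"
    then have "q @ [Plain c] \<in> U1" by (auto simp: U1_eq children_def)
    then show "g (q @- Plain c ## z) = p @- Plain (Suc c) ## z"
      using g(2)[OF _ z, of "q @ [Plain c]"] \<sigma>c[of c] c by simp
  next
    fix x assume x: "x \<in> C" "\<not> has_prefix p x" "\<not> has_prefix q x"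
    obtain u z where u: "u \<in> U" "z \<in> D" "x = u @- z" using antichain_cover[OF U x(1)] by metis
    then have "u \<in> R" using x by (auto simp: R_def)
    then show "g x = x" using g(2)[OF _ u(2), of u] \<sigma>R u(3) by (simp add: U1_eq)
  qed
qed

section \<open>Supports and stabilizers in \<open>T\<close>\<close>

lemma subgroup_T: "subgroup (T) (BijGroup C)"
proof (rule subgroup.intro)
  show "T \<subseteq> carrier (BijGroup C)"
    using T_homeos homeos_Bij by (auto simp: BijGroup_def)
  show "x \<otimes>\<^bsub>BijGroup C\<^esub> y \<in> T" if "x \<in> T" "y \<in> T" for x y
    using that T_compose homeos_Bij[OF T_homeos] by (simp add: BijGroup_def)
  show "\<one>\<^bsub>BijGroup C\<^esub> \<in> T" using id_T by (simp add: BijGroup_def)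
  show "inv\<^bsub>BijGroup C\<^esub> x \<in> T" if "x \<in> T" for x
    using T_inv[OF that] inv_BijGroup[OF homeos_Bij[OF T_homeos[OF that]]] by (simp add: homeo_inv_def)
qed

lemma group_T: "group (T_group n r)"
  unfolding T_group_def by (rule subgroup.subgroup_is_group[OF subgroup_T group_BijGroup])

lemma carrier_T [simp]: "carrier (T_group n r) = T"
  by (simp add: T_group_def)

lemma mult_T: "f \<in> T \<Longrightarrow> g \<in> T \<Longrightarrow> f \<otimes>\<^bsub>T_group n r\<^esub> g = compose C f g"
  using homeos_Bij[OF T_homeos] by (simp add: T_group_def BijGroup_def)

lemma one_T: "\<one>\<^bsub>T_group n r\<^esub> = (\<lambda>x\<in>C. x)"
  by (simp add: T_group_def BijGroup_def)

section \<open>Closed supports of elements of \<open>T\<close>\<close>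

lemma closed_supp_iff:
  "x \<in> clsupp g \<longleftrightarrow>
     x \<in> C \<and> (\<forall>m. \<exists>y\<in>C. stake m y = stake m x \<and> g y \<noteq> y)"
proof
  assume x: "x \<in> clsupp g"
  then have xC: "x \<in> C" by (simp add: closed_supp_def in_closure_of)
  have meets: "\<exists>y. y \<in> asupp g \<and> y \<in> U"
    if "x \<in> U" "openin X U" for U
    using x that unfolding closed_supp_def in_closure_of by meson
  have "\<exists>y\<in>C. stake m y = stake m x \<and> g y \<noteq> y" for m
  proof -
    have "openin X {y \<in> C. stake m y = stake m x}"
      unfolding openin_cantor by (intro conjI ballI exI[of _ m]) auto
    then have "\<exists>y. y \<in> asupp g \<and> y \<in> {y \<in> C. stake m y = stake m x}"
      using xC by (intro meets) auto
    then show ?thesis by (auto simp: act_supp_def)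
  qed
  then show "x \<in> C \<and> (\<forall>m. \<exists>y\<in>C. stake m y = stake m x \<and> g y \<noteq> y)" using xC by blast
next
  assume x: "x \<in> C \<and> (\<forall>m. \<exists>y\<in>C. stake m y = stake m x \<and> g y \<noteq> y)"
  show "x \<in> clsupp g"
    unfolding closed_supp_def in_closure_of
  proof (intro conjI allI impI)
    fix U assume U: "x \<in> U \<and> openin X U"
    then obtain m where "\<forall>y\<in>C. stake m y = stake m x \<longrightarrow> y \<in> U" unfolding openin_cantor by blast
    moreover obtain y where "y \<in> C" "stake m y = stake m x" "g y \<noteq> y" using x by blast
    ultimately show "\<exists>y. y \<in> asupp g \<and> y \<in> U"
      by (intro exI[of _ y]) (simp add: act_supp_def)
  qed (use x in simp)
qed

lemma one_lt_n: "1 < n" and Suc0_lt_n: "Suc 0 < n"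
  using n2 by auto

lemma Plain1_Z_D: "Plain 1 ## Z \<in> D"
  using Z_D one_lt_n by (simp add: Cons_D)

text \<open>In \<open>w 1 0 0 0 ...\<close> the letter 1 stands at position \<open>length w\<close>.
  Prefixing \<open>s\<close> moves it to a position where the original already has 0.\<close>

lemma shift_fixed:
  assumes s: "s \<noteq> []"
  obtains z where "z \<in> D" "w @- z \<noteq> s @- w @- z"
proof (rule that[OF Plain1_Z_D])
  let ?z = "Plain 1 ## Z"
  show "w @- ?z \<noteq> s @- w @- ?z"
  proof
    assume eq: "w @- ?z = s @- w @- ?z"
    have "(w @- ?z) !! (length s + length w) = (w @- ?z) !! length w"
      by (subst eq) (simp only: shift_snth_ge[OF le_add1] add_diff_cancel_left')
    moreover have "(w @- ?z) !! (length s + length w) = ?z !! length s" "(w @- ?z) !! length w = ?z !! 0"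
      by (simp_all only: shift_snth_ge[OF le_add2] shift_snth_ge[OF order_refl] add_diff_cancel_right' diff_self_eq_0)
    moreover have "?z !! length s = Plain 0" using s by (cases s) auto
    ultimately show False by simp
  qed
qed

lemma moved_in_cone:
  assumes "u \<noteq> v"
  obtains z where "z \<in> D" "u @- w @- z \<noteq> v @- w @- z"
proof (cases "prefix u v \<or> prefix v u")
  case False
  then show thesis using that[OF Z_D] shift_eqD by blast
next
  case True
  then obtain s where "s \<noteq> []" "v = u @ s \<or> u = v @ s" using assms unfolding prefix_def by force
  moreover obtain z where "z \<in> D" "w @- z \<noteq> s @- w @- z" using shift_fixed calculation by metis
  ultimately show thesis using that[of z] by auto
qed

text \<open>By \<open>moved_in_cone\<close> a replacement of \<open>u\<close> by a different word
  moves a point in every subcone of \<open>u\<close>, so the support is dense in the cone.\<close>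

lemma local_moved:
  assumes u: "u \<in> W" and uv: "u \<noteq> v" and g: "\<And>z. z \<in> D \<Longrightarrow> g (u @- z) = v @- z" and z: "z \<in> D"
  shows "u @- z \<in> clsupp g"
  unfolding closed_supp_iff
proof (intro conjI allI)
  show "u @- z \<in> C" using u z shift_CI by blast
  fix m
  obtain z' where z': "z' \<in> D" "u @- stake m z @- z' \<noteq> v @- stake m z @- z'"
    using moved_in_cone[OF uv] by metis
  let ?y = "u @- stake m z @- z'"
  have D: "stake m z @- z' \<in> D" using z' z stake_words shift_D by blast
  moreover have "stake m ?y = stake m (u @- z)"
    by (rule stake_shift_cong) (simp add: stake_shift)
  moreover have "g ?y \<noteq> ?y" using g[OF D] z' by metis
  ultimately show "\<exists>y\<in>C. stake m y = stake m (u @- z) \<and> g y \<noteq> y"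
    using u shift_CI by (intro bexI[of _ ?y]) auto
qed

text \<open>Near a point of the closed support the replaced word \<open>u\<close> and its
  replacement differ, since otherwise a whole cone would be fixed; then \<open>local_moved\<close>
  puts the entire cone into the closed support.\<close>

lemma open_closed_supp_T:
  assumes g: "g \<in> T"
  shows "openin X (clsupp g)"
  unfolding openin_cantor
proof (intro conjI ballI)
  show "clsupp g \<subseteq> C" using closed_supp_iff by blast
  fix x assume x: "x \<in> clsupp g"
  then have xC: "x \<in> C" using closed_supp_iff by blast
  obtain u v where u: "u \<in> W" "v \<in> W" "has_prefix u x" "\<And>z. z \<in> D \<Longrightarrow> g (u @- z) = v @- z"
    using g xC unfolding T_elements_iff local_prefix_map_def by metis
  have cone: "\<exists>z\<in>D. y = u @- z" if "y \<in> C" "stake (length u) y = stake (length u) x" for y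
    using C_has_prefix[OF that(1) u(1)] that u(3) by (auto simp: has_prefix_def)
  have "u \<noteq> v"
  proof
    assume "u = v"
    then have "g y = y" if "y \<in> C" "stake (length u) y = stake (length u) x" for y
      using cone[OF that] u(4) by auto
    then show False using x unfolding closed_supp_iff by blast
  qed
  then show "\<exists>m. \<forall>y\<in>C. stake m y = stake m x \<longrightarrow> y \<in> clsupp g"
    using cone local_moved[OF u(1) _ u(4)] by (intro exI[of _ "length u"]) blast
qed

lemma D_split: "z \<in> D \<Longrightarrow> \<exists>d<n. z = Plain d ## stl z \<and> stl z \<in> D"
  by (cases z) (auto simp: Cons_D)

lemma sibling_nxt: "u \<in> W \<Longrightarrow> Suc c < n \<Longrightarrow> nxt ((u @ [Plain c]) @- M) ((u @ [Plain (Suc c)]) @- Z)"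
  using M_D Z_D by (simp, intro nxt_fork) (auto intro!: shift_CI simp: Cons_D)

text \<open>Taking the two neighbouring cones as siblings below \<open>u\<close> confines the
  support to the cone of \<open>u\<close>, which is how small supports are produced.\<close>

lemma sibling_element:
  assumes u: "u \<in> W" and c: "Suc c < n"
  obtains g where "g \<in> T"
    "\<And>z. z \<in> D \<Longrightarrow> g (u @- Plain c ## z) = u @- Plain c ## Plain 0 ## z"
    "\<And>d z. Suc d < n \<Longrightarrow> z \<in> D \<Longrightarrow> g (u @- Plain (Suc c) ## Plain d ## z) = u @- Plain c ## Plain (Suc d) ## z"
    "\<And>z. z \<in> D \<Longrightarrow> g (u @- Plain (Suc c) ## Plain (n - 1) ## z) = u @- Plain (Suc c) ## z"
    "\<And>x. x \<in> C \<Longrightarrow> \<not> has_prefix u x \<Longrightarrow> g x = x"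
    "\<And>x. x \<in> C \<Longrightarrow> \<not> has_prefix (u @ [Plain c]) x \<Longrightarrow> \<not> has_prefix (u @ [Plain (Suc c)]) x \<Longrightarrow> g x = x"
proof -
  let ?p = "u @ [Plain c]" and ?q = "u @ [Plain (Suc c)]"
  have lev: "?p \<in> level (Suc (length u))" "?q \<in> level (Suc (length u))"
    using u c by (auto simp: level_def Cons_words intro!: append_WI)
  obtain g where g: "g \<in> T" "\<And>z. z \<in> D \<Longrightarrow> g (?p @- z) = ?p @- Plain 0 ## z"
    "\<And>d z. Suc d < n \<Longrightarrow> z \<in> D \<Longrightarrow> g (?q @- Plain d ## z) = ?p @- Plain (Suc d) ## z"
    "\<And>z. z \<in> D \<Longrightarrow> g (?q @- Plain (n - 1) ## z) = ?q @- z"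
    "\<And>x. x \<in> C \<Longrightarrow> \<not> has_prefix ?p x \<Longrightarrow> \<not> has_prefix ?q x \<Longrightarrow> g x = x"
    using adjacent_element[OF level_antichain lev _ sibling_nxt[OF u c]] by auto
  have "g x = x" if "x \<in> C" "\<not> has_prefix u x" for x
    using g(5)[OF that(1)] that(2) by (auto simp: has_prefix_iff)
  with g that show thesis by simp
qed

text \<open>On both sibling cones prefixes are replaced by different ones, the second cone having to
  be split once more to see this; hence both cones lie in the closed support.\<close>

lemma sibling_supp:
  assumes u: "u \<in> W" and c: "Suc c < n" and x: "x \<in> C" "has_prefix (u @ [Plain c]) x \<or> has_prefix (u @ [Plain (Suc c)]) x"
  obtains g where "g \<in> T" "x \<in> clsupp g"
    "clsupp g \<subseteq> {y \<in> C. has_prefix u y}"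
proof -
  obtain g where g: "g \<in> T"
    "\<And>z. z \<in> D \<Longrightarrow> g (u @- Plain c ## z) = u @- Plain c ## Plain 0 ## z"
    "\<And>d z. Suc d < n \<Longrightarrow> z \<in> D \<Longrightarrow> g (u @- Plain (Suc c) ## Plain d ## z) = u @- Plain c ## Plain (Suc d) ## z"
    "\<And>z. z \<in> D \<Longrightarrow> g (u @- Plain (Suc c) ## Plain (n - 1) ## z) = u @- Plain (Suc c) ## z"
    "\<And>x. x \<in> C \<Longrightarrow> \<not> has_prefix u x \<Longrightarrow> g x = x"
    using sibling_element[OF u c] by metis
  have supp: "clsupp g \<subseteq> {y \<in> C. has_prefix u y}"
  proof
    fix y assume y: "y \<in> clsupp g"
    then obtain y' where y': "y' \<in> C" "stake (length u) y' = stake (length u) y" "g y' \<noteq> y'"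
      unfolding closed_supp_iff by blast
    then have "has_prefix u y'" using g(5) by blast
    then show "y \<in> {y \<in> C. has_prefix u y}" using y y' unfolding closed_supp_iff has_prefix_def by auto
  qed
  have Wp: "u @ [Plain c] \<in> W" and Wq: "u @ [Plain (Suc c)] \<in> W"
    using u c by (auto simp: Cons_words intro!: append_WI)
  have W: "u @ [Plain (Suc c), Plain d] \<in> W" if "d < n" for d
    using u c that by (auto simp: Cons_words intro!: append_WI)
  have "x \<in> clsupp g"
  proof (cases "has_prefix (u @ [Plain c]) x")
    case True
    then obtain z where "z \<in> D" "x = (u @ [Plain c]) @- z" using C_has_prefix[OF x(1) Wp] by blast
    then show ?thesis
      using local_moved[OF Wp, of "u @ [Plain c, Plain 0]" g z] g(2) by simp
  next
    case False
    then obtain z where z: "z \<in> D" "x = (u @ [Plain (Suc c)]) @- z"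
      using C_has_prefix[OF x(1) Wq] x(2) by blast
    then obtain d where d: "d < n" "z = Plain d ## stl z" "stl z \<in> D"
      using D_split[OF z(1)] by metis
    show ?thesis
    proof (cases "Suc d < n")
      case True
      then show ?thesis
        using local_moved[of "u @ [Plain (Suc c), Plain d]" "u @ [Plain c, Plain (Suc d)]" g "stl z"] W[of d] d z g(3)
        by simp
    next
      case False
      then have "d = n - 1" using d by linarith
      then show ?thesis
        using local_moved[of "u @ [Plain (Suc c), Plain d]" "u @ [Plain (Suc c)]" g "stl z"] W[of d] d z g(4)
        by simp
    qed
  qed
  then show thesis using that g(1) supp by blast
qed

lemma open_cone:
  assumes U: "openin X U" "x \<in> U"
  obtains u z where "u \<in> W" "z \<in> D" "x = u @- z" "{y \<in> C. has_prefix u y} \<subseteq> U"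
proof -
  have xC: "x \<in> C" using U by (auto simp: openin_cantor)
  obtain m where m: "\<forall>y\<in>C. stake m y = stake m x \<longrightarrow> y \<in> U" using U by (auto simp: openin_cantor)
  let ?u = "stake (Suc m) x"
  have u: "?u \<in> W" using stake_W[OF xC] by blast
  have "stake m y = stake m x" if "has_prefix ?u y" for y
  proof -
    have "stake (Suc m) y = stake (Suc m) x" using that by (simp only: has_prefix_def length_stake)
    then have "take m (stake (Suc m) y) = take m (stake (Suc m) x)" by simp
    then show ?thesis by (simp only: take_stake min_absorb1[OF le_SucI[OF order_refl]])
  qed
  then have "{y \<in> C. has_prefix ?u y} \<subseteq> U" using m by blast
  moreover have "x = ?u @- sdrop (Suc m) x" by (simp only: stake_sdrop)
  ultimately show thesis using that u sdrop_D[OF xC, of "Suc m"] by blast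
qed

lemma supp_base_T:
  assumes U: "openin X U" "x \<in> U"
  shows "\<exists>g\<in>T. x \<in> clsupp g \<and>
    clsupp g \<subseteq> U"
proof -
  obtain u z where u: "u \<in> W" "z \<in> D" "x = u @- z" "{y \<in> C. has_prefix u y} \<subseteq> U"
    using open_cone[OF U] by metis
  have xC: "x \<in> C" using U by (auto simp: openin_cantor)
  obtain c where c: "c < n" "shd z = Plain c" using snth_D[OF u(2), of 0] by auto
  have "x = (u @ [Plain c]) @- stl z" using u(3) c by (simp flip: c(2))
  then have pre: "has_prefix (u @ [Plain c]) x" by (metis has_prefix_shift)
  show ?thesis
  \<comment> \<open>The letter \<open>c\<close> after \<open>u\<close> needs a sibling: the next
    one, or the previous one if \<open>c\<close> is the last letter of the alphabet.\<close>
  proof (cases "Suc c < n")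
    case True
    then show ?thesis using sibling_supp[OF u(1) True xC] pre u(4) by (metis subset_trans)
  next
    case False
    then obtain d where "c = Suc d" using n2 by (cases c) auto
    then show ?thesis using sibling_supp[OF u(1) _ xC, of d] pre u(4) c by (metis subset_trans)
  qed
qed

lemma T_pow:
  assumes g: "g \<in> T" and u: "u \<in> W"
    and step: "\<And>z. z \<in> D \<Longrightarrow> g (u @- Plain 0 ## z) = u @- Plain 0 ## Plain 0 ## z" and z: "z \<in> D"
  shows "(g [^]\<^bsub>T_group n r\<^esub> (k::nat)) (u @- Plain 0 ## z) = u @- Plain 0 ## replicate k (Plain 0) @- z"
  using z
proof (induction k arbitrary: z)
  case 0
  have "u @- Plain 0 ## z \<in> C" using u 0 n2 by (intro shift_CI) (auto simp: Cons_D)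
  then show ?case by (simp add: one_T nat_pow_def)
next
  case (Suc k)
  interpret T: group "T_group n r" by (rule group_T)
  have C: "u @- Plain 0 ## z \<in> C" and D: "Plain 0 ## z \<in> D"
    using u Suc.prems n2 by (auto intro!: shift_CI simp: Cons_D)
  have "g [^]\<^bsub>T_group n r\<^esub> Suc k = compose C (g [^]\<^bsub>T_group n r\<^esub> k) g"
    using g T.nat_pow_closed[of g k] by (simp add: mult_T)
  then have "(g [^]\<^bsub>T_group n r\<^esub> Suc k) (u @- Plain 0 ## z) = u @- Plain 0 ## replicate k (Plain 0) @- Plain 0 ## z"
    using Suc.IH[OF D] step[OF Suc.prems] C by (simp add: compose_def)
  then show ?case by (simp add: replicate_append_same flip: shift.simps shift_append)
    (metis replicate_append_same shift.simps shift_append)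
qed

text \<open>An element sending \<open>u0z\<close> to \<open>u00z\<close> has infinite order: each
  further power inserts one more 0, by \<open>T_pow\<close>.\<close>

lemma twelfth_power_T:
  assumes U: "openin X U" "U \<noteq> {}"
  shows "\<exists>g\<in>T. asupp g \<subseteq> U \<and>
    g [^]\<^bsub>T_group n r\<^esub> (12::nat) \<noteq> \<one>\<^bsub>T_group n r\<^esub>"
proof -
  obtain x where "x \<in> U" using U by blast
  then obtain u where u: "u \<in> W" "{y \<in> C. has_prefix u y} \<subseteq> U" using open_cone[OF U(1)] by metis
  obtain g where g: "g \<in> T"
    "\<And>z. z \<in> D \<Longrightarrow> g (u @- Plain 0 ## z) = u @- Plain 0 ## Plain 0 ## z"
    "\<And>x. x \<in> C \<Longrightarrow> \<not> has_prefix u x \<Longrightarrow> g x = x"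
    using sibling_element[OF u(1) Suc0_lt_n] by metis
  let ?z = "Plain 1 ## Z"
  have C: "u @- Plain 0 ## ?z \<in> C" using Plain1_Z_D u n2 by (intro shift_CI) (auto simp: Cons_D)
  have "g [^]\<^bsub>T_group n r\<^esub> (12::nat) \<noteq> \<one>\<^bsub>T_group n r\<^esub>"
  proof
    assume "g [^]\<^bsub>T_group n r\<^esub> (12::nat) = \<one>\<^bsub>T_group n r\<^esub>"
    then have "u @- Plain 0 ## ?z = u @- Plain 0 ## replicate 12 (Plain 0) @- ?z"
      using T_pow[OF g(1) u(1) g(2) Plain1_Z_D, of 12] C by (simp add: one_T)
    then show False by (simp add: numeral_eq_Suc)
  qed
  moreover have "asupp g \<subseteq> U"
    using g(3) u(2) by (auto simp: act_supp_def)
  ultimately show ?thesis using g(1) by blast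
qed

text \<open>\<open>g\<close> pushes the cone of \<open>u01\<close> to that of \<open>u001\<close>,
  while \<open>f\<close> is supported in the cone of \<open>u01\<close>. So \<open>f\<close> moves
  the test point \<open>?y\<close> if applied before \<open>g\<close>, but not if applied
  afterwards.\<close>

lemma noncommuting_T:
  assumes U: "openin X U" "U \<noteq> {}"
  shows "\<exists>f\<in>T. \<exists>g\<in>T. asupp f \<subseteq> U \<and>
    asupp g \<subseteq> U \<and> \<not> commute (T_group n r) f g"
proof -
  obtain x where "x \<in> U" using U by blast
  then obtain u where u: "u \<in> W" "{y \<in> C. has_prefix u y} \<subseteq> U" using open_cone[OF U(1)] by metis
  obtain g where g: "g \<in> T"
    "\<And>z. z \<in> D \<Longrightarrow> g (u @- Plain 0 ## z) = u @- Plain 0 ## Plain 0 ## z"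
    "\<And>x. x \<in> C \<Longrightarrow> \<not> has_prefix u x \<Longrightarrow> g x = x"
    using sibling_element[OF u(1) Suc0_lt_n] by metis
  let ?u = "u @ [Plain 0, Plain 1]"
  have u': "?u \<in> W" using u(1) n2 by (intro append_WI) (auto simp: Cons_words)
  obtain f where f: "f \<in> T"
    "\<And>z. z \<in> D \<Longrightarrow> f (?u @- Plain 0 ## z) = ?u @- Plain 0 ## Plain 0 ## z"
    "\<And>x. x \<in> C \<Longrightarrow> \<not> has_prefix ?u x \<Longrightarrow> f x = x"
    using sibling_element[OF u' Suc0_lt_n] by metis
  have P: "Plain 0 \<in> alphabet n" "Plain 1 \<in> alphabet n" using n2 by auto
  let ?z = "Plain 1 ## Z"
  let ?y = "?u @- Plain 0 ## ?z"
  have C: "?y \<in> C" using u' P Plain1_Z_D by (intro shift_CI) (simp_all add: Cons_D)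
  have fy: "f ?y = u @- Plain 0 ## Plain 1 ## Plain 0 ## Plain 0 ## ?z" using f(2)[OF Plain1_Z_D] by simp
  have gfy: "g (f ?y) = u @- Plain 0 ## Plain 0 ## Plain 1 ## Plain 0 ## Plain 0 ## ?z"
    unfolding fy using g(2)[of "Plain 1 ## Plain 0 ## Plain 0 ## ?z"] P Plain1_Z_D by (simp add: Cons_D)
  have gy: "g ?y = u @- Plain 0 ## Plain 0 ## Plain 1 ## Plain 0 ## ?z"
    using g(2)[of "Plain 1 ## Plain 0 ## ?z"] P Plain1_Z_D by (simp add: Cons_D)
  have gyC: "g ?y \<in> C" using homeos_closed[OF T_homeos[OF g(1)] C] .
  have "\<not> has_prefix ?u (g ?y)" unfolding gy has_prefix_iff by auto
  then have fgy: "f (g ?y) = g ?y" using f(3) gyC by blast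
  have "\<not> commute (T_group n r) f g"
  proof
    assume "commute (T_group n r) f g"
    then have "compose C f g = compose C g f" unfolding commute_def using f g by (simp add: mult_T)
    then have "f (g ?y) = g (f ?y)" using C by (metis compose_eq)
    then have "u @- Plain 0 ## Plain 0 ## Plain 1 ## Plain 0 ## ?z =
        u @- Plain 0 ## Plain 0 ## Plain 1 ## Plain 0 ## Plain 0 ## ?z"
      using fgy gfy gy by metis
    then show False by simp
  qed
  moreover have "asupp g \<subseteq> U"
    using g(3) u(2) by (auto simp: act_supp_def)
  moreover have "asupp f \<subseteq> U"
  proof -
    have "has_prefix u y" if "has_prefix ?u y" for y using that by (auto simp: has_prefix_iff)
    then show ?thesis using f(3) u(2) by (auto simp: act_supp_def)
  qed
  ultimately show ?thesis using f(1) g(1) by blast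
qed

lemma T_continuous: "g \<in> T \<Longrightarrow> continuous_map X X g"
  using T_homeos by (auto simp: homeos_def intro: homeomorphic_imp_continuous_map)

lemma rubin_T: "rubin_action (T_group n r) X (\<lambda>g. g)"
proof (intro rubin_action.intro group_T rubin_action_axioms.intro)
  show "(g \<otimes>\<^bsub>T_group n r\<^esub> h) x = g (h x)"
    if "g \<in> carrier (T_group n r)" "h \<in> carrier (T_group n r)" "x \<in> topspace X" for g h x
    using that by (simp add: mult_T compose_def)
  show "g = \<one>\<^bsub>T_group n r\<^esub>"
    if "g \<in> carrier (T_group n r)" "\<And>x. x \<in> topspace X \<Longrightarrow> g x = x" for g
    using that T_homeos id_homeos by (intro homeos_eqI) (auto simp: one_T)
qed (use T_continuous compact_cantor Hausdorff_cantor open_closed_supp_T supp_base_T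
    noncommuting_T twelfth_power_T in \<open>auto simp: one_T\<close>)

section \<open>Stabilizers of points in \<open>T\<close>\<close>

lemma nxt_exists_left: 
  assumes "u \<in> W"
  obtains x where "nxt x (u @- Z)"
proof -
  have u: "u \<in> level (length u)" using assms by (simp add: level_def)
  have len: "0 < length u" using assms by (cases u) auto
  obtain us where us: "lists_antichain n r us" "set us = level (length u)"
    using antichain_list[OF level_antichain[OF len]] by metis
  then obtain i where i: "i < length us" "u = us ! i" using u by (metis in_set_conv_nth)
  define j where "j = (if i = 0 then length us - 1 else i - 1)"
  have "j < length us" "Suc j mod length us = i" using i(1) by (auto simp: j_def)
  then show thesis using that lists_antichain_nxt[OF us(1), of j] i(2) by auto
qed

text \<open>The images of an adjacent pair form an adjacent pair in one of the two directions. Since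
  \<open>x\<close> ends in \<open>M\<close> it has no predecessor, and \<open>y\<close> has no
  successor, so fixing one point settles the direction and with it the other point.\<close>

lemma stabilizer_nxt:
  assumes g: "g \<in> T" and xy: "nxt x y"
  shows "g x = x \<longleftrightarrow> g y = y"
proof -
  have C: "x \<in> C" "y \<in> C" using xy nxt_C by auto
  have gh: "g \<in> H" and pres: "preserves_circle_eq n r g" using g by (auto simp: T_elements_iff)
  have "circle_eq n r x y" using xy C by (simp add: circle_eq_iff)
  then have e: "circle_eq n r (g x) (g y)" using pres by (simp add: preserves_circle_eq_def)
  have ne: "g x \<noteq> g y" using homeos_inj[OF gh C] nxt_neq[OF xy] by simp
  have nyx: "\<not> nxt z x" and nyy: "\<not> nxt y z" for z
    using xy nxt_left_M nxt_right_Z shift_M_Z by metis+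
  show ?thesis
  proof
    assume "g x = x"
    then have "nxt x (g y)" using e ne nyx unfolding circle_eq_iff by metis
    then show "g y = y" using nxt_right_unique xy by blast
  next
    assume "g y = y"
    then have "nxt (g x) y" using e ne nyy unfolding circle_eq_iff by metis
    then show "g x = x" using nxt_left_unique xy by blast
  qed
qed

lemma exists_common_depth:
  fixes p x y :: "letter stream"
  assumes "p \<noteq> x" "p \<noteq> y" "x \<noteq> y"
  obtains m where "0 < m" "stake m p \<noteq> stake m x" "stake m p \<noteq> stake m y" "stake m x \<noteq> stake m y"
proof -
  have mono: "stake m a \<noteq> stake m b" if "stake k a \<noteq> stake k b" "k \<le> m" for k m and a b :: "letter stream"
    using that by (metis min_absorb1 take_stake)
  obtain k1 k2 k3 where k: "stake k1 p \<noteq> stake k1 x" "stake k2 p \<noteq> stake k2 y" "stake k3 x \<noteq> stake k3 y"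
    using assms stream_eqI by metis
  define m where "m = Suc (k1 + k2 + k3)"
  then have "0 < m" "k1 \<le> m" "k2 \<le> m" "k3 \<le> m" by auto
  then show thesis using that[of m] mono[OF k(1), of m] mono[OF k(2), of m] mono[OF k(3), of m] by blast
qed

text \<open>If \<open>q\<close> is the left end of a cone, it has a predecessor \<open>p'\<close>,
  different from \<open>p\<close>; an adjacent element on small cones around \<open>p'\<close> and
  \<open>q\<close> moves \<open>q\<close> across the gap and avoids \<open>p\<close>. Otherwise
  \<open>q\<close> has nonzero letters arbitrarily deep, so it lies in the second of two sibling
  cones away from \<open>p\<close>. The sibling element fixes in that cone only the right end, which
  is excluded.\<close>

lemma stabilizer_separates:
  assumes p: "p \<in> C" and q: "q \<in> C" and pq: "p \<noteq> q" "\<not> nxt p q" and notM: "\<And>u. q \<noteq> u @- M"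
  obtains g where "g \<in> T" "g p = p" "g q \<noteq> q"
proof (cases "\<exists>v\<in>W. q = v @- Z")
  case True
  then obtain p' where p': "nxt p' q" using nxt_exists_left by metis
  then have "p \<noteq> p'" "p' \<noteq> q" "p' \<in> C" using pq nxt_neq nxt_C by blast+
  then obtain m where m: "0 < m" "stake m p \<noteq> stake m p'" "stake m p \<noteq> stake m q" "stake m p' \<noteq> stake m q"
    using exists_common_depth[of p p' q] pq by blast
  let ?P = "stake m p'" and ?Q = "stake m q"
  have W: "?P \<in> W" "?Q \<in> W" using m stake_W q \<open>p' \<in> C\<close> by auto
  then have lev: "?P \<in> level m" "?Q \<in> level m" by (auto simp: level_def)
  have eq: "p' = ?P @- M" "q = ?Q @- Z"
    using nxt_leave_cone[OF p' W(1)] nxt_enter_cone[OF p' W(2)] m by (auto simp: has_prefix_def)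
  obtain g where g: "g \<in> T"
    "\<And>c z. Suc c < n \<Longrightarrow> z \<in> D \<Longrightarrow> g (?Q @- Plain c ## z) = ?P @- Plain (Suc c) ## z"
    "\<And>x. x \<in> C \<Longrightarrow> \<not> has_prefix ?P x \<Longrightarrow> \<not> has_prefix ?Q x \<Longrightarrow> g x = x"
    using adjacent_element[OF level_antichain[OF m(1)] lev m(4)] p' eq by metis
  have "g p = p" using g(3)[OF p] m by (simp add: has_prefix_def)
  moreover have "g q = ?P @- Plain 1 ## Z" 
    using g(2)[OF Suc0_lt_n Z_D] eq(2) Z_unfold by simp
  then have "stake m (g q) = ?P" by (simp add: stake_shift)
  then have "g q \<noteq> q" using m(4) by metis
  ultimately show thesis using that g(1) by blast
next
  case False
  obtain m where m: "0 < m" "stake m p \<noteq> stake m q"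
    using pq stream_eqI by (metis gr0I stake.simps(1))
  have "\<exists>k\<ge>m. q !! k \<noteq> Plain 0"
  proof (rule ccontr)
    assume "\<not> ?thesis"
    then have "sdrop m q !! k = Z !! k" for k by (simp add: sdrop_snth)
    then have "snth (sdrop m q) = snth Z" by blast
    then have "sdrop m q = Z" using stream_smap_nats by metis
    then have "q = stake m q @- Z" using stake_sdrop by metis
    then show False using False stake_W[OF q m(1)] by blast
  qed
  then obtain k where k: "m \<le> k" "q !! k \<noteq> Plain 0" by blast
  then have "q !! k \<in> alphabet n" using q m unfolding C_iff by (metis not_less0 order.strict_trans2)
  then obtain c where c: "q !! k = Plain (Suc c)" "Suc c < n" using k(2) by (auto simp: gr0_conv_Suc)
  let ?w = "stake k q"
  have w: "?w \<in> W" using stake_W[OF q] m k by simp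
  define z where "z = sdrop (Suc k) q"
  have z: "z \<in> D" "q = ?w @- Plain (Suc c) ## z"
    using sdrop_D[OF q] id_stake_snth_sdrop[of q k] c by (auto simp: z_def simp del: sdrop.simps)
  obtain d where d: "d < n" "z = Plain d ## stl z" "stl z \<in> D"
    using D_split[OF z(1)] by metis
  obtain g where g: "g \<in> T"
    "\<And>d z. Suc d < n \<Longrightarrow> z \<in> D \<Longrightarrow> g (?w @- Plain (Suc c) ## Plain d ## z) = ?w @- Plain c ## Plain (Suc d) ## z"
    "\<And>z. z \<in> D \<Longrightarrow> g (?w @- Plain (Suc c) ## Plain (n - 1) ## z) = ?w @- Plain (Suc c) ## z"
    "\<And>x. x \<in> C \<Longrightarrow> \<not> has_prefix ?w x \<Longrightarrow> g x = x"
    using sibling_element[OF w c(2)] by metis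
  have "\<not> has_prefix ?w p" 
    using m(2) k(1) by (metis has_prefix_def length_stake min_absorb1 take_stake)
  then have "g p = p" using g(4) p by blast
  moreover have "g q \<noteq> q"
  proof (cases "Suc d < n")
    case True
    then have "g q = ?w @- Plain c ## Plain (Suc d) ## stl z" using g(2)[OF True d(3)] z(2) d(2) by metis
    then show ?thesis using z(2) by (metis shift_left_inj stream.inject letter.inject(2) n_not_Suc_n)
  next
    case False
    then have dn: "d = n - 1" using d by linarith
    then have gq: "g q = ?w @- Plain (Suc c) ## stl z" using g(3)[OF d(3)] z(2) d(2) by metis
    show ?thesis
    proof
      assume "g q = q"
      then have "stl z = z" using gq z(2) by (metis shift_left_inj stream.inject)
      then have zz: "z = Plain (n - 1) ## z" using d(2) dn by simp
      have "sdrop i z = z" for i by (induction i) (use \<open>stl z = z\<close> in auto)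
      then have "z !! i = Plain (n - 1)" for i
        using zz by (metis sdrop_simps(1) stream.sel(1))
      then have "snth z = snth M" by auto
      then have "z = M" using stream_smap_nats by metis
      then have "q = (?w @ [Plain (Suc c)]) @- M" using z(2) by simp
      then show False using notM by blast
    qed
  qed
  ultimately show thesis using that g(1) by blast
qed

text \<open>If \<open>q\<close> ends in \<open>M\<close>, its successor \<open>q'\<close> has the
  same stabilizer and does not end in \<open>M\<close>, so \<open>stabilizer_separates\<close>
  applies to it.\<close>

lemma stabilizer_circle_eq:
  assumes p: "p \<in> C" and q: "q \<in> C" and stab: "\<And>g. g \<in> T \<Longrightarrow> g p = p \<longleftrightarrow> g q = q"
  shows "circle_eq n r p q"
proof (rule ccontr)
  assume "\<not> circle_eq n r p q"
  then have no: "p \<noteq> q" "\<not> nxt p q" "\<not> nxt q p" using p q by (auto simp: circle_eq_iff)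
  show False
  proof (cases "\<exists>u. q = u @- M")
    case False
    then show False using stabilizer_separates[OF p q no(1,2)] stab by metis
  next
    case True
    then obtain u where u: "q = u @- M" by blast
    have "sdrop (Suc (length u)) q = M" unfolding u sdrop_shift by (simp del: sdrop.simps)
    then have "q = stake (Suc (length u)) q @- M" using stake_sdrop by metis
    moreover have "stake (Suc (length u)) q \<in> W" using stake_W[OF q] by blast
    ultimately obtain q' where q': "nxt q q'" using nxt_exists by metis
    have "p \<noteq> q'" "\<not> nxt p q'" using no q' nxt_left_unique by blast+
    moreover have "q' \<noteq> v @- M" for v using nxt_right_Z[OF q'] shift_M_Z by metis
    ultimately obtain g where g: "g \<in> T" "g p = p" "g q' \<noteq> q'"
      using stabilizer_separates[OF p nxt_C(2)[OF q']] by metis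
    then show False using stab[OF g(1)] stabilizer_nxt[OF g(1) q'] by blast
  qed
qed

end

section \<open>Synchronizing transducers as a property of maps\<close>

lemma step_word_append: "step_word A (u @ w) q = step_word A w (step_word A u q)"
  by (induction u arbitrary: q) auto

lemma out_word_append: "out_word A (u @ w) q = out_word A u q @ out_word A w (step_word A u q)"
  by (induction u arbitrary: q) auto

lemma stake_Suc_snoc: "stake (Suc k) x = stake k x @ [x !! k]"
  by (induction k arbitrary: x) auto

context cantor_params
begin

section \<open>Increasing chains of words and their limits\<close>

lemma prefix_chain_unique:
  assumes "\<And>k. has_prefix (f k) y" "\<And>k. has_prefix (f k) y'" "\<And>m. \<exists>k. m \<le> length (f k)"
  shows "y = y'"
proof (rule stream_eqI)
  fix m
  obtain k where k: "m \<le> length (f k)" using assms(3) by blast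
  have "stake m z = take m (f k)" if "has_prefix (f k) z" for z
    using that k by (metis has_prefix_def min_absorb1 take_stake)
  then show "stake m y = stake m y'" using assms(1,2) by metis
qed

lemma prefix_chain_limit:
  assumes chain: "\<And>k. prefix (f k) (f (Suc k))" and unb: "\<And>m. \<exists>k. m \<le> length (f k)"
  obtains y :: "letter stream" where "\<And>k. has_prefix (f k) y"
proof -
  have mono: "prefix (f k) (f l)" if "k \<le> l" for k l
    using that by (induction rule: dec_induct) (auto intro: chain prefix_order.trans)
  obtain K where K: "\<And>m. m \<le> length (f (K m))" using unb by metis
  define y where "y = smap (\<lambda>i. f (K (Suc i)) ! i) nats"
  have "has_prefix (f k) y" for k
  proof -
    have "stake (length (f k)) y ! i = f k ! i" if i: "i < length (f k)" for i
    proof -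
      have "prefix (f k) (f (K (Suc i))) \<or> prefix (f (K (Suc i))) (f k)"
        using mono nat_le_linear by metis
      then have "f (K (Suc i)) ! i = f k ! i"
        using i K[of "Suc i"] by (auto simp: prefix_def nth_append)
      then show ?thesis using i by (simp add: y_def)
    qed
    then show ?thesis unfolding has_prefix_def by (intro nth_equalityI) auto
  qed
  then show thesis using that by blast
qed

text \<open>Equality of the local maps of \<open>h\<close> on the cones of \<open>u\<close> and
  \<open>v\<close> up to an output prefix. Asking for \<open>a\<close> and \<open>b\<close> in
  \<open>W\<close> says that the dotted letter of the output is already written on both cones, which
  corresponds to a state in \<open>Sstates\<close>.\<close>

definition locrel :: "(letter stream \<Rightarrow> letter stream) \<Rightarrow> letter list \<Rightarrow> letter list \<Rightarrow> bool" where
  "locrel h u v \<longleftrightarrow> (\<exists>a\<in>W. \<exists>b\<in>W. \<exists>f. \<forall>x\<in>D. h (u @- x) = a @- f x \<and> h (v @- x) = b @- f x)"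

text \<open>Synchronization without a transducer: after a common suffix of length \<open>k\<close>
  the local map has forgotten what came before.\<close>

definition sync_map :: "(letter stream \<Rightarrow> letter stream) \<Rightarrow> bool" where
  "sync_map h \<longleftrightarrow> (\<exists>k. \<forall>w\<in>words n. k \<le> length w \<longrightarrow> (\<forall>u\<in>W. \<forall>v\<in>W. locrel h (u @ w) (v @ w)))"

lemma locrel_append:
  assumes "locrel h u v" "w \<in> words n"
  shows "locrel h (u @ w) (v @ w)"
proof -
  obtain a b f where f: "a \<in> W" "b \<in> W" "\<And>x. x \<in> D \<Longrightarrow> h (u @- x) = a @- f x \<and> h (v @- x) = b @- f x"
    using assms(1) unfolding locrel_def by metis
  have "w @- x \<in> D" if "x \<in> D" for x using that assms(2) shift_D by blast
  then show ?thesis unfolding locrel_def using f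
    by (intro bexI[of _ a] bexI[of _ b] exI[of _ "\<lambda>x. f (w @- x)"]) auto
qed

section \<open>Runs of a transducer\<close>

lemma transducer_components:
  assumes "transducer n r A"
  shows "Rstates A \<inter> Sstates A = {}" "start A \<in> Rstates A"
    "\<forall>q i. readable n r A i q \<longrightarrow> step A i q \<in> states A - {start A} \<and> out A i q \<in> words_star n r \<union> words n"
    "\<forall>q\<in>Rstates A. \<forall>i. readable n r A i q \<longrightarrow>
        (step A i q \<in> Rstates A \<longrightarrow> out A i q = []) \<and> (step A i q \<in> Sstates A \<longrightarrow> out A i q \<in> W)"
    "\<forall>q\<in>Sstates A. \<forall>i. readable n r A i q \<longrightarrow> step A i q \<in> Sstates A \<and> out A i q \<in> words n"
    "\<forall>q\<in>Sstates A. \<forall>x\<in>D. \<forall>m. \<exists>k. m \<le> length (out_word A (stake k x) q)"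
    "\<forall>q\<in>Rstates A. \<forall>w. w \<noteq> [] \<and> readable_word n r A w q \<longrightarrow> step_word A w q \<noteq> q"
  using assms unfolding transducer_def by - (elim conjE, assumption)+

lemma transducer_nonstart:
  assumes A: "transducer n r A" and q: "q \<in> states A - {start A}" and w: "w \<in> words n"
  shows "readable_word n r A w q \<and> step_word A w q \<in> states A - {start A}"
  using q w
proof (induction w arbitrary: q)
  case (Cons i w)
  then have "readable n r A i q" by (auto simp: readable_def Cons_words)
  moreover from this have "step A i q \<in> states A - {start A}" using transducer_components(3)[OF A] by blast
  ultimately show ?case using Cons by (simp add: Cons_words)
qed auto

lemma transducer_start:
  assumes A: "transducer n r A" and u: "u \<in> W"
  shows "readable_word n r A u (start A)" "step_word A u (start A) \<in> states A - {start A}"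
proof -
  obtain i w where iw: "u = i # w" "i \<in> dotted_alphabet r" "w \<in> words n" using u by (auto simp: words_plus_def)
  then have "readable n r A i (start A)" by (auto simp: readable_def)
  moreover from this have "step A i (start A) \<in> states A - {start A}" using transducer_components(3)[OF A] by blast
  ultimately show "readable_word n r A u (start A)" "step_word A u (start A) \<in> states A - {start A}"
    using transducer_nonstart[OF A _ iw(3)] iw(1) by auto
qed

lemma transducer_out_W:
  assumes A: "transducer n r A" and u: "u \<in> W"
  shows "(step_word A u (start A) \<in> Rstates A \<longrightarrow> out_word A u (start A) = []) \<and>
    (step_word A u (start A) \<in> Sstates A \<longrightarrow> out_word A u (start A) \<in> W)"
  using u
proof (induction u rule: rev_induct)
  case (snoc i u)
  have R: "(step A i q \<in> Rstates A \<longrightarrow> out A i q = []) \<and> (step A i q \<in> Sstates A \<longrightarrow> out A i q \<in> W)"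
    if "q \<in> Rstates A" "readable n r A i q" for q
    using transducer_components(4)[OF A] that by blast
  show ?case
  proof (cases "u = []")
    case True
    then have "readable n r A i (start A)" using snoc.prems by (auto simp: readable_def Cons_W)
    moreover have "start A \<in> Rstates A" using transducer_components(2)[OF A] .
    ultimately show ?thesis using True R by simp
  next
    case False
    then have uW: "u \<in> W" "i \<in> alphabet n" using snoc.prems by (auto simp: append_W Cons_words)
    let ?q = "step_word A u (start A)"
    have q: "?q \<in> states A - {start A}" using transducer_start[OF A uW(1)] by blast
    then have rd: "readable n r A i ?q" using uW by (auto simp: readable_def)
    show ?thesis
    proof (cases "?q \<in> Rstates A")
      case True
      then have "out_word A u (start A) = []" using snoc.IH uW by blast
      then show ?thesis using R[OF True rd] by (simp add: step_word_snoc out_word_snoc)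
    next
      case False
      then have S: "?q \<in> Sstates A" using q by (auto simp: states_def)
      then have "step A i ?q \<in> Sstates A \<and> out A i ?q \<in> words n"
        using transducer_components(5)[OF A] rd S by blast
      moreover have "Rstates A \<inter> Sstates A = {}" using transducer_components(1)[OF A] .
      ultimately show ?thesis
        using snoc.IH uW S append_WI by (auto simp: step_word_snoc out_word_snoc)
    qed
  qed
qed simp

lemma state_map_S:
  assumes A: "transducer n r A" and q: "q \<in> Sstates A" and z: "z \<in> D"
  shows "has_prefix (out_word A (stake k z) q) (state_map A q z)"
    and "\<And>y. (\<And>k. has_prefix (out_word A (stake k z) q) y) \<Longrightarrow> y = state_map A q z"
proof -
  let ?f = "\<lambda>k. out_word A (stake k z) q"
  have unb: "\<exists>k. m \<le> length (?f k)" for m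
    using transducer_components(6)[OF A] q z by blast
  have chain: "prefix (?f k) (?f (Suc k))" for k
    by (simp only: stake_Suc_snoc out_word_append) simp
  obtain y where y: "\<And>k. has_prefix (?f k) y" using prefix_chain_limit[OF chain unb] by blast
  have eq: "state_map A q z = y"
    unfolding state_map_def
    by (rule the_equality) (use y prefix_chain_unique[of ?f, OF _ _ unb] in blast)+
  then show "has_prefix (?f k) (state_map A q z)" using y by simp
  show "y' = state_map A q z" if "\<And>k. has_prefix (?f k) y'" for y'
    using prefix_chain_unique[of ?f, OF that y unb] eq by simp
qed

lemma state_map_start:
  assumes A: "transducer n r A" and u: "u \<in> W" and S: "step_word A u (start A) \<in> Sstates A" and z: "z \<in> D"
  shows "state_map A (start A) (u @- z) = out_word A u (start A) @- state_map A (step_word A u (start A)) z"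
proof -
  let ?q = "step_word A u (start A)" and ?a = "out_word A u (start A)"
  let ?f = "\<lambda>k. out_word A (stake k (u @- z)) (start A)"
  have long: "?f (length u + k) = ?a @ out_word A (stake k z) ?q" for k
    by (simp add: stake_shift out_word_append)
  show ?thesis
    unfolding state_map_def[of A "start A"]
  proof (rule the_equality, intro allI)
    fix k
    show "has_prefix (?f k) (?a @- state_map A ?q z)"
    proof (cases "length u \<le> k")
      case True
      then obtain j where "k = length u + j" using le_Suc_ex by blast
      then have "?f k = ?a @ out_word A (stake j z) ?q" using long by blast
      then show ?thesis using state_map_S(1)[OF A S z, of j] by (auto simp: has_prefix_iff)
    next
      case False
      then have "u = stake k (u @- z) @ drop k u" by (simp add: stake_shift)
      then have "?a = ?f k @ out_word A (drop k u) (step_word A (stake k (u @- z)) (start A))"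
        by (metis out_word_append)
      then show ?thesis by (metis has_prefix_shift shift_append)
    qed
  next
    fix y assume y: "\<forall>k. has_prefix (?f k) y"
    then have pre: "has_prefix (?a @ out_word A (stake k z) ?q) y" for k using long by metis
    then obtain y1 where y1: "y = ?a @- y1" using pre[of 0] by (auto simp: has_prefix_iff)
    then have "has_prefix (out_word A (stake k z) ?q) y1" for k
      using pre[of k] by (auto simp: has_prefix_iff)
    then show "y = ?a @- state_map A ?q z" using state_map_S(2)[OF A S z] y1 by blast
  qed
qed

text \<open>A state of \<open>R\<close> reached by a synchronizing word \<open>w\<close> would be fixed by \<open>w\<close>, which
  \<open>R\<close> does not allow.  So the state reached by \<open>w\<close>, which depends on \<open>w\<close> only, lies in \<open>S\<close>.\<close>

lemma sync_homeo_sync_map: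
  assumes "sync_homeo n r h"
  shows "sync_map h"
proof -
  obtain A :: "nat transducer" where min: "minimal n r A" and rep: "represents n r A h"
    and syn: "synchronizing n r A"
    using assms unfolding sync_homeo_def by blast
  have A: "transducer n r A" using min by (simp add: minimal_def)
  obtain k where k: "\<And>w p q. length w = k \<Longrightarrow> readable_word n r A w p \<Longrightarrow> readable_word n r A w q \<Longrightarrow>
      step_word A w p = step_word A w q"
    using syn unfolding synchronizing_def by blast
  have D0: "[Dotted 0] \<in> W" using r1 by (simp add: Cons_W)
  \<comment> \<open>For \<open>k = 0\<close> all states would coincide, whereas the start state is
    never reached again after a letter.\<close>
  have "k \<noteq> 0"
  proof
    assume "k = 0"
    moreover have "start A \<in> states A" using transducer_components(2)[OF A] by (simp add: states_def)
    ultimately show False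
      using k[of "[]" "start A" "step_word A [Dotted 0] (start A)"] transducer_start[OF A D0] by auto
  qed
  have base: "locrel h (u @ w) (v @ w)" if w: "w \<in> words n" "length w = k" and uv: "u \<in> W" "v \<in> W" for u v w
  proof -
    define q where "q u = step_word A u (start A)" for u
    have q: "q u \<in> states A - {start A}" if "u \<in> W" for u
      using transducer_start[OF A that] by (simp add: q_def)
    have rd: "readable_word n r A w p" if "p \<in> states A - {start A}" for p
      using transducer_nonstart[OF A that w(1)] by blast
    have qw: "q (u @ w) = step_word A w (q u)" for u by (simp add: q_def step_word_append)
    define p where "p = q (u @ w)"
    have p: "p \<in> states A - {start A}" using q append_WI[OF uv(1) w(1)] by (simp add: p_def)
    have pq: "q (v @ w) = p" "step_word A w p = p"
      using k[OF w(2) rd[OF q[OF uv(2)]] rd[OF q[OF uv(1)]]] k[OF w(2) rd[OF p] rd[OF q[OF uv(1)]]]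
      unfolding p_def qw by simp_all
    have "w \<noteq> []" using w \<open>k \<noteq> 0\<close> by auto
    then have "p \<notin> Rstates A"
      using pq(2) rd[OF p] transducer_components(7)[OF A] by blast
    then have S: "p \<in> Sstates A" using p by (auto simp: states_def)
    have out: "out_word A (x @ w) (start A) \<in> W" "h ((x @ w) @- z) = out_word A (x @ w) (start A) @- state_map A p z"
      if "x \<in> W" "q (x @ w) = p" "z \<in> D" for x z
    proof -
      have W: "x @ w \<in> W" using that append_WI w by blast
      have st: "step_word A (x @ w) (start A) = p" using that(2) by (simp add: q_def)
      show "out_word A (x @ w) (start A) \<in> W" using transducer_out_W[OF A W] S st by simp
      have "h ((x @ w) @- z) = state_map A (start A) ((x @ w) @- z)"
        using rep shift_CI[OF W that(3)] unfolding represents_def by blast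
      then show "h ((x @ w) @- z) = out_word A (x @ w) (start A) @- state_map A p z"
        using state_map_start[OF A W _ that(3)] S st by simp
    qed
    show ?thesis
      unfolding locrel_def
      using out[OF uv(1) p_def[symmetric]] out[OF uv(2) pq(1)] Z_D by blast
  qed
  have "locrel h (u @ w) (v @ w)" if w: "w \<in> words n" "k \<le> length w" and uv: "u \<in> W" "v \<in> W" for u v w
  proof -
    have "w = take k w @ drop k w" by simp
    then have tw: "take k w \<in> words n" and dw: "drop k w \<in> words n" using w(1) append_words by metis+
    have "locrel h (u @ take k w) (v @ take k w)" using base tw w(2) uv by simp
    then have "locrel h ((u @ take k w) @ drop k w) ((v @ take k w) @ drop k w)"
      using dw by (rule locrel_append)
    then show ?thesis by simp
  qed
  then show ?thesis unfolding sync_map_def by blast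
qed

section \<open>Greatest common prefixes\<close>

lemma greatest_common_prefix_unique:
  "greatest_common_prefix p Y \<Longrightarrow> greatest_common_prefix q Y \<Longrightarrow> p = q"
  unfolding greatest_common_prefix_def by (meson prefix_order.antisym)

lemma greatest_common_prefix_exists:
  assumes Y: "y1 \<in> Y" "y2 \<in> Y" "y1 \<noteq> y2"
  shows "\<exists>p. greatest_common_prefix p Y"
proof -
  let ?P = "\<lambda>l. \<forall>y\<in>Y. has_prefix (stake l y1) y"
  obtain m where m: "stake m y1 \<noteq> stake m y2" using stream_eqI Y(3) by blast
  have bound: "l \<le> m" if "?P l" for l
  proof (rule ccontr)
    assume "\<not> l \<le> m"
    then have "take m (stake l y1) = stake m y1" "take m (stake l y2) = stake m y2"
      by (simp_all add: take_stake min_absorb1)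
    moreover have "stake l y2 = stake l y1" using that Y(2) by (auto simp: has_prefix_def)
    ultimately show False using m by metis
  qed
  have P0: "?P 0" by (simp add: has_prefix_def)
  define L where "L = (GREATEST l. ?P l)"
  have L: "?P L" unfolding L_def by (rule GreatestI_nat[of ?P 0 m]) (use P0 bound in blast)+
  have max: "l \<le> L" if "?P l" for l unfolding L_def by (rule Greatest_le_nat[of ?P l m]) (use that bound in blast)+
  have "prefix v (stake L y1)" if v: "\<forall>y\<in>Y. has_prefix v y" for v
  proof -
    have "v = stake (length v) y1" using v Y(1) by (simp add: has_prefix_def)
    then have "length v \<le> L" using max[of "length v"] v by simp
    then show ?thesis using v Y(1) by (simp add: prefix_stake)
  qed
  then show ?thesis unfolding greatest_common_prefix_def using L by blast
qed

lemma greatest_common_prefix_shift: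
  assumes "greatest_common_prefix q ((\<lambda>y. a @- y) ` Y)"
  obtains p where "q = a @ p" "greatest_common_prefix p Y"
proof -
  have q: "\<And>y. y \<in> Y \<Longrightarrow> has_prefix q (a @- y)"
    and max: "\<And>v. (\<And>y. y \<in> Y \<Longrightarrow> has_prefix v (a @- y)) \<Longrightarrow> prefix v q"
    using assms unfolding greatest_common_prefix_def by auto
  have "prefix a q" using max by simp
  then obtain p where p: "q = a @ p" by (auto simp: prefix_def)
  have sh: "has_prefix (a @ v) (a @- y) \<longleftrightarrow> has_prefix v y" for v y by (simp add: has_prefix_iff)
  have "greatest_common_prefix p Y"
    unfolding greatest_common_prefix_def
    using q max[of "a @ v" for v] p sh by (metis same_prefix_prefix)
  then show thesis using that p by blast
qed

section \<open>Local maps of a homeomorphism\<close>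

context
  fixes h assumes h: "h \<in> H"
begin

text \<open>All of the output to which \<open>h\<close> is committed after the input
  \<open>u\<close>; it is what the minimal transducer has written by then.\<close>

definition cone_prefix :: "letter list \<Rightarrow> letter list" where
  "cone_prefix u = (SOME p. greatest_common_prefix p ((\<lambda>x. h (u @- x)) ` D))"

text \<open>What remains of \<open>h\<close> on the cone of \<open>u\<close> once the committed
  output is removed. It is made extensional on \<open>D\<close>, so that sameness of states becomes
  equality of functions.\<close>

definition local_map :: "letter list \<Rightarrow> letter stream \<Rightarrow> letter stream" where
  "local_map u = restrict (\<lambda>x. sdrop (length (cone_prefix u)) (h (u @- x))) D"

lemma cone_prefix_gcp:
  assumes u: "u \<in> W"
  shows "greatest_common_prefix (cone_prefix u) ((\<lambda>x. h (u @- x)) ` D)"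
proof -
  have "h (u @- M) \<noteq> h (u @- Z)"
    using homeos_inj[OF h] shift_CI u M_D Z_D M_neq_Z by simp
  then have "\<exists>p. greatest_common_prefix p ((\<lambda>x. h (u @- x)) ` D)"
    using greatest_common_prefix_exists M_D Z_D by (metis (no_types, lifting) imageI)
  then show ?thesis unfolding cone_prefix_def by (rule someI_ex)
qed

lemma local_map_eq:
  assumes u: "u \<in> W" and x: "x \<in> D"
  shows "h (u @- x) = cone_prefix u @- local_map u x"
proof -
  have "has_prefix (cone_prefix u) (h (u @- x))" using cone_prefix_gcp[OF u] x unfolding greatest_common_prefix_def by blast
  then show ?thesis using x by (simp add: local_map_def has_prefix_def) (metis stake_sdrop)
qed

lemma cone_prefix_max: "u \<in> W \<Longrightarrow> (\<And>x. x \<in> D \<Longrightarrow> has_prefix v (h (u @- x))) \<Longrightarrow> prefix v (cone_prefix u)"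
  using cone_prefix_gcp unfolding greatest_common_prefix_def by blast

lemma prefix_cp: 
  assumes u: "u \<in> W" and w: "w \<in> words n"
  shows "prefix (cone_prefix u) (cone_prefix (u @ w))"
proof (rule cone_prefix_max[OF append_WI[OF u w]])
  fix x assume "x \<in> D"
  then have "w @- x \<in> D" using w shift_D by blast
  then have "h (u @- (w @- x)) = cone_prefix u @- local_map u (w @- x)" by (rule local_map_eq[OF u])
  then show "has_prefix (cone_prefix u) (h ((u @ w) @- x))" by simp
qed

lemma cone_prefix_W: "u \<in> W \<Longrightarrow> cone_prefix u \<noteq> [] \<Longrightarrow> cone_prefix u \<in> W"
  using homeos_closed[OF h shift_CI[OF _ Z_D]] local_map_eq[OF _ Z_D] shift_C by metis

lemma local_map_C: "u \<in> W \<Longrightarrow> x \<in> D \<Longrightarrow> cone_prefix u = [] \<Longrightarrow> local_map u x \<in> C"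
  using homeos_closed[OF h shift_CI] local_map_eq by (metis shift.simps(1))

lemma local_map_D: "u \<in> W \<Longrightarrow> x \<in> D \<Longrightarrow> cone_prefix u \<noteq> [] \<Longrightarrow> local_map u x \<in> D"
  using homeos_closed[OF h shift_CI] local_map_eq shift_C by metis

text \<open>Values of \<open>local_map u\<close> lie in \<open>C\<close> if no output is committed
  and in \<open>D\<close> otherwise, and these sets are disjoint. Thus the division into
  \<open>Rstates\<close> and \<open>Sstates\<close> depends on the local map only.\<close>

lemma local_map_cp_Nil: "u \<in> W \<Longrightarrow> v \<in> W \<Longrightarrow> local_map u = local_map v \<Longrightarrow> cone_prefix u = [] \<longleftrightarrow> cone_prefix v = []"
  using local_map_C local_map_D Z_D C_not_D by metis

lemma local_map_gcp:
  assumes u: "u \<in> W" and w: "w \<in> words n" and o: "cone_prefix u @ p = cone_prefix (u @ w)"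
  shows "greatest_common_prefix p ((\<lambda>x. local_map u (w @- x)) ` D)"
    and "x \<in> D \<Longrightarrow> local_map u (w @- x) = p @- local_map (u @ w) x"
proof -
  have eq: "h ((u @ w) @- x) = cone_prefix u @- local_map u (w @- x)" if "x \<in> D" for x
    using local_map_eq[OF u, of "w @- x"] that w shift_D by simp
  then have "(\<lambda>x. h ((u @ w) @- x)) ` D = (\<lambda>y. cone_prefix u @- y) ` ((\<lambda>x. local_map u (w @- x)) ` D)"
    by (simp add: image_image)
  then have "greatest_common_prefix (cone_prefix (u @ w)) ((\<lambda>y. cone_prefix u @- y) ` ((\<lambda>x. local_map u (w @- x)) ` D))"
    using cone_prefix_gcp[OF append_WI[OF u w]] by simp
  then show "greatest_common_prefix p ((\<lambda>x. local_map u (w @- x)) ` D)"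
    using greatest_common_prefix_shift o by (metis same_append_eq)
  show "local_map u (w @- x) = p @- local_map (u @ w) x" if "x \<in> D"
    using eq[OF that] local_map_eq[OF append_WI[OF u w] that] by (simp flip: o)
qed

text \<open>The further output is the greatest common prefix of the values of the local map on the
  subcone \<open>w\<close>, so it is read off from that map alone. This makes the transitions of the
  minimal transducer independent of the representing word.\<close>

lemma local_map_append:
  assumes uv: "u \<in> W" "v \<in> W" "local_map u = local_map v" and w: "w \<in> words n"
    and p: "cone_prefix u @ p = cone_prefix (u @ w)" "cone_prefix v @ q = cone_prefix (v @ w)"
  shows "p = q" "local_map (u @ w) = local_map (v @ w)"
proof -
  show pq: "p = q"
    using local_map_gcp(1)[OF uv(1) w p(1)] local_map_gcp(1)[OF uv(2) w p(2)] uv(3) greatest_common_prefix_unique by metis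
  show "local_map (u @ w) = local_map (v @ w)"
  proof
    fix x
    show "local_map (u @ w) x = local_map (v @ w) x"
    proof (cases "x \<in> D")
      case True
      then show ?thesis
        using local_map_gcp(2)[OF uv(1) w p(1) True] local_map_gcp(2)[OF uv(2) w p(2) True] uv(3) pq by simp
    qed (simp add: local_map_def)
  qed
qed

text \<open>Removing greatest common prefixes normalizes: both local maps become the common
  \<open>f\<close> without its own greatest common prefix. The nonempty word \<open>a\<close> is
  part of \<open>cone_prefix u\<close>.\<close>

lemma locrel_loc:
  assumes "u \<in> W" "v \<in> W" "locrel h u v"
  shows "local_map u = local_map v" "cone_prefix u \<noteq> []"
proof -
  obtain a b f where f: "a \<in> W" "b \<in> W" "\<And>x. x \<in> D \<Longrightarrow> h (u @- x) = a @- f x"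
      "\<And>x. x \<in> D \<Longrightarrow> h (v @- x) = b @- f x"
    using assms(3) unfolding locrel_def by metis
  have im: "(\<lambda>x. h (u @- x)) ` D = (\<lambda>y. a @- y) ` (f ` D)" "(\<lambda>x. h (v @- x)) ` D = (\<lambda>y. b @- y) ` (f ` D)"
    using f by (simp_all add: image_image)
  obtain p where p: "cone_prefix u = a @ p" "greatest_common_prefix p (f ` D)"
    using greatest_common_prefix_shift cone_prefix_gcp[OF assms(1)] im by metis
  obtain q where q: "cone_prefix v = b @ q" "greatest_common_prefix q (f ` D)"
    using greatest_common_prefix_shift cone_prefix_gcp[OF assms(2)] im by metis
  have "p = q" using greatest_common_prefix_unique p q by blast
  have "local_map u x = sdrop (length p) (f x) \<and> local_map v x = sdrop (length p) (f x)" if "x \<in> D" for x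
    using that f p q \<open>p = q\<close> by (simp add: local_map_def sdrop_shift)
  then show "local_map u = local_map v" by (auto simp: local_map_def fun_eq_iff restrict_def)
  show "cone_prefix u \<noteq> []" using p f by auto
qed

text \<open>Continuity of \<open>h\<close> at \<open>u @- x\<close> commits arbitrarily much output
  after finitely many letters.\<close>

lemma cone_prefix_unbounded:
  assumes u: "u \<in> W" and x: "x \<in> D"
  shows "\<exists>k. m \<le> length (cone_prefix (u @ stake k x))"
proof -
  have C: "u @- x \<in> C" using u x shift_CI by blast
  obtain k where k: "\<forall>y\<in>C. stake k y = stake k (u @- x) \<longrightarrow> stake m (h y) = stake m (h (u @- x))"
    using homeos_continuous[OF h C] by blast
  let ?w = "u @ stake k x"
  have w: "?w \<in> W" using u x append_WI stake_words by blast
  have "prefix (stake m (h (u @- x))) (cone_prefix ?w)"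
  proof (rule cone_prefix_max[OF w])
    fix z assume z: "z \<in> D"
    have "stake k (stake k x @- z) = stake k x" by (simp add: stake_shift)
    then have "stake k (u @- stake k x @- z) = stake k (u @- x)"
      by (metis diff_le_self min_absorb1 stake_shift take_stake)
    then show "has_prefix (stake m (h (u @- x))) (h (?w @- z))"
      using k shift_CI[OF w z] by (simp add: has_prefix_def)
  qed
  then show ?thesis using prefix_length_le by fastforce
qed

lemma local_map_append_eq:
  assumes uv: "u \<in> W" "v \<in> W" "local_map u = local_map v" and w: "w \<in> words n"
  shows "local_map (u @ w) = local_map (v @ w)"
proof -
  obtain p q where "cone_prefix (u @ w) = cone_prefix u @ p" "cone_prefix (v @ w) = cone_prefix v @ q"
    using prefix_cp[OF uv(1) w] prefix_cp[OF uv(2) w] by (auto simp: prefix_def)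
  then show ?thesis using local_map_append(2)[OF uv w] by metis
qed

text \<open>States are the numbers of local maps; \<open>Suc\<close> frees 0 for the start state,
  which reads from \<open>C\<close> and so has no local map.\<close>

definition st :: "letter list \<Rightarrow> nat" where
  "st u = Suc (to_nat_on (local_map ` W) (local_map u))"

definition state_word :: "nat \<Rightarrow> letter list" where
  "state_word q = (SOME u. u \<in> W \<and> st u = q)"

text \<open>Transitions are computed on a representing word of the state. The output of a letter is
  the increment of \<open>cone_prefix\<close>, obtained by dropping the part already
  written.\<close>

definition min_transducer :: "nat transducer" where
  "min_transducer = \<lparr>Rstates = insert 0 (st ` {u \<in> W. cone_prefix u = []}), Sstates = st ` {u \<in> W. cone_prefix u \<noteq> []},
     start = 0,
     step = (\<lambda>i q. if q = 0 then st [i] else st (state_word q @ [i])),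
     out = (\<lambda>i q. if q = 0 then cone_prefix [i] else drop (length (cone_prefix (state_word q))) (cone_prefix (state_word q @ [i])))\<rparr>"

abbreviation "\<A> \<equiv> min_transducer"

lemma st_neq_0 [simp]: "st u \<noteq> 0" "0 \<noteq> st u" "0 < st u"
  by (auto simp: st_def)

lemma start_A [simp]: "start \<A> = 0"
  by (simp add: min_transducer_def)

section \<open>The transducer of local maps for a synchronizing map\<close>

context
  assumes sm: "sync_map h"
begin

lemma sync_depth:
  obtains k where "\<And>w u v. w \<in> words n \<Longrightarrow> k \<le> length w \<Longrightarrow> u \<in> W \<Longrightarrow> v \<in> W \<Longrightarrow>
    local_map (u @ w) = local_map (v @ w) \<and> cone_prefix (u @ w) \<noteq> []"
proof -
  obtain k where k: "\<And>w u v. w \<in> words n \<Longrightarrow> k \<le> length w \<Longrightarrow> u \<in> W \<Longrightarrow> v \<in> W \<Longrightarrow> locrel h (u @ w) (v @ w)"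
    using sm unfolding sync_map_def by metis
  then show thesis using that[of k] locrel_loc append_WI by metis
qed

text \<open>Past the synchronization depth the local map of a word depends on its last
  \<open>k\<close> letters only, so the word may be replaced by \<open>Dotted 0\<close> followed by
  them; only finitely many short words are left.\<close>

lemma finite_loc: "finite (local_map ` W)"
proof -
  obtain k where k: "\<And>w u v. w \<in> words n \<Longrightarrow> k \<le> length w \<Longrightarrow> u \<in> W \<Longrightarrow> v \<in> W \<Longrightarrow>
    local_map (u @ w) = local_map (v @ w) \<and> cone_prefix (u @ w) \<noteq> []" using sync_depth by metis
  have D0: "[Dotted 0] \<in> W" using r1 by (simp add: Cons_W)
  let ?S = "local_map ` (\<Union>m\<le>k. level m) \<union> (\<lambda>w. local_map ([Dotted 0] @ w)) ` {w \<in> words n. length w = k}"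
  have "local_map u \<in> ?S" if u: "u \<in> W" for u
  proof (cases "length u \<le> k")
    case True
    then have "u \<in> (\<Union>m\<le>k. level m)" using u by (auto simp: level_def)
    then show ?thesis by blast
  next
    case False
    define v w where "v = take (length u - k) u" and "w = drop (length u - k) u"
    have vw: "u = v @ w" "v \<noteq> []" "length w = k" using False by (auto simp: v_def w_def)
    then have "v \<in> W" "w \<in> words n" using u append_W[of v w] by auto
    then have "local_map u = local_map ([Dotted 0] @ w)" using k[of w v "[Dotted 0]"] D0 vw by simp
    then show ?thesis using \<open>w \<in> words n\<close> vw(3) by blast
  qed
  then have "local_map ` W \<subseteq> ?S" by blast
  moreover have "finite ?S" using finite_level finite_words_length by simp
  ultimately show ?thesis by (rule finite_subset)
qed

lemma st_eq_iff: "u \<in> W \<Longrightarrow> v \<in> W \<Longrightarrow> st u = st v \<longleftrightarrow> local_map u = local_map v"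
  using inj_on_to_nat_on[OF countable_finite[OF finite_loc]] by (auto simp: st_def inj_on_def)

lemma state_word:
  assumes "u \<in> W"
  shows "state_word (st u) \<in> W" "local_map (state_word (st u)) = local_map u"
proof -
  have *: "state_word (st u) \<in> W \<and> st (state_word (st u)) = st u"
    unfolding state_word_def by (rule someI[of _ u]) (use assms in simp)
  then show "state_word (st u) \<in> W" by blast
  then show "local_map (state_word (st u)) = local_map u" using * st_eq_iff assms by blast
qed

lemma states_A: "states \<A> = insert 0 (st ` W)"
  by (auto simp: states_def min_transducer_def)

lemma step_A:
  assumes u: "u \<in> W" and i: "i \<in> alphabet n"
  shows "step \<A> i (st u) = st (u @ [i])" "cone_prefix u @ out \<A> i (st u) = cone_prefix (u @ [i])"
proof -
  have w: "[i] \<in> words n" using i by (simp add: Cons_words)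
  let ?v = "state_word (st u)"
  have v: "?v \<in> W" "local_map ?v = local_map u" using state_word u by auto
  have "local_map (?v @ [i]) = local_map (u @ [i])" by (rule local_map_append_eq[OF v(1) u v(2) w])
  then show "step \<A> i (st u) = st (u @ [i])"
    using st_eq_iff append_WI v u w by (simp add: min_transducer_def)
  obtain p q where pq: "cone_prefix (u @ [i]) = cone_prefix u @ p" "cone_prefix (?v @ [i]) = cone_prefix ?v @ q"
    using prefix_cp[OF u w] prefix_cp[OF v(1) w] by (auto simp: prefix_def)
  then have "p = q" using local_map_append(1)[OF u v(1) v(2)[symmetric] w] by metis
  then show "cone_prefix u @ out \<A> i (st u) = cone_prefix (u @ [i])" using pq by (simp add: min_transducer_def)
qed

lemma step_word_A:
  assumes "u \<in> W" "w \<in> words n"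
  shows "step_word \<A> w (st u) = st (u @ w)" "cone_prefix u @ out_word \<A> w (st u) = cone_prefix (u @ w)"
    "readable_word n r \<A> w (st u)"
proof -
  have "step_word \<A> w (st u) = st (u @ w) \<and> cone_prefix u @ out_word \<A> w (st u) = cone_prefix (u @ w) \<and>
    readable_word n r \<A> w (st u)"
    using assms
  proof (induction w arbitrary: u)
    case (Cons i w)
    then have i: "i \<in> alphabet n" "w \<in> words n" and ui: "u @ [i] \<in> W"
      by (auto simp: Cons_words intro!: append_WI)
    have "readable n r \<A> i (st u)" using i Cons.prems by (auto simp: readable_def states_A)
    then show ?case
      using Cons.IH[OF ui i(2)] step_A[OF Cons.prems(1) i(1)] by simp (metis append.assoc)
  qed (auto simp: states_A)
  then show "step_word \<A> w (st u) = st (u @ w)" "cone_prefix u @ out_word \<A> w (st u) = cone_prefix (u @ w)"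
    "readable_word n r \<A> w (st u)" by auto
qed

lemma step_word_start_A:
  assumes "u \<in> W"
  shows "step_word \<A> u 0 = st u" "out_word \<A> u 0 = cone_prefix u" "readable_word n r \<A> u 0"
proof -
  obtain i w where u: "u = i # w" "i \<in> dotted_alphabet r" "w \<in> words n"
    using assms by (auto simp: words_plus_def)
  have i: "[i] \<in> W" using u by (simp add: Cons_W)
  have st0: "step \<A> i 0 = st [i]" "out \<A> i 0 = cone_prefix [i]" by (simp_all add: min_transducer_def)
  have "readable n r \<A> i 0" using u by (simp add: readable_def)
  then show "step_word \<A> u 0 = st u" "out_word \<A> u 0 = cone_prefix u" "readable_word n r \<A> u 0"
    using step_word_A[OF i u(3)] st0 u(1) by simp_all
qed

lemma readable_word_A:
  assumes "readable_word n r \<A> w q" "w \<noteq> []"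
  shows "q = 0 \<and> w \<in> W \<or> (\<exists>u\<in>W. q = st u \<and> w \<in> words n)"
proof -
  have st: "w \<in> words n" if "readable_word n r \<A> w (st u)" "u \<in> W" for w u
    using that
  proof (induction w arbitrary: u)
    case (Cons i w)
    then have i: "i \<in> alphabet n" by (auto simp: readable_def)
    then have "step \<A> i (st u) = st (u @ [i])" "u @ [i] \<in> W"
      using step_A Cons.prems by (auto simp: Cons_words intro!: append_WI)
    then have "w \<in> words n" using Cons.IH[of "u @ [i]"] Cons.prems by simp
    then show ?case using i by (simp add: Cons_words)
  qed simp
  obtain i v where w: "w = i # v" using assms(2) by (cases w) auto
  then have rd: "readable n r \<A> i q" "readable_word n r \<A> v (step \<A> i q)" using assms by auto
  show ?thesis
  proof (cases "q = 0")
    case True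
    then have i: "i \<in> dotted_alphabet r" using rd(1) by (auto simp: readable_def)
    then have "step \<A> i q = st [i]" "[i] \<in> W" using True by (auto simp: min_transducer_def Cons_W)
    then have "v \<in> words n" using st rd(2) by metis
    then show ?thesis using True i w by (simp add: Cons_W)
  next
    case False
    then obtain u where "u \<in> W" "q = st u" using rd(1) by (auto simp: readable_def states_A)
    then show ?thesis using st assms(1) by blast
  qed
qed

lemma readable_A:
  assumes "readable n r \<A> i q"
  shows "q = 0 \<and> [i] \<in> W \<or> (\<exists>u\<in>W. q = st u \<and> i \<in> alphabet n)"
  using assms by (auto simp: readable_def states_A Cons_W)

lemma R_A: "st u \<in> Rstates \<A> \<longleftrightarrow> cone_prefix u = []"
  and S_A: "st u \<in> Sstates \<A> \<longleftrightarrow> cone_prefix u \<noteq> []" if u: "u \<in> W"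
proof -
  have iff: "cone_prefix u = [] \<longleftrightarrow> cone_prefix v = []" if "v \<in> W" "st u = st v" for v
    using local_map_cp_Nil[OF u that(1)] st_eq_iff[OF u that(1)] that(2) by blast
  have "st u \<in> Rstates \<A> \<longleftrightarrow> (\<exists>v\<in>W. cone_prefix v = [] \<and> st u = st v)"
    "st u \<in> Sstates \<A> \<longleftrightarrow> (\<exists>v\<in>W. cone_prefix v \<noteq> [] \<and> st u = st v)"
    by (auto simp: min_transducer_def)
  then show "st u \<in> Rstates \<A> \<longleftrightarrow> cone_prefix u = []" "st u \<in> Sstates \<A> \<longleftrightarrow> cone_prefix u \<noteq> []"
    using iff u by blast+
qed

text \<open>Prefixing \<open>cone_prefix u\<close> turns the outputs from \<open>st u\<close> into
  the words \<open>cone_prefix (u @ stake k x)\<close>, which are prefixes of unbounded length of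
  the one point \<open>h (u @- x)\<close>.\<close>

lemma state_map_A:
  assumes u: "u \<in> W" and x: "x \<in> D"
  shows "state_map \<A> (st u) x = local_map u x"
proof -
  let ?f = "\<lambda>k. cone_prefix (u @ stake k x)"
  have out: "cone_prefix u @ out_word \<A> (stake k x) (st u) = ?f k" for k
    using step_word_A(2)[OF u stake_words[OF x]] .
  have pre: "has_prefix (?f k) (cone_prefix u @- local_map u x)" for k
  proof -
    have "h ((u @ stake k x) @- sdrop k x) = ?f k @- local_map (u @ stake k x) (sdrop k x)"
      using local_map_eq append_WI[OF u stake_words[OF x]] sdrop_DD[OF x] by blast
    then have "h (u @- x) = ?f k @- local_map (u @ stake k x) (sdrop k x)" by (simp add: stake_sdrop)
    then show ?thesis using local_map_eq[OF u x] by (metis has_prefix_shift)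
  qed
  have iff: "has_prefix (?f k) (cone_prefix u @- y) \<longleftrightarrow> has_prefix (out_word \<A> (stake k x) (st u)) y" for k y
    unfolding out[of k, symmetric] by (simp add: has_prefix_iff)
  show ?thesis
    unfolding state_map_def
  proof (rule the_equality)
    show "\<forall>k. has_prefix (out_word \<A> (stake k x) (st u)) (local_map u x)" using pre iff by blast
    fix y assume "\<forall>k. has_prefix (out_word \<A> (stake k x) (st u)) y"
    then have "has_prefix (?f k) (cone_prefix u @- y)" for k using iff by blast
    then have "cone_prefix u @- y = cone_prefix u @- local_map u x"
      using prefix_chain_unique[of ?f] pre cone_prefix_unbounded[OF u x] by blast
    then show "y = local_map u x" by simp
  qed
qed

lemma state_map_start_A:
  assumes x: "x \<in> C"
  shows "state_map \<A> 0 x = h x"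
proof -
  define u z where "u = stake 1 x" and "z = sdrop 1 x"
  have u: "u \<in> W" and z: "z \<in> D" and xu: "x = u @- z"
    using stake_W[OF x, of 1] sdrop_D[OF x, of 1] stake_sdrop[of 1 x] by (simp_all only: u_def z_def zero_less_one)
  have len: "length u = 1" by (simp add: u_def)
  let ?f = "\<lambda>k. cone_prefix (u @ stake k z)"
  have out: "out_word \<A> (stake (Suc k) x) 0 = ?f k" for k
  proof -
    have "stake (Suc k) x = u @ stake k z" using len by (simp only: xu stake_shift) simp
    then show ?thesis using step_word_start_A(2) append_WI[OF u stake_words[OF z]] by metis
  qed
  have pre: "has_prefix (?f k) (h x)" for k
  proof -
    have "h ((u @ stake k z) @- sdrop k z) = ?f k @- local_map (u @ stake k z) (sdrop k z)"
      using local_map_eq append_WI[OF u stake_words[OF z]] sdrop_DD[OF z] by blast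
    then show ?thesis unfolding xu by (simp add: stake_sdrop)
  qed
  have iff: "(\<forall>k. has_prefix (out_word \<A> (stake k x) 0) y) \<longleftrightarrow> (\<forall>k. has_prefix (?f k) y)" for y
  proof
    assume "\<forall>k. has_prefix (out_word \<A> (stake k x) 0) y"
    then show "\<forall>k. has_prefix (?f k) y" using out by metis
  next
    assume f: "\<forall>k. has_prefix (?f k) y"
    show "\<forall>k. has_prefix (out_word \<A> (stake k x) 0) y"
    proof
      fix k
      show "has_prefix (out_word \<A> (stake k x) 0) y"
      proof (cases k)
        case 0
        then show ?thesis by (simp add: has_prefix_def)
      next
        case (Suc j)
        then show ?thesis using f out by metis
      qed
    qed
  qed
  show ?thesis
    unfolding state_map_def iff
    by (rule the_equality) (use pre prefix_chain_unique[of ?f] cone_prefix_unbounded[OF u z] in blast)+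
qed

lemma transducer_A: "transducer n r \<A>"
  unfolding transducer_def
proof (intro conjI allI ballI impI)
  show "finite (Rstates \<A>)"
  proof -
    have "finite (st ` W)"
    proof -
      have "st ` W = (\<lambda>f. Suc (to_nat_on (local_map ` W) f)) ` (local_map ` W)" by (auto simp: st_def)
      then show ?thesis using finite_loc by simp
    qed
    then show ?thesis by (rule finite_subset[rotated, OF finite.insertI[of _ 0]]) (auto simp: min_transducer_def)
  qed
  show "Rstates \<A> \<inter> Sstates \<A> = {}"
  proof (rule equals0I)
    fix q assume q: "q \<in> Rstates \<A> \<inter> Sstates \<A>"
    then obtain v where v: "v \<in> W" "cone_prefix v \<noteq> []" "q = st v" by (auto simp: min_transducer_def)
    then show False using q R_A[OF v(1)] by simp
  qed
  show "start \<A> \<in> Rstates \<A>" by (simp add: min_transducer_def)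
next
  fix q i assume rd: "readable n r \<A> i q"
  consider "q = 0" "[i] \<in> W" | u where "u \<in> W" "q = st u" "i \<in> alphabet n" using readable_A[OF rd] by blast
  then have "(\<exists>v\<in>W. step \<A> i q = st v) \<and> out \<A> i q \<in> words_star n r \<union> words n"
  proof cases
    case 1
    then have "step \<A> i q = st [i]" "out \<A> i q = cone_prefix [i]" by (simp_all add: min_transducer_def)
    then show ?thesis using cone_prefix_W[OF 1(2)] 1(2) by (cases "cone_prefix [i] = []") (auto simp: words_star_def)
  next
    case (2 u)
    have ui: "u @ [i] \<in> W" using 2 by (auto simp: Cons_words intro!: append_WI)
    have o: "cone_prefix u @ out \<A> i q = cone_prefix (u @ [i])" using step_A(2)[OF 2(1,3)] 2(2) by simp
    have "out \<A> i q \<in> words_star n r \<union> words n"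
    proof (cases "cone_prefix u = []")
      case True
      then show ?thesis using o cone_prefix_W[OF ui] by (cases "cone_prefix (u @ [i]) = []") (auto simp: words_star_def)
    next
      case False
      then have "cone_prefix (u @ [i]) \<in> W" using cone_prefix_W[OF ui] o by (metis append_is_Nil_conv)
      then have "out \<A> i q \<in> words n" using append_W[OF False, of "out \<A> i q"] o by simp
      then show ?thesis by blast
    qed
    then show ?thesis using step_A(1)[OF 2(1,3)] 2(2) ui by blast
  qed
  then show "step \<A> i q \<in> states \<A> - {start \<A>}" "out \<A> i q \<in> words_star n r \<union> words n"
    by (auto simp: states_A)
next
  fix q i assume q: "q \<in> Rstates \<A>" and rd: "readable n r \<A> i q"
  have "\<exists>v\<in>W. step \<A> i q = st v \<and> out \<A> i q = cone_prefix v"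
  proof -
    consider "q = 0" "[i] \<in> W" | u where "u \<in> W" "q = st u" "i \<in> alphabet n" using readable_A[OF rd] by blast
    then show ?thesis
    proof cases
      case 1
      then show ?thesis by (intro bexI[of _ "[i]"]) (simp_all add: min_transducer_def)
    next
      case (2 u)
      then have "cone_prefix u = []" using q R_A by simp
      moreover have "u @ [i] \<in> W" using 2 by (auto simp: Cons_words intro!: append_WI)
      ultimately show ?thesis using step_A[OF 2(1,3)] 2(2) by (intro bexI[of _ "u @ [i]"]) simp_all
    qed
  qed
  then obtain v where v: "v \<in> W" "step \<A> i q = st v" "out \<A> i q = cone_prefix v" by blast
  show "out \<A> i q = []" if "step \<A> i q \<in> Rstates \<A>" using that v R_A by simp
  show "out \<A> i q \<in> W" if "step \<A> i q \<in> Sstates \<A>" using that v S_A cone_prefix_W by simp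
next
  fix q i assume q: "q \<in> Sstates \<A>" and rd: "readable n r \<A> i q"
  obtain u where u: "u \<in> W" "q = st u" "cone_prefix u \<noteq> []" using q by (auto simp: min_transducer_def)
  have i: "i \<in> alphabet n" using rd u by (auto simp: readable_def)
  have ui: "u @ [i] \<in> W" using u i by (auto simp: Cons_words intro!: append_WI)
  have o: "cone_prefix u @ out \<A> i q = cone_prefix (u @ [i])" using step_A(2)[OF u(1) i] u(2) by simp
  then have ne: "cone_prefix (u @ [i]) \<noteq> []" using u(3) by (metis append_is_Nil_conv)
  then show "step \<A> i q \<in> Sstates \<A>" using step_A(1)[OF u(1) i] u(2) S_A[OF ui] by simp
  show "out \<A> i q \<in> words n" using cone_prefix_W[OF ui ne] o append_W[OF u(3)] by metis
next
  fix q x m assume q: "q \<in> Sstates \<A>" and x: "x \<in> D"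
  obtain u where u: "u \<in> W" "q = st u" using q by (auto simp: min_transducer_def)
  obtain k where "length (cone_prefix u) + m \<le> length (cone_prefix (u @ stake k x))" using cone_prefix_unbounded[OF u(1) x] by blast
  then have "m \<le> length (out_word \<A> (stake k x) q)"
    using step_word_A(2)[OF u(1) stake_words[OF x], of k] u(2) by (metis add_le_cancel_left length_append)
  then show "\<exists>k. m \<le> length (out_word \<A> (stake k x) q)" by blast
next
  fix q w assume q: "q \<in> Rstates \<A>" and w: "w \<noteq> [] \<and> readable_word n r \<A> w q"
  consider "q = 0" "w \<in> W" | u where "u \<in> W" "q = st u" "w \<in> words n" using readable_word_A w by blast
  then show "step_word \<A> w q \<noteq> q"
  proof cases
    case 1
    then show ?thesis using step_word_start_A(1) by simp
  next
    case (2 u)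
    show ?thesis
    proof
      assume "step_word \<A> w q = q"
      then have eq: "local_map (u @ w) = local_map u"
        using step_word_A(1)[OF 2(1,3)] 2 st_eq_iff append_WI by metis
      have ws: "concat (replicate j w) \<in> words n" for j using 2(3) by (induction j) (auto simp: append_words)
      \<comment> \<open>A cycle \<open>w\<close> at a state of \<open>Rstates\<close> could be
        repeated without changing the local map, hence without any output; but \<open>k\<close>
        repetitions reach the synchronization depth, where output is committed.\<close>
      have iter: "local_map (u @ concat (replicate j w)) = local_map u" for j
      proof (induction j)
        case (Suc j)
        have "local_map ((u @ w) @ concat (replicate j w)) = local_map (u @ concat (replicate j w))"
          by (rule local_map_append_eq[OF append_WI[OF 2(1,3)] 2(1) eq ws])
        then show ?case using Suc by simp
      qed simp
      obtain k where k: "\<And>w u v. w \<in> words n \<Longrightarrow> k \<le> length w \<Longrightarrow> u \<in> W \<Longrightarrow> v \<in> W \<Longrightarrow>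
        local_map (u @ w) = local_map (v @ w) \<and> cone_prefix (u @ w) \<noteq> []" using sync_depth by metis
      have "k * 1 \<le> k * length w" using w by (intro mult_le_mono2) (simp add: Suc_leI)
      then have "k \<le> length (concat (replicate k w))"
        by (simp add: length_concat sum_list_replicate map_replicate)
      then have "cone_prefix (u @ concat (replicate k w)) \<noteq> []" using k[OF ws _ 2(1) 2(1)] by blast
      moreover have "cone_prefix u = []" using q 2 R_A by simp
      ultimately show False using local_map_cp_Nil[OF append_WI[OF 2(1) ws] 2(1) iter] by blast
    qed
  qed
qed

lemma minimal_A: "minimal n r \<A>"
  unfolding minimal_def
proof (intro conjI ballI impI allI)
  show "transducer n r \<A>" by (rule transducer_A)
  fix q assume q: "q \<in> states \<A>"
  show "\<exists>w. readable_word n r \<A> w (start \<A>) \<and> step_word \<A> w (start \<A>) = q"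
  proof (cases "q = 0")
    case True
    then show ?thesis by (intro exI[of _ "[]"]) (simp add: states_A)
  next
    case False
    then obtain u where "u \<in> W" "q = st u" using q by (auto simp: states_A)
    then show ?thesis using step_word_start_A by (intro exI[of _ u]) simp
  qed
next
  fix p q assume pq: "p \<in> states \<A>" "q \<in> states \<A>" "p \<noteq> q"
  have CD: "C \<noteq> D" using C_nonempty C_not_D by blast
  show "\<not> same_state_map n r \<A> p q"
  proof
    assume same: "same_state_map n r \<A> p q"
    then have "input_space n r \<A> p = input_space n r \<A> q" by (simp add: same_state_map_def)
    then have "p \<noteq> 0" "q \<noteq> 0" using pq(3) CD by (auto simp: input_space_def split: if_splits)
    then obtain u v where u: "u \<in> W" "p = st u" and v: "v \<in> W" "q = st v"
      using pq by (auto simp: states_A)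
    have "local_map u x = local_map v x" for x
    proof (cases "x \<in> D")
      case True
      then have "state_map \<A> p x = state_map \<A> q x"
        using same u(2) by (simp add: same_state_map_def input_space_def)
      then show ?thesis using state_map_A True u v by simp
    qed (simp add: local_map_def)
    then have "local_map u = local_map v" by blast
    then show False using pq(3) u v by (simp add: st_def)
  qed
next
  fix q i assume "q \<in> states \<A>" and rd: "readable n r \<A> i q"
  consider "q = 0" "[i] \<in> W" | u where "u \<in> W" "q = st u" "i \<in> alphabet n" using readable_A[OF rd] by blast
  then show "greatest_common_prefix (out \<A> i q) {state_map \<A> q (i ## x) |x. x \<in> D}"
  proof cases
    case 1
    have "state_map \<A> q (i ## x) = h ([i] @- x)" if "x \<in> D" for x
      using state_map_start_A[of "i ## x"] shift_CI[OF 1(2) that] 1(1) by simp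
    then have "{state_map \<A> q (i ## x) |x. x \<in> D} = (\<lambda>x. h ([i] @- x)) ` D" by force
    then show ?thesis using cone_prefix_gcp[OF 1(2)] 1(1) by (simp add: min_transducer_def)
  next
    case (2 u)
    have w: "[i] \<in> words n" using 2 by (simp add: Cons_words)
    have "state_map \<A> q (i ## x) = local_map u ([i] @- x)" if "x \<in> D" for x
      using state_map_A[OF 2(1), of "i ## x"] 2 that by (simp add: Cons_D)
    then have "{state_map \<A> q (i ## x) |x. x \<in> D} = (\<lambda>x. local_map u ([i] @- x)) ` D" by force
    then show ?thesis using local_map_gcp(1)[OF 2(1) w] step_A(2)[OF 2(1,3)] 2(2) by simp
  qed
qed

lemma synchronizing_A: "synchronizing n r \<A>"
proof -
  obtain k where k: "\<And>w u v. w \<in> words n \<Longrightarrow> k \<le> length w \<Longrightarrow> u \<in> W \<Longrightarrow> v \<in> W \<Longrightarrow>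
    local_map (u @ w) = local_map (v @ w) \<and> cone_prefix (u @ w) \<noteq> []" using sync_depth by metis
  \<comment> \<open>\<open>Suc k\<close> keeps the word nonempty, so its first letter, dotted or
    plain, tells whether it is read from the start state or from the others.\<close>
  have "step_word \<A> w p = step_word \<A> w q"
    if w: "length w = Suc k" and p: "readable_word n r \<A> w p" and q: "readable_word n r \<A> w q" for w p q
  proof -
    have "w \<noteq> []" using w by auto
    then consider "p = 0" "q = 0" | u v where "u \<in> W" "v \<in> W" "p = st u" "q = st v" "w \<in> words n"
      using readable_word_A[OF p] readable_word_A[OF q] words_not_W by blast
    then show ?thesis
    proof cases
      case (2 u v)
      then have "local_map (u @ w) = local_map (v @ w)" using k[of w u v] w by simp
      then show ?thesis using step_word_A(1) 2 st_eq_iff append_WI by metis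
    qed simp
  qed
  then show ?thesis unfolding synchronizing_def by blast
qed

lemma sync_map_transducer:
  "\<exists>A :: nat transducer. minimal n r A \<and> represents n r A h \<and> finite (states A) \<and> synchronizing n r A"
proof (intro exI[of _ \<A>] conjI minimal_A synchronizing_A)
  show "represents n r \<A> h" by (simp add: represents_def state_map_start_A)
  have "st ` W = (\<lambda>f. Suc (to_nat_on (local_map ` W) f)) ` (local_map ` W)" by (auto simp: st_def)
  then show "finite (states \<A>)" using finite_loc by (simp add: states_A)
qed

end

end

text \<open>The transducer of local maps is finite, minimal and synchronizing at once, which serves
  \<open>rational_homeos\<close> and \<open>sync_homeo\<close> together.\<close>

lemma TB_elements_iff:
  "h \<in> TB_elements n r \<longleftrightarrow> h \<in> H \<and> sync_map h \<and> sync_map (homeo_inv n r h) \<and> preserves_circle_eq n r h"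
proof
  assume "h \<in> TB_elements n r"
  then show "h \<in> H \<and> sync_map h \<and> sync_map (homeo_inv n r h) \<and> preserves_circle_eq n r h"
    unfolding TB_elements_def rational_homeos_def bisync_homeo_def using sync_homeo_sync_map by blast
next
  assume "h \<in> H \<and> sync_map h \<and> sync_map (homeo_inv n r h) \<and> preserves_circle_eq n r h"
  then show "h \<in> TB_elements n r"
    unfolding TB_elements_def rational_homeos_def bisync_homeo_def sync_homeo_def
    using sync_map_transducer[of h] sync_map_transducer[OF homeo_inv_homeos[of h]] by blast
qed

section \<open>The normalizer of \<open>T\<close> and its automorphisms\<close>

definition conjugate :: "(letter stream \<Rightarrow> letter stream) \<Rightarrow> (letter stream \<Rightarrow> letter stream) \<Rightarrow> letter stream \<Rightarrow> letter stream" where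
  "conjugate h g = compose C h (compose C g (homeo_inv n r h))"

lemma homeo_inv_closed: "h \<in> H \<Longrightarrow> x \<in> C \<Longrightarrow> homeo_inv n r h x \<in> C"
  using homeos_closed homeo_inv_homeos by blast

lemma conjugate_apply: "h \<in> H \<Longrightarrow> x \<in> C \<Longrightarrow> conjugate h g (h x) = h (g x)"
  using homeos_closed homeo_inv_left by (simp add: conjugate_def compose_def)

lemma conjugate_homeos: "h \<in> H \<Longrightarrow> g \<in> H \<Longrightarrow> conjugate h g \<in> H"
  unfolding conjugate_def by (intro compose_homeos homeo_inv_homeos)

lemma conjugate_eqI:
  assumes h: "h \<in> H" and g: "g \<in> H" "g' \<in> H"
    and eq: "\<And>x. x \<in> C \<Longrightarrow> h (g x) = g' (h x)"
  shows "conjugate h g = g'"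
proof (rule homeos_eqI[OF conjugate_homeos[OF h g(1)] g(2)])
  fix y assume "y \<in> C"
  then obtain x where "x \<in> C" "y = h x" using homeos_surj[OF h] by blast
  then show "conjugate h g y = g' y" using conjugate_apply[OF h] eq by simp
qed

lemma homeo_inv_involutive:
  assumes h: "h \<in> H"
  shows "homeo_inv n r (homeo_inv n r h) = h"
proof (rule homeos_eqI[OF homeo_inv_homeos[OF homeo_inv_homeos[OF h]] h])
  fix x assume x: "x \<in> C"
  have "homeo_inv n r (homeo_inv n r h) (homeo_inv n r h (h x)) = h x"
    using homeo_inv_left[OF homeo_inv_homeos[OF h]] homeos_closed[OF h x] by blast
  then show "homeo_inv n r (homeo_inv n r h) x = h x" using homeo_inv_left[OF h x] by simp
qed

text \<open>The two inclusions between \<open>T\<close> and its conjugate by \<open>h\<close>,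
  written as intertwining relations so that no inverse of \<open>h\<close> occurs.\<close>

definition T_normalizer :: "(letter stream \<Rightarrow> letter stream) set" where
  "T_normalizer = {h \<in> H. preserves_circle_eq n r h \<and>
     (\<forall>g\<in>T. \<exists>g'\<in>T. \<forall>x\<in>C. h (g x) = g' (h x)) \<and>
     (\<forall>g\<in>T. \<exists>g'\<in>T. \<forall>x\<in>C. h (g' x) = g (h x))}"

lemma T_normalizerD:
  assumes "h \<in> T_normalizer"
  shows "h \<in> H" "preserves_circle_eq n r h"
    "\<And>g. g \<in> T \<Longrightarrow> \<exists>g'\<in>T. \<forall>x\<in>C. h (g x) = g' (h x)"
    "\<And>g. g \<in> T \<Longrightarrow> \<exists>g'\<in>T. \<forall>x\<in>C. h (g' x) = g (h x)"
  using assms unfolding T_normalizer_def by blast+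

lemma T_closed: "g \<in> T \<Longrightarrow> x \<in> C \<Longrightarrow> g x \<in> C"
  using T_homeos homeos_closed by blast

lemma T_normalizer_inv:
  assumes "h \<in> T_normalizer"
  shows "homeo_inv n r h \<in> T_normalizer"
proof -
  note h = T_normalizerD[OF assms]
  let ?k = "homeo_inv n r h"
  have pre: "\<exists>x\<in>C. y = h x \<and> ?k y = x" if "y \<in> C" for y
    using homeo_inv_right[OF h(1) that] homeo_inv_closed[OF h(1) that] by metis
  have "\<exists>g'\<in>T. \<forall>y\<in>C. ?k (g y) = g' (?k y)" if g: "g \<in> T" for g
  proof -
    obtain g' where g': "g' \<in> T" "\<forall>x\<in>C. h (g' x) = g (h x)" using h(4)[OF g] by blast
    have "?k (g y) = g' (?k y)" if "y \<in> C" for y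
      using pre[OF that] g' homeo_inv_left[OF h(1) T_closed[OF g'(1)]] by metis
    then show ?thesis using g' by blast
  qed
  moreover have "\<exists>g'\<in>T. \<forall>y\<in>C. ?k (g' y) = g (?k y)" if g: "g \<in> T" for g
  proof -
    obtain g' where g': "g' \<in> T" "\<forall>x\<in>C. h (g x) = g' (h x)" using h(3)[OF g] by blast
    have "?k (g' y) = g (?k y)" if "y \<in> C" for y
      using pre[OF that] g' homeo_inv_left[OF h(1) T_closed[OF g]] by metis
    then show ?thesis using g' by blast
  qed
  ultimately show ?thesis
    unfolding T_normalizer_def using homeo_inv_homeos preserves_circle_eq_inv h(1,2) by simp
qed

lemma T_normalizer_compose:
  assumes "h \<in> T_normalizer" "k \<in> T_normalizer"
  shows "compose C h k \<in> T_normalizer"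
proof -
  note h = T_normalizerD[OF assms(1)] and k = T_normalizerD[OF assms(2)]
  have "\<exists>g'\<in>T. \<forall>x\<in>C. compose C h k (g x) = g' (compose C h k x)" if g: "g \<in> T" for g
  proof -
    obtain g1 where g1: "g1 \<in> T" "\<forall>x\<in>C. k (g x) = g1 (k x)" using k(3)[OF g] by blast
    obtain g2 where g2: "g2 \<in> T" "\<forall>x\<in>C. h (g1 x) = g2 (h x)" using h(3)[OF g1(1)] by blast
    show ?thesis using g1 g2 T_closed[OF g] homeos_closed[OF k(1)]
      by (intro bexI[of _ g2]) (auto simp: compose_def)
  qed
  moreover have "\<exists>g'\<in>T. \<forall>x\<in>C. compose C h k (g' x) = g (compose C h k x)" if g: "g \<in> T" for g
  proof -
    obtain g1 where g1: "g1 \<in> T" "\<forall>x\<in>C. h (g1 x) = g (h x)" using h(4)[OF g] by blast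
    obtain g2 where g2: "g2 \<in> T" "\<forall>x\<in>C. k (g2 x) = g1 (k x)" using k(4)[OF g1(1)] by blast
    show ?thesis using g1 g2 T_closed[OF g2(1)] homeos_closed[OF k(1)]
      by (intro bexI[of _ g2]) (auto simp: compose_def)
  qed
  ultimately show ?thesis
    unfolding T_normalizer_def using compose_homeos preserves_circle_eq_compose h(1,2) k(1,2) by simp
qed

lemma id_T_normalizer: "(\<lambda>x\<in>C. x) \<in> T_normalizer"
proof -
  have "preserves_circle_eq n r (\<lambda>x\<in>C. x)" using id_T by (simp add: T_elements_iff)
  then show ?thesis
    unfolding T_normalizer_def using id_homeos T_closed by auto
qed

text \<open>The depth may depend on the pair of words. In this weak form the relation can be chained
  along elements of \<open>T\<close>; uniformity is restored at the end from finitely many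
  pairs.\<close>

definition eventually_locrel :: "(letter stream \<Rightarrow> letter stream) \<Rightarrow> letter list \<Rightarrow> letter list \<Rightarrow> bool" where
  "eventually_locrel h u v \<longleftrightarrow> (\<exists>k. \<forall>w\<in>words n. k \<le> length w \<longrightarrow> locrel h (u @ w) (v @ w))"

lemma locrel_sym: "locrel h u v \<Longrightarrow> locrel h v u"
  unfolding locrel_def by blast

text \<open>The two descriptions of \<open>h\<close> on the cone of \<open>v\<close> have comparable
  output prefixes; the surplus \<open>s\<close> is appended to the output prefix of \<open>w\<close>
  or of \<open>u\<close>.\<close>

lemma locrel_trans:
  assumes "locrel h u v" "locrel h v w"
  shows "locrel h u w"
proof -
  obtain a b f where f: "a \<in> W" "b \<in> W" "\<And>x. x \<in> D \<Longrightarrow> h (u @- x) = a @- f x \<and> h (v @- x) = b @- f x"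
    using assms(1) unfolding locrel_def by metis
  obtain a' b' f' where f': "a' \<in> W" "b' \<in> W" "\<And>x. x \<in> D \<Longrightarrow> h (v @- x) = a' @- f' x \<and> h (w @- x) = b' @- f' x"
    using assms(2) unfolding locrel_def by metis
  have eq: "b @- f x = a' @- f' x" if "x \<in> D" for x using f(3)[OF that] f'(3)[OF that] by metis
  consider s where "b = a' @ s" | s where "a' = b @ s"
    using shift_eqD[OF eq[OF Z_D]] unfolding prefix_def by metis
  then show ?thesis
  proof cases
    case (1 s)
    then have "s \<in> words n" using f(2) f'(1) by (metis append_W Nil_W)
    then have "b' @ s \<in> W" using f'(2) append_WI by blast
    moreover have "f' x = s @- f x" if "x \<in> D" for x using eq[OF that] 1 by simp
    then have "\<forall>x\<in>D. h (u @- x) = a @- f x \<and> h (w @- x) = (b' @ s) @- f x"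
      using f(3) f'(3) by simp
    ultimately show ?thesis unfolding locrel_def using f(1) by blast
  next
    case (2 s)
    then have "s \<in> words n" using f(2) f'(1) by (metis append_W Nil_W)
    then have "a @ s \<in> W" using f(1) append_WI by blast
    moreover have "f x = s @- f' x" if "x \<in> D" for x using eq[OF that] 2 by simp
    then have "\<forall>x\<in>D. h (u @- x) = (a @ s) @- f' x \<and> h (w @- x) = b' @- f' x"
      using f(3) f'(3) by simp
    ultimately show ?thesis unfolding locrel_def using f'(2) by blast
  qed
qed

lemma eventually_locrel_sym: "eventually_locrel h u v \<Longrightarrow> eventually_locrel h v u"
  unfolding eventually_locrel_def using locrel_sym by blast

lemma eventually_locrel_trans:
  assumes "eventually_locrel h u v" "eventually_locrel h v w"
  shows "eventually_locrel h u w"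
proof -
  obtain k l where k: "\<And>s. s \<in> words n \<Longrightarrow> k \<le> length s \<Longrightarrow> locrel h (u @ s) (v @ s)"
    and l: "\<And>s. s \<in> words n \<Longrightarrow> l \<le> length s \<Longrightarrow> locrel h (v @ s) (w @ s)"
    using assms unfolding eventually_locrel_def by metis
  have "locrel h (u @ s) (w @ s)" if "s \<in> words n" "k + l \<le> length s" for s
    using locrel_trans[OF k[OF that(1)] l[OF that(1)]] that(2) by simp
  then show ?thesis unfolding eventually_locrel_def by blast
qed

text \<open>Deep enough inside the cone of \<open>u\<close>, \<open>h\<close> has written the whole
  word \<open>a\<close> that \<open>t\<close> replaces near the image point, so on the matching cone
  below \<open>v\<close> the output is the same with \<open>a\<close> replaced by \<open>b\<close>.
  Compactness makes the depth uniform.\<close>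

lemma eventually_locrel_transport:
  assumes h: "h \<in> H" and t: "local_prefix_map t" and uv: "u \<in> W" "v \<in> W"
    and eq: "\<And>x. x \<in> D \<Longrightarrow> h (v @- x) = t (h (u @- x))"
  shows "eventually_locrel h u v"
proof -
  \<comment> \<open>Vacuous outside the cone of \<open>u\<close>, so that
    \<open>uniform_depth\<close> applies to the whole space. The length condition keeps
    \<open>P\<close> monotone: shorter words would satisfy the implication for free.\<close>
  define P where "P w \<longleftrightarrow> length u \<le> length w \<and> (prefix u w \<longrightarrow> locrel h w (v @ drop (length u) w))" for w
  have u0: "0 < length u" using uv(1) by (cases u) auto
  have mono: "P (stake m x)" if x: "x \<in> C" and P: "P (stake k x)" and km: "k \<le> m" for x k m
  proof -
    let ?s = "stake (m - k) (sdrop k x)"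
    have uk: "length u \<le> k" using P by (simp add: P_def)
    have "0 < k" using uk u0 by linarith
    then have s: "?s \<in> words n" using stake_words[OF sdrop_D[OF x]] by blast
    have eq: "stake m x = stake k x @ ?s" using km by simp
    have "locrel h (stake m x) (v @ drop (length u) (stake m x))" if "prefix u (stake m x)"
    proof -
      have "prefix u (stake k x)" using that uk by (simp add: prefix_stake)
      then have "locrel h (stake k x) (v @ drop (length u) (stake k x))" using P by (simp add: P_def)
      then have "locrel h (stake k x @ ?s) ((v @ drop (length u) (stake k x)) @ ?s)"
        using s by (rule locrel_append)
      moreover have "(v @ drop (length u) (stake k x)) @ ?s = v @ drop (length u) (stake k x @ ?s)"
        using uk by (simp del: stake_add)
      ultimately show ?thesis unfolding eq by metis
    qed
    then show ?thesis unfolding P_def using uk km by simp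
  qed
  have "\<exists>m. \<forall>x\<in>C. P (stake m x)"
  proof (rule uniform_depth[where P = P, OF mono])
    fix x assume x: "x \<in> C"
    show "\<exists>m. P (stake m x)"
    proof (cases "has_prefix u x")
      case False
      then have "P (stake (length u) x)" by (simp add: P_def prefix_stake)
      then show ?thesis by blast
    next
      case True
      then obtain x0 where x0: "x0 \<in> D" "x = u @- x0" using C_has_prefix[OF x uv(1)] by blast
      obtain a b where ab: "a \<in> W" "b \<in> W" "has_prefix a (h x)" "\<And>z. z \<in> D \<Longrightarrow> t (a @- z) = b @- z"
        using t homeos_closed[OF h x] unfolding local_prefix_map_def by metis
      obtain k where k: "\<forall>y\<in>C. stake k y = stake k x \<longrightarrow> stake (length a) (h y) = stake (length a) (h x)"
        using homeos_continuous[OF h x] by blast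
      let ?s = "stake k x0"
      have s: "?s \<in> words n" using stake_words x0 by blast
      have us: "u @ ?s \<in> W" using append_WI[OF uv(1) s] .
      have "\<exists>z'\<in>D. h ((u @ ?s) @- z) = a @- z'" if z: "z \<in> D" for z
      proof -
        let ?y = "(u @ ?s) @- z"
        have "stake k ?y = stake k x"
          unfolding x0(2) shift_append by (rule stake_shift_cong) (simp add: stake_shift)
        then have "has_prefix a (h ?y)"
          using k shift_CI[OF us z] ab(3) by (simp add: has_prefix_def)
        then show ?thesis using C_has_prefix homeos_closed[OF h] shift_CI[OF us z] ab(1) by blast
      qed
      then obtain f where f: "\<And>z. z \<in> D \<Longrightarrow> f z \<in> D \<and> h ((u @ ?s) @- z) = a @- f z" by metis
      have "h ((v @ ?s) @- z) = b @- f z" if z: "z \<in> D" for z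
      proof -
        have "?s @- z \<in> D" using s z shift_D by blast
        then have "h (v @- ?s @- z) = t (h (u @- ?s @- z))" by (rule eq)
        then show ?thesis using f[OF z] ab(4) by simp
      qed
      then have "locrel h (u @ ?s) (v @ ?s)" unfolding locrel_def using f ab(1,2) by blast
      moreover have "stake (length u + k) x = u @ ?s" using x0(2) by (simp add: stake_shift)
      ultimately have "P (stake (length u + k) x)" by (simp add: P_def)
      then show ?thesis by blast
    qed
  qed
  then obtain m where m: "\<And>x. x \<in> C \<Longrightarrow> P (stake m x)" by blast
  have "locrel h (u @ w) (v @ w)" if w: "w \<in> words n" "m \<le> length w" for w
  proof -
    have C: "(u @ w) @- Z \<in> C" using append_WI[OF uv(1) w(1)] Z_D shift_CI by blast
    then have "P (stake (length (u @ w)) ((u @ w) @- Z))" using mono[OF C m[OF C]] w(2) by simp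
    moreover have "stake (length (u @ w)) ((u @ w) @- Z) = u @ w" by (subst stake_shift) simp
    ultimately show ?thesis by (simp add: P_def)
  qed
  then show ?thesis unfolding eventually_locrel_def by blast
qed

lemma uniform_bound:
  fixes Q :: "'b \<Rightarrow> nat \<Rightarrow> bool"
  assumes "finite A" "\<And>a. a \<in> A \<Longrightarrow> \<exists>k. \<forall>l\<ge>k. Q a l"
  obtains k where "\<And>a l. a \<in> A \<Longrightarrow> k \<le> l \<Longrightarrow> Q a l"
proof -
  obtain \<kappa> where \<kappa>: "\<And>a l. a \<in> A \<Longrightarrow> \<kappa> a \<le> l \<Longrightarrow> Q a l" using assms(2) by metis
  have "\<kappa> a \<le> sum \<kappa> A" if "a \<in> A" for a using assms(1) that by (rule member_le_sum[rotated 2]) auto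
  then show thesis using that[of "sum \<kappa> A"] \<kappa> order_trans by metis
qed

text \<open>An element of \<open>T\<close> replacing \<open>u\<close> by \<open>v\<close> relates
  the two cones, by transport through its conjugate. Elements on adjacent cones relate
  \<open>u\<close> to \<open>u0\<close>, rotations relate neighbours of equal length, so the fixed
  word \<open>?\<nu>\<close> is related to its children and to every word of length two. These
  finitely many pairs have common depths \<open>k0\<close> and \<open>k1\<close>, and arbitrary
  words are reduced to \<open>?\<nu>\<close> letter by letter.\<close>

lemma T_normalizer_sync:
  assumes "h \<in> T_normalizer"
  shows "sync_map h"
proof -
  note h = T_normalizerD[OF assms]
  let ?E = "eventually_locrel h"
  have E0: "?E u v" if g: "g \<in> T" and uv: "u \<in> W" "v \<in> W"
    and eq: "\<And>x. x \<in> D \<Longrightarrow> g (u @- x) = v @- x" for g u v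
  proof -
    obtain t where t: "t \<in> T" "\<forall>x\<in>C. h (g x) = t (h x)" using h(3)[OF g] by blast
    show ?thesis
    proof (rule eventually_locrel_transport[OF h(1) _ uv])
      show "local_prefix_map t" using t(1) by (simp add: T_elements_iff)
      show "h (v @- x) = t (h (u @- x))" if "x \<in> D" for x
        using t(2) eq[OF that] shift_CI[OF uv(1) that] by metis
    qed
  qed
  have D0: "[Dotted 0] \<in> W" using r1 by (simp add: Cons_W)
  let ?\<nu> = "[Dotted 0, Plain 0]"
  have \<nu>: "?\<nu> \<in> W" using r1 n2 by (simp add: Cons_W Cons_words)
  \<comment> \<open>Length at least two: for \<open>r = 1\<close> the cone of
    \<open>[Dotted 0]\<close> is the whole space and has no distinct neighbour.\<close>
  have E1: "?E u (u @ [Plain 0])" if u: "u \<in> W" "2 \<le> length u" for u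
  proof -
    obtain y where y: "nxt (u @- M) y" using nxt_exists u by blast
    have yC: "y \<in> C" using nxt_C(2)[OF y] .
    define q where "q = stake (length u) y"
    have "0 < length u" using u(2) by linarith
    then have lev: "u \<in> level (length u)" "q \<in> level (length u)"
      using u stake_W[OF yC] by (auto simp: level_def q_def)
    have qW: "q \<in> W" using lev(2) by (simp add: level_def)
    have qy: "has_prefix q y" by (simp add: q_def)
    \<comment> \<open>If the successor of the right end of \<open>u\<close> stayed in the cone of
      \<open>u\<close>, \<open>nxt_same_cone\<close> would carry the pair to the cone of
      \<open>?\<nu>\<close>, whose right end is known to be followed by a point of the sibling
      cone.\<close>
    have uq: "u \<noteq> q"
    proof
      assume "u = q"
      then obtain y' where y': "y = u @- y'" using qy by (auto simp: has_prefix_iff)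
      have "nxt (?\<nu> @- M) (?\<nu> @- y')" using nxt_same_cone[OF y[unfolded y'] u(1) \<nu>] u(2) by auto
      moreover have "nxt (?\<nu> @- M) ([Dotted 0, Plain (Suc 0)] @- Z)"
        using sibling_nxt[OF D0 Suc0_lt_n] by simp
      ultimately have "?\<nu> @- y' = [Dotted 0, Plain (Suc 0)] @- Z" using nxt_right_unique by blast
      then show False by simp
    qed
    then have "\<not> has_prefix q (u @- M)"
      using lev by (auto simp: has_prefix_iff level_def shift_eq_same_length)
    then have yq: "y = q @- Z" using nxt_enter_cone[OF y qW qy] by blast
    have "0 < length u" using u(2) by linarith
    then obtain g where g: "g \<in> T" "\<And>z. z \<in> D \<Longrightarrow> g (u @- z) = u @- Plain 0 ## z"
      using adjacent_element[OF level_antichain lev uq y[unfolded yq]] by metis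
    show ?thesis
    proof (rule E0[OF g(1) u(1)])
      show "u @ [Plain 0] \<in> W" using u(1) n2 by (intro append_WI) (auto simp: Cons_words)
      show "g (u @- x) = (u @ [Plain 0]) @- x" if "x \<in> D" for x using g(2)[OF that] by simp
    qed
  qed
  have rot: "?E u v" if uv: "u \<in> level m" "v \<in> level m" and nx: "nxt (u @- M) (v @- Z)" for u v m
  proof -
    have "0 < m" using uv(1) by (cases u) (auto simp: level_def)
    then obtain g where "g \<in> T"
      "\<And>u u' z. u \<in> level m \<Longrightarrow> u' \<in> level m \<Longrightarrow> nxt (u @- M) (u' @- Z) \<Longrightarrow> z \<in> D \<Longrightarrow> g (u @- z) = u' @- z"
      using rotation[OF level_antichain] by metis
    then show ?thesis using E0[of g u v] uv nx by (simp add: level_def)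
  qed
  have W1: "u @ [Plain c] \<in> W" if "u \<in> W" "c < n" for u c
    using that by (intro append_WI) (auto simp: Cons_words)
  have E2: "?E (u @ [Plain c]) (u @ [Plain (Suc c)])" if "u \<in> W" "Suc c < n" for u c
    using rot[of _ "Suc (length u)"] sibling_nxt[OF that] W1[OF that(1)] that(2) by (simp add: level_def)
  have E3: "?E (u @ [Plain 0]) (u @ [Plain c])" if u: "u \<in> W" and "c < n" for u c
    using that(2)
  proof (induction c)
    case 0
    \<comment> \<open>Reflexivity is not automatic, as \<open>locrel\<close> demands written output;
      it comes from going to the sibling and back.\<close>
    show ?case
      using E2[OF u Suc0_lt_n] eventually_locrel_sym eventually_locrel_trans by blast
  next
    case (Suc c)
    then show ?case using E2[OF u Suc.prems] eventually_locrel_trans by simp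
  qed
  have E4: "?E ?\<nu> [Dotted a, Plain c]" if "a < r" "c < n" for a c
    using that
  proof (induction a arbitrary: c)
    case 0
    then show ?case using E3[OF D0, of c] by simp
  next
    case (Suc a)
    let ?N = "n - 1"
    have W: "[Dotted a] \<in> W" "[Dotted (Suc a)] \<in> W" using Suc.prems by (auto simp: Cons_W)
    have lev: "[Dotted a, Plain ?N] \<in> level 2" "[Dotted (Suc a), Plain 0] \<in> level 2"
      using W1[OF W(1), of ?N] W1[OF W(2), of 0] n2 by (auto simp: level_def)
    have "[] @- Dotted a ## M \<in> C" "[] @- Dotted (Suc a) ## Z \<in> C"
      using Suc.prems M_D Z_D by (auto simp: Cons_C)
    then have "nxt ([] @- Dotted a ## M) ([] @- Dotted (Suc a) ## Z)" by (intro nxt_fork) auto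
    then have "nxt ([Dotted a, Plain ?N] @- M) ([Dotted (Suc a), Plain 0] @- Z)"
      using M_unfold Z_unfold by simp
    then have "?E [Dotted a, Plain ?N] [Dotted (Suc a), Plain 0]" by (rule rot[OF lev])
    moreover have "?E ?\<nu> [Dotted a, Plain ?N]" using Suc.IH[of ?N] Suc.prems n2 by simp
    moreover have "?E [Dotted (Suc a), Plain 0] [Dotted (Suc a), Plain c]"
      using E3[OF W(2) Suc.prems(2)] by simp
    ultimately show ?case using eventually_locrel_trans by blast
  qed
  have E5: "?E ?\<nu> (?\<nu> @ [Plain c])" if "c < n" for c
    using E1[OF \<nu>] E3[OF \<nu> that] eventually_locrel_trans by simp
  obtain k0 where k0: "\<And>c l. c \<in> {..<n} \<Longrightarrow> k0 \<le> l \<Longrightarrow>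
      \<forall>w\<in>words n. length w = l \<longrightarrow> locrel h (?\<nu> @ w) ((?\<nu> @ [Plain c]) @ w)"
  proof (rule uniform_bound[of "{..<n}" "\<lambda>c l. \<forall>w\<in>words n. length w = l \<longrightarrow> locrel h (?\<nu> @ w) ((?\<nu> @ [Plain c]) @ w)"])
    show "\<exists>k. \<forall>l\<ge>k. \<forall>w\<in>words n. length w = l \<longrightarrow> locrel h (?\<nu> @ w) ((?\<nu> @ [Plain c]) @ w)"
      if "c \<in> {..<n}" for c
      using E5[of c] that unfolding eventually_locrel_def by blast
  qed (simp, rule that, blast)
  have lev2: "\<exists>a c. a < r \<and> c < n \<and> u = [Dotted a, Plain c]" if u: "u \<in> level 2" for u
  proof -
    obtain x y where xy: "u = [x, y]" using u by (auto simp: level_def length_Suc_conv numeral_2_eq_2)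
    then show ?thesis using u by (auto simp: level_def Cons_W Cons_words)
  qed
  obtain k1 where k1: "\<And>u l. u \<in> level 2 \<Longrightarrow> k1 \<le> l \<Longrightarrow>
      \<forall>w\<in>words n. length w = l \<longrightarrow> locrel h (?\<nu> @ w) (u @ w)"
  proof (rule uniform_bound[of "level 2" "\<lambda>u l. \<forall>w\<in>words n. length w = l \<longrightarrow> locrel h (?\<nu> @ w) (u @ w)"])
    show "\<exists>k. \<forall>l\<ge>k. \<forall>w\<in>words n. length w = l \<longrightarrow> locrel h (?\<nu> @ w) (u @ w)" if "u \<in> level 2" for u
      using lev2[OF that] E4 unfolding eventually_locrel_def by blast
  qed (rule finite_level, rule that, blast)
  \<comment> \<open>Letters of \<open>\<mu>\<close> are deleted from the front; what follows is at
    least as long as \<open>w\<close>, so the one depth \<open>k0\<close> serves every step.\<close>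
  have A: "locrel h (?\<nu> @ \<mu> @ w) (?\<nu> @ w)" if "\<mu> \<in> words n" "w \<in> words n" "k0 \<le> length w" for \<mu> w
    using that(1)
  proof (induction \<mu>)
    case Nil
    have "locrel h (?\<nu> @ w) ((?\<nu> @ [Plain 0]) @ w)" using k0[of 0 "length w"] that n2 by simp
    then show ?case using locrel_sym locrel_trans by (metis append_Nil)
  next
    case (Cons i \<mu>)
    then obtain c where c: "i = Plain c" "c < n" "\<mu> \<in> words n" by (auto simp: Cons_words)
    then have "\<mu> @ w \<in> words n" using that by (simp add: append_words)
    then have "locrel h (?\<nu> @ (\<mu> @ w)) ((?\<nu> @ [Plain c]) @ (\<mu> @ w))"
      using k0[of c "length (\<mu> @ w)"] c(2) that(3) by simp
    then have "locrel h (?\<nu> @ (i # \<mu>) @ w) (?\<nu> @ \<mu> @ w)" using c(1) locrel_sym by simp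
    then show ?case using Cons.IH[OF c(3)] locrel_trans by blast
  qed
  have B: "locrel h (u @ w) (?\<nu> @ w)" if u: "u \<in> W" "2 \<le> length u" and w: "w \<in> words n" "k0 + k1 \<le> length w" for u w
  proof -
    let ?p = "take 2 u" and ?\<mu> = "drop 2 u"
    have p0: "?p \<noteq> []" using u(2) by (cases u) auto
    have "?p @ ?\<mu> \<in> W" using u by simp
    then have "?p \<in> W" "?\<mu> \<in> words n" using append_W[OF p0] by blast+
    then have "?p \<in> level 2" "?\<mu> @ w \<in> words n" using u w by (auto simp: level_def append_words)
    then have "locrel h (?\<nu> @ (?\<mu> @ w)) (?p @ (?\<mu> @ w))"
      using k1[of ?p "length (?\<mu> @ w)"] w(2) by simp
    then have "locrel h (?p @ ?\<mu> @ w) (?\<nu> @ ?\<mu> @ w)" by (rule locrel_sym)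
    moreover have "?p @ ?\<mu> @ w = u @ w" by (metis append_assoc append_take_drop_id)
    moreover have "locrel h (?\<nu> @ ?\<mu> @ w) (?\<nu> @ w)" using A[OF \<open>?\<mu> \<in> words n\<close> w(1)] w(2) by simp
    ultimately show ?thesis using locrel_trans by metis
  qed
  \<comment> \<open>The extra letter covers words of length one: the first letter of
    \<open>w\<close> is handed over to reach length two.\<close>
  have "locrel h (u @ w) (v @ w)" if uv: "u \<in> W" "v \<in> W" and w: "w \<in> words n" "Suc (k0 + k1) \<le> length w" for u v w
  proof -
    obtain i w' where iw: "w = i # w'" using w(2) by (cases w) auto
    have i: "i \<in> alphabet n" "w' \<in> words n" "k0 + k1 \<le> length w'" using w iw by (auto simp: Cons_words)
    have "locrel h ((x @ [i]) @ w') (?\<nu> @ w')" if "x \<in> W" for x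
    proof (rule B)
      show "x @ [i] \<in> W" using that i(1) by (intro append_WI) (auto simp: Cons_words)
      show "2 \<le> length (x @ [i])" using that by (cases x) auto
    qed (use i in auto)
    then have "locrel h (u @ w) (?\<nu> @ w')" "locrel h (v @ w) (?\<nu> @ w')" using uv iw by auto
    then show ?thesis using locrel_sym locrel_trans by blast
  qed
  then show ?thesis unfolding sync_map_def by blast
qed

text \<open>Near \<open>h x\<close> the conjugate is a prefix replacement: if \<open>g\<close> replaces \<open>u\<close> by \<open>v\<close> near \<open>x\<close>
  and \<open>w\<close> is synchronizing, then \<open>h\<close> acts on \<open>u w\<close> and \<open>v w\<close> through the same local map.\<close>

lemma sync_map_conj:
  assumes h: "h \<in> H" and sync: "sync_map h" and g: "g \<in> T"
  shows "local_prefix_map (conjugate h g)"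
  unfolding local_prefix_map_def
proof
  fix y assume y: "y \<in> C"
  define k where "k = homeo_inv n r h"
  have kh: "k \<in> H" using homeo_inv_homeos[OF h] by (simp add: k_def)
  have hk: "h (k y) = y" "k y \<in> C" if "y \<in> C" for y
    using homeo_inv_right[OF h that] homeos_closed[OF kh that] by (simp_all add: k_def)
  have conjugate: "conjugate h g y = h (g (k y))" if "y \<in> C" for y
    using that homeo_inv_closed[OF h that] by (simp add: conjugate_def compose_def k_def)
  obtain d where d: "\<And>w u v. w \<in> words n \<Longrightarrow> d \<le> length w \<Longrightarrow> u \<in> W \<Longrightarrow> v \<in> W \<Longrightarrow> locrel h (u @ w) (v @ w)"
    using sync unfolding sync_map_def by metis
  obtain u v where u: "u \<in> W" "v \<in> W" "has_prefix u (k y)" "\<And>z. z \<in> D \<Longrightarrow> g (u @- z) = v @- z"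
    using g hk(2)[OF y] unfolding T_elements_iff local_prefix_map_def by metis
  obtain x0 where x0: "x0 \<in> D" "k y = u @- x0" using C_has_prefix[OF hk(2)[OF y] u(1,3)] by blast
  define w where "w = stake d x0"
  have w: "w \<in> words n" "length w = d" using x0 stake_words by (auto simp: w_def)
  obtain a b f where f: "a \<in> W" "b \<in> W" "\<And>x. x \<in> D \<Longrightarrow> h ((u @ w) @- x) = a @- f x \<and> h ((v @ w) @- x) = b @- f x"
    using d[OF w(1) _ u(1,2)] w(2) unfolding locrel_def by force
  have uw: "u @ w \<in> W" using append_WI[OF u(1) w(1)] .
  have ky: "k y = (u @ w) @- sdrop d x0" "sdrop d x0 \<in> D"
    using x0 sdrop_DD by (simp_all add: w_def stake_sdrop)
  have ya: "has_prefix a y" using f(3)[OF ky(2)] hk(1)[OF y] ky(1) by (metis has_prefix_shift)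
  obtain l where l: "\<forall>y'\<in>C. stake l y' = stake l y \<longrightarrow> stake (length (u @ w)) (k y') = stake (length (u @ w)) (k y)"
    using homeos_continuous[OF kh y] by blast
  \<comment> \<open>Long enough to contain \<open>a\<close> and, by continuity of the inverse, to
    force the preimage under \<open>h\<close> into the cone of \<open>u @ w\<close>.\<close>
  define \<eta> where "\<eta> = stake (l + length a) y"
  have "0 < length a" using f(1) by (cases a) auto
  then have \<eta>W: "\<eta> \<in> W" using stake_W[OF y] by (simp add: \<eta>_def)
  have "prefix a \<eta>" using ya by (simp add: \<eta>_def prefix_stake)
  then obtain s where s: "\<eta> = a @ s" by (auto simp: prefix_def)
  then have sw: "s \<in> words n" using \<eta>W f(1) append_W by (metis Nil_W)
  have "conjugate h g (\<eta> @- z) = (b @ s) @- z" if z: "z \<in> D" for z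
  proof -
    let ?y = "\<eta> @- z"
    have yC: "?y \<in> C" using shift_CI[OF \<eta>W z] .
    have "stake l ?y = stake l y" by (simp add: \<eta>_def stake_shift take_stake)
    then have "stake (length (u @ w)) (k ?y) = stake (length (u @ w)) (k y)" using l yC by blast
    also have "\<dots> = u @ w" unfolding ky(1) by (subst stake_shift) simp
    finally have "has_prefix (u @ w) (k ?y)" by (simp add: has_prefix_def)
    then obtain x where x: "x \<in> D" "k ?y = (u @ w) @- x" using C_has_prefix[OF hk(2)[OF yC] uw] by blast
    have "a @- s @- z = a @- f x" using f(3)[OF x(1)] hk(1)[OF yC] x(2) s by simp
    then have fx: "f x = s @- z" by simp
    have "w @- x \<in> D" using w(1) x(1) shift_D by blast
    then have "g (k ?y) = (v @ w) @- x" using u(4) x(2) by simp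
    then show ?thesis using conjugate[OF yC] f(3)[OF x(1)] fx by simp
  qed
  moreover have "has_prefix \<eta> y" by (simp add: \<eta>_def)
  ultimately show "\<exists>u\<in>W. \<exists>v\<in>W. has_prefix u y \<and> (\<forall>z\<in>D. conjugate h g (u @- z) = v @- z)"
    using \<eta>W append_WI[OF f(2) sw] by blast
qed

lemma sync_map_conj_T:
  assumes h: "h \<in> H" "preserves_circle_eq n r h" "sync_map h" and g: "g \<in> T"
  shows "conjugate h g \<in> T"
proof -
  have "preserves_circle_eq n r (conjugate h g)"
    unfolding conjugate_def using h g
    by (intro preserves_circle_eq_compose preserves_circle_eq_inv) (auto simp: T_elements_iff)
  then show ?thesis
    using conjugate_homeos[OF h(1) T_homeos[OF g]] sync_map_conj[OF h(1,3) g] by (simp add: T_elements_iff)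
qed

text \<open>A synchronizing \<open>h\<close> conjugates \<open>T\<close> into \<open>T\<close>, and
  its synchronizing inverse gives the other inclusion. Conversely \<open>T_normalizer\<close> is
  closed under inverses, so \<open>T_normalizer_sync\<close> applies to \<open>h\<close> and to its
  inverse.\<close>

lemma TB_elements_eq: "TB_elements n r = T_normalizer"
proof (intro equalityI subsetI)
  fix h assume "h \<in> TB_elements n r"
  then have h: "h \<in> H" "preserves_circle_eq n r h" "sync_map h" "sync_map (homeo_inv n r h)"
    by (auto simp: TB_elements_iff)
  let ?k = "homeo_inv n r h"
  have k: "?k \<in> H" "preserves_circle_eq n r ?k"
    using homeo_inv_homeos preserves_circle_eq_inv h by auto
  have "\<exists>g'\<in>T. \<forall>x\<in>C. h (g x) = g' (h x)" if g: "g \<in> T" for g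
    using sync_map_conj_T[OF h(1-3) g] conjugate_apply[OF h(1)] by (intro bexI[of _ "conjugate h g"]) auto
  moreover have "\<exists>g'\<in>T. \<forall>x\<in>C. h (g' x) = g (h x)" if g: "g \<in> T" for g
  proof (intro bexI[of _ "conjugate ?k g"] ballI)
    show "conjugate ?k g \<in> T" using sync_map_conj_T[OF k h(4) g] .
    fix x assume x: "x \<in> C"
    have "conjugate ?k g (?k (h x)) = ?k (g (h x))" using conjugate_apply[OF k(1)] homeos_closed[OF h(1) x] by blast
    then show "h (conjugate ?k g x) = g (h x)"
      using homeo_inv_left[OF h(1) x] homeo_inv_right[OF h(1)] T_closed[OF g] homeos_closed[OF h(1) x] by simp
  qed
  ultimately show "h \<in> T_normalizer" unfolding T_normalizer_def using h(1,2) by blast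
next
  fix h assume h: "h \<in> T_normalizer"
  then show "h \<in> TB_elements n r"
    using T_normalizer_sync[OF h] T_normalizer_sync[OF T_normalizer_inv[OF h]] T_normalizerD(1,2)[OF h]
    by (simp add: TB_elements_iff)
qed

lemma carrier_TB [simp]: "carrier (TB_group n r) = T_normalizer"
  by (simp add: TB_group_def TB_elements_eq)

lemma subgroup_TB: "subgroup T_normalizer (BijGroup C)"
proof (rule subgroup.intro)
  have Bij: "h \<in> Bij C" if "h \<in> T_normalizer" for h using homeos_Bij T_normalizerD(1) that by blast
  then show "T_normalizer \<subseteq> carrier (BijGroup C)" by (auto simp: BijGroup_def)
  show "x \<otimes>\<^bsub>BijGroup C\<^esub> y \<in> T_normalizer" if "x \<in> T_normalizer" "y \<in> T_normalizer" for x y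
    using that T_normalizer_compose Bij by (simp add: BijGroup_def)
  show "\<one>\<^bsub>BijGroup C\<^esub> \<in> T_normalizer" using id_T_normalizer by (simp add: BijGroup_def)
  show "inv\<^bsub>BijGroup C\<^esub> x \<in> T_normalizer" if "x \<in> T_normalizer" for x
    using T_normalizer_inv[OF that] inv_BijGroup[OF Bij[OF that]] by (simp add: homeo_inv_def)
qed

lemma group_TB: "group (TB_group n r)"
  unfolding TB_group_def TB_elements_eq by (rule subgroup.subgroup_is_group[OF subgroup_TB group_BijGroup])

lemma mult_TB: "h \<in> T_normalizer \<Longrightarrow> k \<in> T_normalizer \<Longrightarrow> h \<otimes>\<^bsub>TB_group n r\<^esub> k = compose C h k"
  using homeos_Bij T_normalizerD(1) by (simp add: TB_group_def BijGroup_def)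

section \<open>Conjugation as an isomorphism onto the automorphism group\<close>

definition conjugate_auto :: "(letter stream \<Rightarrow> letter stream) \<Rightarrow> (letter stream \<Rightarrow> letter stream) \<Rightarrow> letter stream \<Rightarrow> letter stream" where
  "conjugate_auto h = restrict (conjugate h) (T)"

lemma conjugate_T:
  assumes "h \<in> T_normalizer" "g \<in> T"
  shows "conjugate h g \<in> T"
proof -
  obtain g' where "g' \<in> T" "\<forall>x\<in>C. h (g x) = g' (h x)" using T_normalizerD(3) assms by blast
  then show ?thesis using conjugate_eqI T_homeos assms T_normalizerD(1) by metis
qed

lemma conjugate_compose:
  assumes h: "h \<in> H" and g: "f \<in> H" "g \<in> H"
  shows "conjugate h (compose C f g) = compose C (conjugate h f) (conjugate h g)"
proof (rule conjugate_eqI[OF h compose_homeos[OF g] compose_homeos[OF conjugate_homeos[OF h g(1)] conjugate_homeos[OF h g(2)]]])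
  fix x assume "x \<in> C"
  then show "h (compose C f g x) = compose C (conjugate h f) (conjugate h g) (h x)"
    using conjugate_apply[OF h] homeos_closed[OF h] homeos_closed[OF g(2)] by (simp add: compose_def)
qed

lemma conjugate_conj:
  assumes h: "h \<in> H" "k \<in> H" and g: "g \<in> H"
  shows "conjugate (compose C h k) g = conjugate h (conjugate k g)"
proof (rule conjugate_eqI[OF compose_homeos[OF h] g conjugate_homeos[OF h(1) conjugate_homeos[OF h(2) g]]])
  fix x assume "x \<in> C"
  then show "compose C h k (g x) = conjugate h (conjugate k g) (compose C h k x)"
    using conjugate_apply[OF h(1)] conjugate_apply[OF h(2)] homeos_closed[OF h(2)] homeos_closed[OF g]
    by (simp add: compose_def)
qed

lemma conjugate_inv:
  assumes h: "h \<in> H" and g: "g \<in> H"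
  shows "conjugate (homeo_inv n r h) (conjugate h g) = g" "conjugate h (conjugate (homeo_inv n r h) g) = g"
proof -
  have k: "homeo_inv n r h \<in> H" using homeo_inv_homeos[OF h] .
  have *: "conjugate (homeo_inv n r h) (conjugate h g) = g" if h: "h \<in> H" for h
  proof (rule conjugate_eqI[OF homeo_inv_homeos[OF h] conjugate_homeos[OF h g] g])
    fix x assume x: "x \<in> C"
    then obtain y where "y \<in> C" "x = h y" using homeos_surj[OF h] by blast
    then show "homeo_inv n r h (conjugate h g x) = g (homeo_inv n r h x)"
      using conjugate_apply[OF h] homeo_inv_left[OF h] homeos_closed[OF g] by simp
  qed
  show "conjugate (homeo_inv n r h) (conjugate h g) = g" using *[OF h] .
  show "conjugate h (conjugate (homeo_inv n r h) g) = g" using *[OF k] homeo_inv_involutive[OF h] by simp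
qed

lemma conjugate_auto_auto:
  assumes h: "h \<in> T_normalizer"
  shows "conjugate_auto h \<in> auto (T_group n r)"
proof -
  note hh = T_normalizerD(1)[OF h]
  have k: "homeo_inv n r h \<in> T_normalizer" using T_normalizer_inv[OF h] .
  have "bij_betw (conjugate_auto h) (T) (T)"
  proof (rule bij_betw_byWitness[where f' = "conjugate (homeo_inv n r h)"])
    show "\<forall>g\<in>T. conjugate (homeo_inv n r h) (conjugate_auto h g) = g"
      using conjugate_inv(1)[OF hh T_homeos] by (simp add: conjugate_auto_def)
    show "\<forall>g\<in>T. conjugate_auto h (conjugate (homeo_inv n r h) g) = g"
      using conjugate_inv(2)[OF hh T_homeos] conjugate_T[OF k] by (simp add: conjugate_auto_def)
    show "conjugate_auto h ` T \<subseteq> T" using conjugate_T[OF h] by (auto simp: conjugate_auto_def)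
    show "conjugate (homeo_inv n r h) ` T \<subseteq> T" using conjugate_T[OF k] by auto
  qed
  moreover have "conjugate_auto h \<in> hom (T_group n r) (T_group n r)"
  proof (rule homI)
    fix f g assume "f \<in> carrier (T_group n r)" "g \<in> carrier (T_group n r)"
    then have fg: "f \<in> T" "g \<in> T" by auto
    show "conjugate_auto h f \<in> carrier (T_group n r)" using fg conjugate_T[OF h] by (simp add: conjugate_auto_def)
    show "conjugate_auto h (f \<otimes>\<^bsub>T_group n r\<^esub> g) = conjugate_auto h f \<otimes>\<^bsub>T_group n r\<^esub> conjugate_auto h g"
      using fg T_compose[OF fg] conjugate_T[OF h] conjugate_compose[OF hh T_homeos T_homeos, OF fg]
      by (simp add: conjugate_auto_def mult_T)
  qed
  ultimately show ?thesis by (simp add: auto_def Bij_def conjugate_auto_def)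
qed

lemma conjugate_auto_hom: "conjugate_auto \<in> hom (TB_group n r) (AutoGroup (T_group n r))"
proof (rule homI)
  fix h k assume "h \<in> carrier (TB_group n r)" "k \<in> carrier (TB_group n r)"
  then have hk: "h \<in> T_normalizer" "k \<in> T_normalizer" by auto
  show "conjugate_auto h \<in> carrier (AutoGroup (T_group n r))"
    using conjugate_auto_auto[OF hk(1)] by (simp add: AutoGroup_def)
  have Bij: "conjugate_auto h \<in> Bij (T)" "conjugate_auto k \<in> Bij (T)"
    using conjugate_auto_auto hk by (auto simp: auto_def)
  have "conjugate_auto (compose C h k) = compose (T) (conjugate_auto h) (conjugate_auto k)"
  proof
    fix g
    show "conjugate_auto (compose C h k) g = compose (T) (conjugate_auto h) (conjugate_auto k) g"
      using conjugate_conj[OF T_normalizerD(1) T_normalizerD(1) T_homeos, OF hk] conjugate_T[OF hk(2)]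
      by (simp add: conjugate_auto_def compose_def)
  qed
  then show "conjugate_auto (h \<otimes>\<^bsub>TB_group n r\<^esub> k) = conjugate_auto h \<otimes>\<^bsub>AutoGroup (T_group n r)\<^esub> conjugate_auto k"
    using mult_TB[OF hk] Bij by (simp add: AutoGroup_def BijGroup_def)
qed

text \<open>Two homeomorphisms with the same conjugation intertwine the action with the same
  automorphism, so \<open>equivariant_unique\<close> identifies them.\<close>

lemma conjugate_auto_inj: "inj_on conjugate_auto T_normalizer"
proof (rule inj_onI)
  fix h k assume hk: "h \<in> T_normalizer" "k \<in> T_normalizer" and eq: "conjugate_auto h = conjugate_auto k"
  note hh = T_normalizerD(1)[OF hk(1)] and kh = T_normalizerD(1)[OF hk(2)]
  have conjugate: "conjugate h g = conjugate k g" if "g \<in> T" for g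
    using fun_cong[OF eq, of g] that by (simp add: conjugate_auto_def)
  show "h = k"
  proof (rule homeos_eqI[OF hh kh])
    fix x assume x: "x \<in> C"
    show "h x = k x"
    proof (rule rubin_action.equivariant_unique[OF rubin_T, of h k "conjugate h"])
      show "homeomorphic_map X X h"
        "homeomorphic_map X X k"
        using hh kh by (auto simp: homeos_def)
      fix g assume "g \<in> carrier (T_group n r)"
      then have g: "g \<in> T" by simp
      then show "conjugate h g \<in> carrier (T_group n r)" using conjugate_T[OF hk(1)] by simp
      fix x assume "x \<in> topspace X"
      then have x: "x \<in> C" by simp
      show "h (g x) = conjugate h g (h x)" using conjugate_apply[OF hh x] by simp
      show "k (g x) = conjugate h g (k x)" using conjugate_apply[OF kh x] conjugate[OF g] by simp
    qed (use x in simp)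
  qed
qed

text \<open>A homeomorphism carrying stabilizers to stabilizers preserves \<open>\<simeq>\<close>, because two points
  are equivalent iff they have the same stabilizer.\<close>

lemma conjugate_auto_surj:
  assumes \<alpha>: "\<alpha> \<in> auto (T_group n r)"
  shows "\<exists>h\<in>T_normalizer. \<alpha> = conjugate_auto h"
proof -
  interpret rubin_action "T_group n r" "cantor_top n r" "\<lambda>g. g" by (rule rubin_T)
  obtain h0 where h0: "homeomorphic_map X X h0"
    "\<And>g x. \<lbrakk>g \<in> carrier (T_group n r); x \<in> topspace X\<rbrakk> \<Longrightarrow> h0 (g x) = \<alpha> g (h0 x)"
    using auto_spatial[OF \<alpha>] by metis
  define h where "h = restrict h0 C"
  have "homeomorphic_map X X h"
    by (rule homeomorphic_map_eq[OF h0(1)]) (simp add: h_def)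
  then have h: "h \<in> H" by (simp add: homeos_def h_def)
  have eq: "h (g x) = \<alpha> g (h x)" if "g \<in> T" "x \<in> C" for g x
    using h0(2)[of g x] that T_closed by (simp add: h_def)
  have \<alpha>T: "\<alpha> g \<in> T" if "g \<in> T" for g
    using auto_closed[OF \<alpha>, of g] that by simp
  have \<alpha>surj: "\<exists>g\<in>T. g' = \<alpha> g" if "g' \<in> T" for g'
    using bij_betw_imp_surj_on[OF auto_bij[OF \<alpha>]] that by (metis carrier_T imageE)
  have "preserves_circle_eq n r h"
  proof (rule preserves_circle_eqI)
    show "h x \<in> C" if "x \<in> C" for x using homeos_closed[OF h that] .
    fix x y assume xy: "nxt x y"
    then have C: "x \<in> C" "y \<in> C" using nxt_C by auto
    show "circle_eq n r (h x) (h y)"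
    proof (rule stabilizer_circle_eq)
      show "h x \<in> C" "h y \<in> C" using C homeos_closed[OF h] by auto
      fix g' assume "g' \<in> T"
      then obtain g where g: "g \<in> T" "g' = \<alpha> g" using \<alpha>surj by blast
      have "g' (h z) = h z \<longleftrightarrow> g z = z" if "z \<in> C" for z
        using eq[OF g(1) that] g(2) homeos_inj[OF h T_closed[OF g(1) that] that] by metis
      then show "g' (h x) = h x \<longleftrightarrow> g' (h y) = h y" using C stabilizer_nxt[OF g(1) xy] by blast
    qed
  qed
  moreover have "\<exists>g'\<in>T. \<forall>x\<in>C. h (g x) = g' (h x)" if "g \<in> T" for g
    using eq \<alpha>T that by blast
  moreover have "\<exists>g'\<in>T. \<forall>x\<in>C. h (g' x) = g (h x)" if "g \<in> T" for g
    using eq \<alpha>surj[OF that] by blast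
  ultimately have "h \<in> T_normalizer" unfolding T_normalizer_def using h by blast
  moreover have "\<alpha> = conjugate_auto h"
  proof (rule extensionalityI[of _ "T"])
    show "\<alpha> \<in> extensional (T)" using \<alpha> by (simp add: auto_def Bij_def)
    show "conjugate_auto h \<in> extensional (T)" by (simp add: conjugate_auto_def)
    fix g assume g: "g \<in> T"
    have "conjugate h g = \<alpha> g" using eq[OF g] by (intro conjugate_eqI h T_homeos g \<alpha>T)
    then show "\<alpha> g = conjugate_auto h g" using g by (simp add: conjugate_auto_def)
  qed
  ultimately show ?thesis by blast
qed

lemma AutoGroup_T_iso: "AutoGroup (T_group n r) \<cong> TB_group n r"
proof -
  have "conjugate_auto ` T_normalizer = auto (T_group n r)" using conjugate_auto_auto conjugate_auto_surj by blast
  then have "bij_betw conjugate_auto (carrier (TB_group n r)) (carrier (AutoGroup (T_group n r)))"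
    using conjugate_auto_inj by (simp add: bij_betw_def AutoGroup_def)
  then have "TB_group n r \<cong> AutoGroup (T_group n r)"
    using conjugate_auto_hom unfolding is_iso_def iso_def by blast
  then show ?thesis by (rule group.iso_sym[OF group_TB])
qed

end

theorem theorem1p1:
  fixes n r :: nat
  assumes "n \<ge> 2" and "1 \<le> r" and "r \<le> n - 1"
  shows "group (TB_group n r) \<and> AutoGroup (T_group n r) \<cong> TB_group n r"
proof -
  interpret cantor_params n r by unfold_locales (use assms in auto)
  show ?thesis using group_TB AutoGroup_T_iso by blast
qed

end
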